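(* Let $d\ge 1$, $k\ge 2$, $h\ge 2$ and $r\ge kh$ be fixed integers. Then: (1) For every $\varepsilon>0$ there is $n_0$ such that for all $n\ge n_0$ and every subset $A\subseteq [n]^d$ with $|A|\ge n^d-\frac{n^d}{\log n}$, $$(1-\varepsilon)\binom{r}{kh-1}(kh-1)^{|A|}\le g_r(A)\le (1+\varepsilon)\binom{r}{kh-1}(kh-1)^{|A|},$$ i.e. $g_r(A)=(1+o(1))\binom{r}{kh-1}(kh-1)^{|A|}$. (2) Moreover, for such $A$, all but an $o(1)$ proportion (as $n\to\infty$) of the $r$-colorings of $A$ without rainbow solutions to the $B_{k,h}$-equation use at most $kh-1$ distinct colors. (3) Furthermore, for all sufficiently large $n$, among all subsets $A\subseteq[n]^d$, the set $[n]^d$ is the unique subset maximizing $g_r(A)$; that is, $g_r(A)<g_r([n]^d)$ for every $A\subsetneq [n]^d$.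
   Context: For positive integers $n,d$, $[n]=\{1,\dots,n\}$ and $[n]^d$ is the $d$-dimensional grid, whose points are vectors in $\mathbb{Z}^d$ with all coordinates in $[n]$; addition is coordinatewise. For integers $k,h\ge2$, the $B_{k,h}$-equation is $\sum_{i=1}^h x_{1,i}=\sum_{i=1}^h x_{2,i}=\cdots=\sum_{i=1}^h x_{k,i}$ in $kh$ points $x_{\ell,i}$ ($\ell\in[k],i\in[h]$). An $r$-coloring of $A\subseteq[n]^d$ is a map $c:A\to[r]$. A solution (in $A$) is rainbow under $c$ if the colors $c(x_{\ell,i})$, $\ell\in[k],i\in[h]$, are pairwise distinct (so in particular the $kh$ points are pairwise distinct). For $r\ge kh$, $g_r(A)$ denotes the number of $r$-colorings of $A$ with no rainbow solution to the $B_{k,h}$-equation. Logarithms are base 2. *)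

theory Defs
  imports "HOL-Analysis.Finite_Cartesian_Product" "HOL-Library.FuncSet" Complex_Main
begin

text \<open>The dimension d is the cardinality of the index type \<open>'d\<close>.\<close>

definition grid :: "nat \<Rightarrow> (int ^ 'd) set" where
  "grid n = {x. \<forall>j. x $ j \<in> {1..int n}}"

text \<open>The points of a solution need not be distinct here; for rainbow solutions distinctness
  follows from that of the colors.\<close>

definition B_solution :: "nat \<Rightarrow> nat \<Rightarrow> (int ^ 'd) set \<Rightarrow> (nat \<Rightarrow> nat \<Rightarrow> int ^ 'd) \<Rightarrow> bool" where
  "B_solution k h A x \<longleftrightarrow>
     (\<forall>l\<in>{1..k}. \<forall>i\<in>{1..h}. x l i \<in> A) \<and>
     (\<forall>l\<in>{1..k}. \<forall>m\<in>{1..k}. (\<Sum>i=1..h. x l i) = (\<Sum>i=1..h. x m i))"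

definition rainbow ::
  "nat \<Rightarrow> nat \<Rightarrow> (int ^ 'd \<Rightarrow> nat) \<Rightarrow> (nat \<Rightarrow> nat \<Rightarrow> int ^ 'd) \<Rightarrow> bool" where
  "rainbow k h c x \<longleftrightarrow> inj_on (\<lambda>(l, i). c (x l i)) ({1..k} \<times> {1..h})"

text \<open>Colorings are extensional functions, so that each map from A to [r] is counted once.\<close>

definition rainbow_free_colorings ::
  "nat \<Rightarrow> nat \<Rightarrow> nat \<Rightarrow> (int ^ 'd) set \<Rightarrow> (int ^ 'd \<Rightarrow> nat) set" where
  "rainbow_free_colorings k h r A =
     {c \<in> A \<rightarrow>\<^sub>E {1..r}. \<not> (\<exists>x. B_solution k h A x \<and> rainbow k h c x)}"

definition num_rainbow_free :: "nat \<Rightarrow> nat \<Rightarrow> nat \<Rightarrow> (int ^ 'd) set \<Rightarrow> nat" where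
  "num_rainbow_free k h r A = card (rainbow_free_colorings k h r A)"

end

theory Submission
  imports Defs "HOL-Analysis.Convex" "HOL-Library.Indicator_Function"
begin

text \<open>
  Write \<open>s = k h\<close> and \<open>N = n ^ d\<close>. For a fixed set in every other slot, the number of solutions with \<open>x\<close> in a
  given slot is, after normalization, a correlation \<open>u(x) = (1/N) \<Sum>y. f(y) W(x + y)\<close> of functions with values in \<open>[0,1]\<close>;
  here \<open>h \<ge> 2\<close> is used. Rounding \<open>f\<close> and \<open>W\<close> to multiples of indicators of sparse sets shows that
  all such functions lie close in \<open>L\<^sup>1\<close> to a family of only \<open>exp(o(N))\<close> functions. If \<open>(D\<^sub>p)\<close> admits no solution,
  one replaces the sets slot by slot by the places where the approximate number of completions is small;
  the result comes from a family of size \<open>exp(o(N))\<close>, contains almost all of each \<open>D\<^sub>p\<close>, and admits few solutions.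

  Applied to the color classes, this places a rainbow-free coloring, up to \<open>o(N)\<close> points, inside one of
  \<open>exp(o(N))\<close> templates, i.e. assignments of lists of colors to points with few rainbow solutions.
  By convexity such a template has few lists of size at least \<open>s\<close>, and at most one list of size \<open>s - 1\<close>
  occurs often. Hence colorings that are not close to using a single palette of \<open>s - 1\<close> colors
  are exponentially rare compared to \<open>(s-1) ^ |A|\<close>. If a coloring is close to a palette but gives some \<open>y\<close> a
  color outside it, then each of linearly many solutions through \<open>y\<close>, disjoint apart from \<open>y\<close>, forbids a
  pattern on its remaining points, so these colorings are exponentially rare as well.
  All this works for \<open>|A| \<ge> (1 - \<delta>) N\<close> with a constant \<open>\<delta>\<close>, and for smaller \<open>A\<close> the template bound alone
  beats \<open>(s-1) ^ N\<close>.
\<close>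

text \<open>A color class may be any of about 2^N sets, so a union bound over color classes proves
  nothing. What makes a family of size exp(o(N)) possible is that a degree is an average over order
  N many values of y and can be estimated by sampling. A random set of density about \<gamma>
  reproduces all degrees with total squared error O(1/\<gamma>^3), far below the \<epsilon>^2 N that
  is tolerated, while the number of such sets is at most b^N with b close to 1 for small \<gamma>.
  Convexity only compares configurations that use the same set in all slots of a column. This is why
  templates are tested with one set \<open>B i\<close> per column, and why two popular lists are
  played off against each other by giving each of them whole columns. Constants are fixed backwards.
  The fraction \<beta> of points off every palette yields an exponential gain; b is then taken so
  close to 1 that all choices together cost only the square root of that gain; the densities
  \<delta> and \<eta> of the templates come last.\<close>

section \<open>Sparse approximation of correlations\<close>

text \<open>If each y enters F independently with probability \<open>\<gamma> * f y\<close>, then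
  \<open>indicator F y / \<gamma>\<close> has mean \<open>f y\<close> and variance at most
  \<open>1 / \<gamma>\<close>, so the expected squared error is at most the right-hand side. The
  induction is the method of conditional expectations: decide y so that the error grows by no more
  than its mean.\<close>

lemma sparse_rounding:
  fixes v :: "'a \<Rightarrow> 'b \<Rightarrow> real"
  assumes "finite Y" "\<And>y. y \<in> Y \<Longrightarrow> 0 \<le> f y \<and> f y \<le> 1" "0 < \<gamma>" "\<gamma> \<le> 1"
  shows "\<exists>F\<subseteq>Y. (\<Sum>x\<in>X. (\<Sum>y\<in>Y. (indicator F y / \<gamma> - f y) * v y x)\<^sup>2)
           \<le> (\<Sum>y\<in>Y. \<Sum>x\<in>X. (v y x)\<^sup>2) / \<gamma>"
  using assms(1,2)
proof (induction Y rule: finite_induct)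
  case empty
  then show ?case by simp
next
  case (insert y Y)
  obtain F where F: "F \<subseteq> Y"
    "(\<Sum>x\<in>X. (\<Sum>y\<in>Y. (indicator F y / \<gamma> - f y) * v y x)\<^sup>2) \<le> (\<Sum>y\<in>Y. \<Sum>x\<in>X. (v y x)\<^sup>2) / \<gamma>"
    using insert by auto
  define w where "w x = (\<Sum>y\<in>Y. (indicator F y / \<gamma> - f y) * v y x)" for x
  define p where "p = (\<Sum>x\<in>X. w x * v y x)"
  define c where "c = (\<Sum>x\<in>X. (v y x)\<^sup>2)"
  have c0: "c \<ge> 0" unfolding c_def by (simp add: sum_nonneg)
  have ex: "(\<Sum>x\<in>X. (w x + t * v y x)\<^sup>2) = (\<Sum>x\<in>X. (w x)\<^sup>2) + 2 * t * p + t\<^sup>2 * c" for t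
    unfolding p_def c_def by (simp add: power2_sum sum.distrib sum_distrib_left algebra_simps power_mult_distrib)
  have fy: "0 \<le> f y" "f y \<le> 1" using insert.prems by auto
  \<comment> \<open>The two possible coefficients of \<open>v y\<close>, for y in F and y not in F.
    With weights \<open>\<gamma> * f y\<close> and \<open>1 - \<gamma> * f y\<close> they have mean
    0, so the term linear in p cancels in \<open>mean\<close>.\<close>
  define t1 where "t1 = 1 / \<gamma> - f y"
  define t2 where "t2 = - f y"
  have mean: "\<gamma> * f y * (2 * t1 * p + t1\<^sup>2 * c) + (1 - \<gamma> * f y) * (2 * t2 * p + t2\<^sup>2 * c) = c * (f y / \<gamma> - (f y)\<^sup>2)"
    using assms(3) unfolding t1_def t2_def by (simp add: field_simps power2_eq_square)
  have "c * (f y / \<gamma> - (f y)\<^sup>2) \<le> c * (1 / \<gamma>)"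
    using fy assms(3) by (intro mult_left_mono[OF _ c0]) (smt (verit) divide_right_mono zero_le_power2)
  then have mean_le: "\<gamma> * f y * (2 * t1 * p + t1\<^sup>2 * c) + (1 - \<gamma> * f y) * (2 * t2 * p + t2\<^sup>2 * c) \<le> c / \<gamma>"
    using mean by simp
  have wt: "0 \<le> \<gamma> * f y" "\<gamma> * f y \<le> 1"
    using fy assms(3,4) by (auto simp: mult_le_one)
  have "2 * t1 * p + t1\<^sup>2 * c \<le> c / \<gamma> \<or> 2 * t2 * p + t2\<^sup>2 * c \<le> c / \<gamma>"
  proof (rule ccontr)
    assume "\<not> ?thesis"
    then have "c / \<gamma> < \<gamma> * f y * (2 * t1 * p + t1\<^sup>2 * c) + (1 - \<gamma> * f y) * (2 * t2 * p + t2\<^sup>2 * c)"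
      using wt convex_bound_lt[of "-(2 * t1 * p + t1\<^sup>2 * c)" "-(c/\<gamma>)" "-(2 * t2 * p + t2\<^sup>2 * c)" "\<gamma> * f y" "1 - \<gamma> * f y"]
      by (simp add: algebra_simps)
    then show False using mean_le by simp
  qed
  then obtain t where t: "t = t1 \<or> t = t2" "2 * t * p + t\<^sup>2 * c \<le> c / \<gamma>" by blast
  have "\<exists>F'\<subseteq>insert y Y. (\<Sum>x\<in>X. (\<Sum>y\<in>insert y Y. (indicator F' y / \<gamma> - f y) * v y x)\<^sup>2) = (\<Sum>x\<in>X. (w x + t * v y x)\<^sup>2)"
  proof -
    define F' where "F' = (if t = t1 then insert y F else F)"
    have yF: "y \<notin> F" using F insert by auto
    have t12: "t1 \<noteq> t2" using assms(3) by (simp add: t1_def t2_def)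
    have "(\<Sum>y\<in>Y. (indicator F' y / \<gamma> - f y) * v y x) = w x" for x
      unfolding w_def F'_def using insert by (intro sum.cong) (auto simp: indicator_def)
    moreover have "indicator F' y / \<gamma> - f y = t"
      using t(1) yF t12 unfolding F'_def t1_def t2_def by auto
    ultimately show ?thesis using insert F
      by (intro exI[of _ F']) (auto simp: F'_def add.commute)
  qed
  then obtain F' where F': "F' \<subseteq> insert y Y"
    "(\<Sum>x\<in>X. (\<Sum>y\<in>insert y Y. (indicator F' y / \<gamma> - f y) * v y x)\<^sup>2) = (\<Sum>x\<in>X. (w x + t * v y x)\<^sup>2)"
    by blast
  have "(\<Sum>x\<in>X. (w x)\<^sup>2) \<le> (\<Sum>y\<in>Y. \<Sum>x\<in>X. (v y x)\<^sup>2) / \<gamma>"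
    using F unfolding w_def by simp
  moreover have "(\<Sum>y\<in>insert y Y. \<Sum>x\<in>X. (v y x)\<^sup>2) / \<gamma> = c / \<gamma> + (\<Sum>y\<in>Y. \<Sum>x\<in>X. (v y x)\<^sup>2) / \<gamma>"
    using insert by (simp add: c_def add_divide_distrib)
  ultimately have "(\<Sum>x\<in>X. (w x + t * v y x)\<^sup>2) \<le> (\<Sum>y\<in>insert y Y. \<Sum>x\<in>X. (v y x)\<^sup>2) / \<gamma>"
    using ex[of t] t(2) by linarith
  then show ?case using F' by (intro exI[of _ F']) simp
qed

text \<open>An additional coordinate of weight \<open>1/sqrt N\<close> controls the size of the rounded set.\<close>

lemma sparse_rounding_small:
  fixes v :: "'a \<Rightarrow> 'b \<Rightarrow> real" and N K B :: real
  assumes "finite Y" and f: "\<And>y. y \<in> Y \<Longrightarrow> 0 \<le> f y \<and> f y \<le> 1" and g: "0 < \<gamma>" "\<gamma> \<le> 1"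
    and X: "finite X" and N: "N > 0" and cY: "real (card Y) \<le> K * N"
    and v: "\<And>y. y \<in> Y \<Longrightarrow> (\<Sum>x\<in>X. (v y x)\<^sup>2) \<le> B / N"
    and B: "0 \<le> B" "1 + B \<le> \<gamma> * K * N"
  shows "\<exists>F\<subseteq>Y. real (card F) \<le> 2 * \<gamma> * K * N \<and>
    (\<Sum>x\<in>X. (\<Sum>y\<in>Y. (indicator F y / \<gamma> - f y) * v y x)\<^sup>2) \<le> K * (1 + B) / \<gamma>"
proof -
  define v' where "v' y z = (case z of None \<Rightarrow> 1 / sqrt N | Some x \<Rightarrow> v y x)" for y z
  define X' where "X' = insert None (Some ` X)"
  have sX: "(\<Sum>z\<in>X'. q z) = q None + (\<Sum>x\<in>X. q (Some x))" for q :: "'b option \<Rightarrow> real"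
    unfolding X'_def using X by (subst sum.insert) (auto simp: sum.reindex)
  obtain F where F: "F \<subseteq> Y" "(\<Sum>x\<in>X'. (\<Sum>y\<in>Y. (indicator F y / \<gamma> - f y) * v' y x)\<^sup>2)
           \<le> (\<Sum>y\<in>Y. \<Sum>x\<in>X'. (v' y x)\<^sup>2) / \<gamma>"
    using sparse_rounding[OF assms(1) _ g, where X = X' and v = v' and f = f] f by auto
  have "(\<Sum>y\<in>Y. \<Sum>x\<in>X'. (v' y x)\<^sup>2) \<le> (\<Sum>y\<in>Y. (1 + B) / N)"
    using v N by (intro sum_mono) (auto simp: sX v'_def power_divide add_divide_distrib)
  also have "\<dots> = real (card Y) * ((1 + B) / N)" by simp
  also have "\<dots> \<le> (K * N) * ((1 + B) / N)" using cY B N by (intro mult_right_mono) auto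
  finally have "(\<Sum>y\<in>Y. \<Sum>x\<in>X'. (v' y x)\<^sup>2) \<le> K * (1 + B)" using N by simp
  then have "(\<Sum>y\<in>Y. \<Sum>x\<in>X'. (v' y x)\<^sup>2) / \<gamma> \<le> K * (1 + B) / \<gamma>"
    using g by (simp add: divide_right_mono)
  then have le: "(\<Sum>y\<in>Y. (indicator F y / \<gamma> - f y) * (1 / sqrt N))\<^sup>2 +
      (\<Sum>x\<in>X. (\<Sum>y\<in>Y. (indicator F y / \<gamma> - f y) * v y x)\<^sup>2) \<le> K * (1 + B) / \<gamma>"
    using F(2) by (simp add: sX v'_def)
  moreover have "(\<Sum>x\<in>X. (\<Sum>y\<in>Y. (indicator F y / \<gamma> - f y) * v y x)\<^sup>2) \<ge> 0"
    by (simp add: sum_nonneg)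
  ultimately have "(\<Sum>y\<in>Y. (indicator F y / \<gamma> - f y) * (1 / sqrt N))\<^sup>2 \<le> K * (1 + B) / \<gamma>" by linarith
  \<comment> \<open>The extra coordinate of the error measures how far the size of F is from its
    expected value \<open>\<gamma> * sum f Y\<close>.\<close>
  moreover have "(\<Sum>y\<in>Y. (indicator F y / \<gamma> - f y) * (1 / sqrt N)) = (card F / \<gamma> - sum f Y) / sqrt N"
  proof -
    have "(\<Sum>y\<in>Y. indicator F y :: real) = card F"
      using F(1) assms(1) by (simp add: indicator_def sum.If_cases Int_absorb1 Collect_mem_eq)
    then show ?thesis
      by (simp add: sum_subtractf diff_divide_distrib flip: sum_distrib_right sum_divide_distrib)
  qed
  ultimately have "((card F / \<gamma> - sum f Y) / sqrt N)\<^sup>2 \<le> K * (1 + B) / \<gamma>" by simp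
  then have "(card F / \<gamma> - sum f Y)\<^sup>2 \<le> K * (1 + B) / \<gamma> * N"
    using N by (simp add: power_divide divide_le_eq)
  \<comment> \<open>The assumption \<open>1 + B \<le> \<gamma> * K * N\<close> says that N is large
    enough for the deviation to be at most the trivial bound \<open>K * N\<close> on
    \<open>sum f Y\<close>.\<close>
  also have "\<dots> \<le> K * (\<gamma> * K * N) / \<gamma> * N"
  proof -
    have "K \<ge> 0" using cY N by (metis mult_nonneg_nonneg of_nat_0_le_iff order_trans zero_le_mult_iff not_less linorder_not_le mult_neg_pos)
    then show ?thesis using B N g by (intro mult_right_mono divide_right_mono mult_left_mono) auto
  qed
  also have "\<dots> = (K * N)\<^sup>2" using g by (simp add: power2_eq_square)
  finally have "card F / \<gamma> - sum f Y \<le> K * N"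
    using abs_le_square_iff[of "card F / \<gamma> - sum f Y" "K*N"] cY by linarith
  moreover have "sum f Y \<le> K * N"
    using sum_mono[of Y f "\<lambda>_. 1"] f cY by auto
  ultimately have "card F / \<gamma> \<le> 2 * (K * N)" by linarith
  then have "card F \<le> 2 * \<gamma> * K * N" using g by (simp add: field_simps)
  moreover have "(\<Sum>x\<in>X. (\<Sum>y\<in>Y. (indicator F y / \<gamma> - f y) * v y x)\<^sup>2) \<le> K * (1 + B) / \<gamma>"
    using le by (smt (verit) zero_le_power2)
  ultimately show ?thesis using F(1) by blast
qed

text \<open>The error is linear in each of f and W separately, so one is rounded at a time: f
  against the vectors \<open>W (x + y) / N\<close>, then W against the already rounded f. The second
  vectors carry the weight \<open>1 / \<gamma>\<close>, hence \<open>1 / \<gamma>\<^sup>2\<close> in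
  the first size condition. The square error stays bounded as N grows, so the error in the sum of
  absolute values is of order sqrt N.\<close>

lemma correlation_net:
  fixes G Y Z :: "'a::ab_group_add set" and K :: real
  defines "N \<equiv> real (card G)"
  assumes fin: "finite G" "finite Y" "finite Z" and G: "G \<noteq> {}"
    and YZ: "\<And>x y. x \<in> G \<Longrightarrow> y \<in> Y \<Longrightarrow> x + y \<in> Z"
    and f: "\<And>y. y \<in> Y \<Longrightarrow> 0 \<le> f y \<and> f y \<le> 1"
    and W: "\<And>z. z \<in> Z \<Longrightarrow> 0 \<le> W z \<and> W z \<le> 1"
    and g: "0 < \<gamma>" "\<gamma> \<le> 1" and cY: "real (card Y) \<le> K * N" and cZ: "real (card Z) \<le> K * N"
    and e: "\<epsilon> > 0" and N1: "1 + 1 / \<gamma>\<^sup>2 \<le> \<gamma> * K * N" and N2: "8 * K / \<gamma> ^ 3 \<le> \<epsilon>\<^sup>2 * N"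
  shows "\<exists>F\<subseteq>Y. \<exists>E\<subseteq>Z. real (card F) \<le> 2 * \<gamma> * K * N \<and> real (card E) \<le> 2 * \<gamma> * K * N \<and>
    (\<Sum>x\<in>G. \<bar>(\<Sum>y\<in>Y. f y * W (x + y)) / N - real (card {y\<in>F. x + y \<in> E}) / (\<gamma>\<^sup>2 * N)\<bar>) \<le> \<epsilon> * N"
proof -
  have N: "N > 0" using fin G by (auto simp: N_def card_gt_0_iff)
  have g2: "1 \<le> 1 / \<gamma>\<^sup>2" using g by (simp add: power_le_one)
  have K: "K \<ge> 0" using cY N
    by (metis mult_neg_pos not_less of_nat_0_le_iff order_trans linorder_not_le)
  have "\<exists>F\<subseteq>Y. real (card F) \<le> 2 * \<gamma> * K * N \<and>
    (\<Sum>x\<in>G. (\<Sum>y\<in>Y. (indicator F y / \<gamma> - f y) * (W (x + y) / N))\<^sup>2) \<le> K * (1 + 1) / \<gamma>"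
  proof (rule sparse_rounding_small[OF fin(2) f g fin(1) N cY])
    fix y assume y: "y \<in> Y"
    have "(\<Sum>x\<in>G. (W (x + y) / N)\<^sup>2) \<le> (\<Sum>x\<in>G. 1 / N\<^sup>2)"
      using YZ[OF _ y] W by (intro sum_mono) (auto simp: power_divide abs_square_le_1 intro!: divide_right_mono)
    also have "\<dots> = 1 / N" using N by (simp add: N_def power2_eq_square)
    finally show "(\<Sum>x\<in>G. (W (x + y) / N)\<^sup>2) \<le> 1 / N" .
  qed (use N1 g2 in auto)
  then obtain F where F: "F \<subseteq> Y" "real (card F) \<le> 2 * \<gamma> * K * N"
    "(\<Sum>x\<in>G. (\<Sum>y\<in>Y. (indicator F y / \<gamma> - f y) * (W (x + y) / N))\<^sup>2) \<le> K * 2 / \<gamma>" by auto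
  have finF: "finite F" using F fin finite_subset by blast
  have "\<exists>E\<subseteq>Z. real (card E) \<le> 2 * \<gamma> * K * N \<and>
    (\<Sum>x\<in>G. (\<Sum>z\<in>Z. (indicator E z / \<gamma> - W z) * (indicator F (z - x) / (\<gamma> * N)))\<^sup>2) \<le> K * (1 + 1 / \<gamma>\<^sup>2) / \<gamma>"
  proof (rule sparse_rounding_small[OF fin(3) W g fin(1) N cZ])
    fix z
    have "(\<Sum>x\<in>G. (indicator F (z - x) / (\<gamma> * N))\<^sup>2) \<le> (\<Sum>x\<in>G. 1 / (\<gamma> * N)\<^sup>2)"
      by (intro sum_mono) (auto simp: indicator_def power_divide)
    also have "\<dots> = 1 / \<gamma>\<^sup>2 / N" using N by (simp add: N_def power2_eq_square)
    finally show "(\<Sum>x\<in>G. (indicator F (z - x) / (\<gamma> * N))\<^sup>2) \<le> 1 / \<gamma>\<^sup>2 / N" .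
  qed (use N1 g in auto)
  then obtain E where E: "E \<subseteq> Z" "real (card E) \<le> 2 * \<gamma> * K * N"
    "(\<Sum>x\<in>G. (\<Sum>z\<in>Z. (indicator E z / \<gamma> - W z) * (indicator F (z - x) / (\<gamma> * N)))\<^sup>2) \<le> K * (1 + 1 / \<gamma>\<^sup>2) / \<gamma>" by blast
  define u where "u x = (\<Sum>y\<in>Y. f y * W (x + y)) / N" for x
  define u' where "u' x = real (card {y\<in>F. x + y \<in> E}) / (\<gamma>\<^sup>2 * N)" for x
  define a where "a x = (\<Sum>y\<in>Y. (indicator F y / \<gamma> - f y) * (W (x + y) / N))" for x
  define b where "b x = (\<Sum>z\<in>Z. (indicator E z / \<gamma> - W z) * (indicator F (z - x) / (\<gamma> * N)))" for x
  \<comment> \<open>The total error telescopes: a is the cost of replacing f, b the cost of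
    replacing W once f is replaced.\<close>
  have ab: "u' x - u x = a x + b x" if x: "x \<in> G" for x
  proof -
    have a: "a x = (\<Sum>y\<in>F. W (x + y)) / (\<gamma> * N) - u x"
    proof -
      have "a x = (\<Sum>y\<in>Y. indicator F y * (W (x + y) / (\<gamma> * N))) - u x"
        unfolding a_def u_def by (simp add: sum_subtractf left_diff_distrib diff_divide_distrib sum_divide_distrib)
      also have "(\<Sum>y\<in>Y. indicator F y * (W (x + y) / (\<gamma> * N))) = (\<Sum>y\<in>F. W (x + y) / (\<gamma> * N))"
        using F(1) fin by (intro sum.mono_neutral_cong_right) (auto simp: indicator_def)
      finally show ?thesis by (simp add: sum_divide_distrib)
    qed
    have conv: "(\<Sum>z\<in>Z. q z * indicator F (z - x)) = (\<Sum>y\<in>F. q (x + y))" for q :: "'a \<Rightarrow> real"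
    proof -
      have "(\<Sum>y\<in>F. q (x + y)) = (\<Sum>z\<in>(+) x ` F. q z)"
        by (subst sum.reindex) auto
      also have "\<dots> = (\<Sum>z\<in>(+) x ` F. q z * indicator F (z - x))"
        by (intro sum.cong) auto
      also have "\<dots> = (\<Sum>z\<in>Z. q z * indicator F (z - x))"
        using fin YZ[OF x] F(1)
        by (intro sum.mono_neutral_left) (auto simp: indicator_def image_iff, metis add.commute diff_add_cancel)
      finally show ?thesis ..
    qed
    have "b x = (\<Sum>z\<in>Z. ((indicator E z / \<gamma> - W z) / (\<gamma> * N)) * indicator F (z - x))"
      unfolding b_def by simp
    also have "\<dots> = (\<Sum>y\<in>F. (indicator E (x + y) / \<gamma> - W (x + y)) / (\<gamma> * N))"
      by (rule conv)
    also have "\<dots> = (\<Sum>y\<in>F. indicator E (x + y)) / (\<gamma>\<^sup>2 * N) - (\<Sum>y\<in>F. W (x + y)) / (\<gamma> * N)"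
      by (simp add: diff_divide_distrib sum_subtractf sum_divide_distrib power2_eq_square mult.assoc)
    also have "(\<Sum>y\<in>F. indicator E (x + y) :: real) = card {y\<in>F. x + y \<in> E}"
      using finF by (simp add: indicator_def sum.If_cases Int_def)
    finally show ?thesis using a by (simp add: u'_def)
  qed
  have "(\<Sum>x\<in>G. (u' x - u x)\<^sup>2) \<le> (\<Sum>x\<in>G. 2 * (a x)\<^sup>2 + 2 * (b x)\<^sup>2)"
  proof (intro sum_mono)
    fix x assume "x \<in> G"
    have "0 \<le> (a x - b x)\<^sup>2" by simp
    then show "(u' x - u x)\<^sup>2 \<le> 2 * (a x)\<^sup>2 + 2 * (b x)\<^sup>2"
      unfolding ab[OF \<open>x \<in> G\<close>] by (simp add: power2_sum power2_diff)
  qed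
  also have "\<dots> \<le> 2 * (K * 2 / \<gamma>) + 2 * (K * (1 + 1 / \<gamma>\<^sup>2) / \<gamma>)"
    using F(3) E(3) unfolding a_def[symmetric] b_def[symmetric]
    by (simp add: sum.distrib flip: sum_distrib_left)
  also have "\<dots> = 2 * K / \<gamma> * (3 + 1 / \<gamma>\<^sup>2)"
    by (simp add: algebra_simps add_divide_distrib)
  also have "\<dots> \<le> 2 * K / \<gamma> * (4 / \<gamma>\<^sup>2)"
  proof (intro mult_left_mono)
    show "3 + 1 / \<gamma>\<^sup>2 \<le> 4 / \<gamma>\<^sup>2" using g2 by linarith
  qed (use K g in auto)
  also have "\<dots> = 8 * K / \<gamma> ^ 3" by (simp add: power2_eq_square power3_eq_cube)
  finally have sq: "(\<Sum>x\<in>G. (u' x - u x)\<^sup>2) \<le> \<epsilon>\<^sup>2 * N" using N2 by linarith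
  have "(\<Sum>x\<in>G. \<bar>u x - u' x\<bar>)\<^sup>2 \<le> (\<Sum>x\<in>G. 1\<^sup>2) * (\<Sum>x\<in>G. \<bar>u x - u' x\<bar>\<^sup>2)"
    using Cauchy_Schwarz_ineq_sum[of "\<lambda>_. 1" "\<lambda>x. \<bar>u x - u' x\<bar>" G] by simp
  also have "\<dots> = N * (\<Sum>x\<in>G. (u' x - u x)\<^sup>2)"
    by (simp add: N_def power2_commute)
  also have "\<dots> \<le> N * (\<epsilon>\<^sup>2 * N)" using sq N by (intro mult_left_mono) auto
  also have "\<dots> = (\<epsilon> * N)\<^sup>2" by (simp add: power2_eq_square)
  finally have "(\<Sum>x\<in>G. \<bar>u x - u' x\<bar>) \<le> \<epsilon> * N"
    by (rule power2_le_imp_le) (use e N in simp)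
  then show ?thesis using F(1,2) E(1,2) unfolding u_def u'_def
    by (intro exI[of _ F] exI[of _ E] conjI)
qed

section \<open>Solutions of the equation\<close>

definition solutions :: "nat \<Rightarrow> nat \<Rightarrow> (nat \<times> nat \<Rightarrow> 'a::ab_group_add set) \<Rightarrow> (nat \<times> nat \<Rightarrow> 'a) set" where
  "solutions k h D = {x \<in> Pi\<^sub>E ({1..k} \<times> {1..h}) D.
     \<forall>l\<in>{1..k}. \<forall>m\<in>{1..k}. (\<Sum>i=1..h. x (l, i)) = (\<Sum>i=1..h. x (m, i))}"

text \<open>If slot p holds x and the rest of its row sums to y, the common row sum is x + y. Given
  y, the rest of that row and the other rows are then chosen independently, the latter from
  \<open>other_rows\<close> at x + y.\<close>

definition row_completions ::
  "nat \<Rightarrow> (nat \<times> nat \<Rightarrow> 'a::ab_group_add set) \<Rightarrow> nat \<times> nat \<Rightarrow> 'a \<Rightarrow> (nat \<Rightarrow> 'a) set" where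
  "row_completions h D p y = {u \<in> Pi\<^sub>E ({1..h} - {snd p}) (\<lambda>i. D (fst p, i)). (\<Sum>i\<in>{1..h} - {snd p}. u i) = y}"

definition other_rows ::
  "nat \<Rightarrow> nat \<Rightarrow> (nat \<times> nat \<Rightarrow> 'a::ab_group_add set) \<Rightarrow> nat \<times> nat \<Rightarrow> 'a \<Rightarrow> (nat \<times> nat \<Rightarrow> 'a) set" where
  "other_rows k h D p z = {w \<in> Pi\<^sub>E (({1..k} - {fst p}) \<times> {1..h}) D.
     \<forall>l\<in>{1..k} - {fst p}. (\<Sum>i=1..h. w (l, i)) = z}"

section \<open>Counting completions of a slot\<close>

lemma restrict_in_PiE:
  assumes "w \<in> Pi\<^sub>E S D" "R \<subseteq> S" "\<And>q. D q \<subseteq> G"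
  shows "restrict w R \<in> R \<rightarrow>\<^sub>E G"
  using assms by (auto dest!: PiE_mem)

lemma finite_solutions:
  assumes "\<And>q. finite (D q)" shows "finite (solutions k h D)"
  unfolding solutions_def by (rule finite_subset[OF _ finite_PiE[of "{1..k} \<times> {1..h}" D]]) (auto simp: assms)

lemma finite_row_completions:
  assumes "\<And>q. finite (D q)" shows "finite (row_completions h D p y)"
  unfolding row_completions_def
  by (rule finite_subset[OF _ finite_PiE[of "{1..h} - {snd p}" "\<lambda>i. D (fst p, i)"]]) (auto simp: assms)

lemma finite_other_rows:
  assumes "\<And>q. finite (D q)" shows "finite (other_rows k h D p y)"
  unfolding other_rows_def
  by (rule finite_subset[OF _ finite_PiE[of "({1..k} - {fst p}) \<times> {1..h}" D]]) (auto simp: assms)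

lemma solutions_mono:
  assumes "\<And>q. q \<in> {1..k} \<times> {1..h} \<Longrightarrow> D q \<subseteq> D' q"
  shows "solutions k h D \<subseteq> solutions k h D'"
proof -
  have "Pi\<^sub>E ({1..k} \<times> {1..h}) D \<subseteq> Pi\<^sub>E ({1..k} \<times> {1..h}) D'" by (rule PiE_mono) (use assms in auto)
  then show ?thesis by (auto simp: solutions_def)
qed

text \<open>The inner sum is the correlation form required by \<open>correlation_net\<close>: one
  factor depends on y only, the other on x + y only.\<close>

lemma card_solutions_by_slot:
  fixes D :: "nat \<times> nat \<Rightarrow> 'a::ab_group_add set"
  assumes p: "p \<in> {1..k} \<times> {1..h}" and fin: "\<And>q. finite (D q)" "finite Y"
    and Y: "\<And>u. u \<in> Pi\<^sub>E ({1..h} - {snd p}) (\<lambda>i. D (fst p, i)) \<Longrightarrow> (\<Sum>i\<in>{1..h} - {snd p}. u i) \<in> Y"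
  shows "card (solutions k h D) =
    (\<Sum>x\<in>D p. \<Sum>y\<in>Y. card (row_completions h D p y) * card (other_rows k h D p (x + y)))"
proof -
  obtain l0 i0 where p0: "p = (l0, i0)" by force
  have l0: "l0 \<in> {1..k}" and i0: "i0 \<in> {1..h}" using p p0 by auto
  define S where "S = (SIGMA x:D p. SIGMA y:Y. row_completions h D p y \<times> other_rows k h D p (x + y))"
  \<comment> \<open>The sum y is recorded although the rest of the row determines it, so that the
    target S is a dependent sum over pairs (x, y) of a product.\<close>
  define enc :: "(nat \<times> nat \<Rightarrow> 'a) \<Rightarrow> 'a \<times> 'a \<times> (nat \<Rightarrow> 'a) \<times> (nat \<times> nat \<Rightarrow> 'a)" where
    "enc = (\<lambda>x. (x p, (\<Sum>i\<in>{1..h} - {i0}. x (l0, i)), (\<lambda>i\<in>{1..h} - {i0}. x (l0, i)), restrict x (({1..k} - {l0}) \<times> {1..h})))"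
  define dec :: "'a \<times> 'a \<times> (nat \<Rightarrow> 'a) \<times> (nat \<times> nat \<Rightarrow> 'a) \<Rightarrow> (nat \<times> nat \<Rightarrow> 'a)" where
    "dec = (\<lambda>(a, y, u, w). \<lambda>q\<in>{1..k} \<times> {1..h}. if q = p then a else if fst q = l0 then u (snd q) else w q)"
  have split: "(\<Sum>i=1..h. g i) = g i0 + (\<Sum>i\<in>{1..h} - {i0}. g i)" for g :: "nat \<Rightarrow> 'a"
    using i0 by (simp add: sum.remove)
  have "bij_betw enc (solutions k h D) S"
  proof (rule bij_betw_byWitness[where f' = dec])
    show "\<forall>x\<in>solutions k h D. dec (enc x) = x"
    proof (intro ballI ext)
      fix x and q :: "nat \<times> nat" assume x: "x \<in> solutions k h D"
      obtain l i where q: "q = (l, i)" by force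
      show "dec (enc x) q = x q"
      proof (cases "q \<in> {1..k} \<times> {1..h}")
        case True
        then show ?thesis by (simp add: q dec_def enc_def p0)
      next
        case False
        then have "x q = undefined" using x by (auto simp: solutions_def elim: PiE_arb)
        then show ?thesis using False by (simp add: dec_def enc_def)
      qed
    qed
    show "\<forall>t\<in>S. enc (dec t) = t"
    proof
      fix t assume t: "t \<in> S"
      obtain a y u w where ay: "t = (a, y, u, w)" by (metis prod_cases4)
      have u: "u \<in> row_completions h D p y" and w: "w \<in> other_rows k h D p (a + y)"
        using t ay by (auto simp: S_def)
      have bu: "(\<lambda>i\<in>{1..h} - {i0}. dec t (l0, i)) = u"
      proof
        fix i
        show "(\<lambda>i\<in>{1..h} - {i0}. dec t (l0, i)) i = u i"
        proof (cases "i \<in> {1..h} - {i0}")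
          case True
          then show ?thesis using l0 by (simp add: ay dec_def p0)
        next
          case False
          have "u \<in> Pi\<^sub>E ({1..h} - {i0}) (\<lambda>i. D (l0, i))" using u by (simp add: row_completions_def p0)
          then have "u i = undefined" using False by (rule PiE_arb)
          then show ?thesis using False by (simp only: restrict_apply if_False)
        qed
      qed
      have bw: "restrict (dec t) (({1..k} - {l0}) \<times> {1..h}) = w"
      proof
        fix q
        show "restrict (dec t) (({1..k} - {l0}) \<times> {1..h}) q = w q"
        proof (cases "q \<in> ({1..k} - {l0}) \<times> {1..h}")
          case True
          then show ?thesis by (cases q) (simp add: ay dec_def p0)
        next
          case False
          have "w \<in> Pi\<^sub>E (({1..k} - {l0}) \<times> {1..h}) D" using w by (simp add: other_rows_def p0)
          then have "w q = undefined" using False by (rule PiE_arb)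
          then show ?thesis using False by (simp only: restrict_apply if_False)
        qed
      qed
      have "(\<Sum>i\<in>{1..h} - {i0}. dec t (l0, i)) = (\<Sum>i\<in>{1..h} - {i0}. u i)"
        by (subst bu[symmetric]) simp
      also have "\<dots> = y" using u by (simp add: row_completions_def p0)
      finally show "enc (dec t) = t" unfolding enc_def bu bw
        using p by (simp add: ay dec_def)
    qed
    show "enc ` solutions k h D \<subseteq> S"
    proof
      fix t assume "t \<in> enc ` solutions k h D"
      then obtain x where x: "x \<in> solutions k h D" and t: "t = enc x" by blast
      have xP: "x q \<in> D q" if "q \<in> {1..k} \<times> {1..h}" for q
        using x that by (auto simp: solutions_def)
      define u where "u = (\<lambda>i\<in>{1..h} - {i0}. x (l0, i))"
      have su: "(\<Sum>i\<in>{1..h} - {i0}. x (l0, i)) = (\<Sum>i\<in>{1..h} - {i0}. u i)"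
        unfolding u_def by simp
      have uP: "u \<in> Pi\<^sub>E ({1..h} - {snd p}) (\<lambda>i. D (fst p, i))"
        using xP l0 by (auto simp: u_def p0)
      have "(\<Sum>i=1..h. x (l, i)) = x p + (\<Sum>i\<in>{1..h} - {i0}. u i)" if "l \<in> {1..k} - {l0}" for l
        using x that l0 unfolding su[symmetric] p0 split[of "\<lambda>i. x (l0, i)", symmetric] solutions_def by blast
      moreover have "(\<Sum>i=1..h. restrict x (({1..k} - {l0}) \<times> {1..h}) (l, i)) = (\<Sum>i=1..h. x (l, i))"
        if "l \<in> {1..k} - {l0}" for l using that by (intro sum.cong) auto
      ultimately have "restrict x (({1..k} - {l0}) \<times> {1..h}) \<in> other_rows k h D p (x p + (\<Sum>i\<in>{1..h} - {i0}. u i))"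
        using xP by (auto simp: other_rows_def p0)
      moreover have "u \<in> row_completions h D p (\<Sum>i\<in>{1..h} - {i0}. u i)"
        unfolding row_completions_def using uP by (simp add: p0)
      moreover have "(\<Sum>i\<in>{1..h} - {i0}. u i) \<in> Y" using Y[OF uP] by (simp add: p0)
      moreover have "t = (x p, (\<Sum>i\<in>{1..h} - {i0}. u i), u, restrict x (({1..k} - {l0}) \<times> {1..h}))"
        unfolding t enc_def su u_def ..
      ultimately show "t \<in> S" using xP[OF p] unfolding S_def by blast
    qed
    show "dec ` S \<subseteq> solutions k h D"
    proof
      fix x assume "x \<in> dec ` S"
      then obtain a y u w where x: "x = dec (a, y, u, w)" and a: "a \<in> D p"
        and u: "u \<in> row_completions h D p y" and w: "w \<in> other_rows k h D p (a + y)"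
        unfolding S_def by blast
      have u': "u i \<in> D (l0, i)" if "i \<in> {1..h} - {i0}" for i
      proof -
        have "u \<in> Pi\<^sub>E ({1..h} - {i0}) (\<lambda>i. D (l0, i))" using u by (simp add: row_completions_def p0)
        then show ?thesis using that by (rule PiE_mem)
      qed
      have w': "w q \<in> D q" if "q \<in> ({1..k} - {l0}) \<times> {1..h}" for q
      proof -
        have "w \<in> Pi\<^sub>E (({1..k} - {l0}) \<times> {1..h}) D" using w by (simp add: other_rows_def p0)
        then show ?thesis using that by (rule PiE_mem)
      qed
      have "x \<in> Pi\<^sub>E ({1..k} \<times> {1..h}) D"
      proof (rule PiE_I)
        fix q assume "q \<in> {1..k} \<times> {1..h}"
        then show "x q \<in> D q" using a u'[of "snd q"] w'[of q] by (cases q) (simp add: x dec_def p0)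
      qed (simp add: x dec_def)
      moreover have "(\<Sum>i=1..h. x (l, i)) = a + y" if l: "l \<in> {1..k}" for l
      proof (cases "l = l0")
        case True
        have "(\<Sum>i\<in>{1..h} - {i0}. x (l0, i)) = (\<Sum>i\<in>{1..h} - {i0}. u i)"
          using l0 by (intro sum.cong) (auto simp: x dec_def p0)
        also have "\<dots> = y" using u by (simp add: row_completions_def p0)
        finally have "(\<Sum>i\<in>{1..h} - {i0}. x (l0, i)) = y" .
        moreover have "x (l0, i0) = a" using l0 i0 by (simp add: x dec_def p0)
        ultimately show ?thesis unfolding True split[of "\<lambda>i. x (l0, i)"] by simp
      next
        case False
        have "(\<Sum>i=1..h. x (l, i)) = (\<Sum>i=1..h. w (l, i))"
          using l False by (intro sum.cong) (auto simp: x dec_def p0)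
        then show ?thesis using w False l by (simp add: other_rows_def p0)
      qed
      ultimately show "x \<in> solutions k h D" by (simp add: solutions_def)
    qed
  qed
  then have "card (solutions k h D) = card S" by (rule bij_betw_same_card)
  also have "\<dots> = (\<Sum>x\<in>D p. \<Sum>y\<in>Y. card (row_completions h D p y) * card (other_rows k h D p (x + y)))"
    unfolding S_def using fin
    by (simp add: card_SigmaI finite_row_completions finite_other_rows card_cartesian_product)
  finally show ?thesis .
qed

text \<open>The prescribed sum determines one of the h - 1 entries from the others; such an entry
  exists because \<open>h \<ge> 2\<close>. Dividing by this bound gives a function with values in
  [0,1].\<close>

lemma card_row_completions_le:
  fixes D :: "nat \<times> nat \<Rightarrow> 'a::ab_group_add set"
  assumes "h \<ge> 2" "snd p \<in> {1..h}" "finite G" "\<And>q. D q \<subseteq> G"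
  shows "card (row_completions h D p y) \<le> card G ^ (h - 2)"
proof -
  obtain i1 where i1: "i1 \<in> {1..h}" "i1 \<noteq> snd p"
    using assms(1) by (metis One_nat_def Suc_1 Suc_leD atLeastAtMost_iff le_refl n_not_Suc_n)
  define R where "R = {1..h} - {snd p} - {i1}"
  have "card R = h - 2" using i1 assms(2) by (simp add: R_def)
  have inj: "inj_on (\<lambda>u. restrict u R) (row_completions h D p y)"
  proof (rule inj_onI)
    fix u v assume u: "u \<in> row_completions h D p y" and v: "v \<in> row_completions h D p y"
      and eq: "restrict u R = restrict v R"
    have e: "u i = v i" if "i \<in> R" for i using eq that by (metis restrict_apply')
    have "u i1 + sum u R = v i1 + sum v R"
      using u v i1 by (simp add: row_completions_def R_def sum.remove[symmetric])
    then have "u i1 = v i1" using e by (simp add: sum.cong[of R R u v])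
    then show "u = v" using u v e
      by (intro PiE_ext[of u "{1..h} - {snd p}" "\<lambda>i. D (fst p, i)"]) (auto simp: row_completions_def R_def)
  qed
  have "(\<lambda>u. restrict u R) ` row_completions h D p y \<subseteq> R \<rightarrow>\<^sub>E G"
    
  proof (rule image_subsetI)
    fix u assume "u \<in> row_completions h D p y"
    then have "u \<in> Pi\<^sub>E ({1..h} - {snd p}) (\<lambda>i. D (fst p, i))" by (simp add: row_completions_def)
    then show "restrict u R \<in> R \<rightarrow>\<^sub>E G"
      by (rule restrict_in_PiE) (use assms(4) in \<open>auto simp: R_def\<close>)
  qed
  then have "card (row_completions h D p y) \<le> card (R \<rightarrow>\<^sub>E G)"
    using inj assms(3) by (intro card_inj_on_le[OF inj]) (auto simp: R_def intro!: finite_PiE)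
  then show ?thesis using \<open>card R = h - 2\<close> by (simp add: card_funcsetE R_def)
qed

text \<open>In each of the k - 1 rows the first entry is determined by the other h - 1 and the row
  sum.\<close>

lemma card_other_rows_le:
  fixes D :: "nat \<times> nat \<Rightarrow> 'a::ab_group_add set"
  assumes "h \<ge> 1" "fst p \<in> {1..k}" "finite G" "\<And>q. D q \<subseteq> G"
  shows "card (other_rows k h D p z) \<le> card G ^ ((k - 1) * (h - 1))"
proof -
  define R where "R = ({1..k} - {fst p}) \<times> {2..h}"
  have "card R = (k - 1) * (h - 1)" using assms by (simp add: R_def card_cartesian_product)
  have inj: "inj_on (\<lambda>u. restrict u R) (other_rows k h D p z)"
  proof (rule inj_onI)
    fix u v assume u: "u \<in> other_rows k h D p z" and v: "v \<in> other_rows k h D p z"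
      and eq: "restrict u R = restrict v R"
    have e: "u q = v q" if "q \<in> R" for q using eq that by (metis restrict_apply')
    have I: "{1..h} = insert 1 {2..h}" using assms(1) by auto
    have "u (l, 1) = v (l, 1)" if l: "l \<in> {1..k} - {fst p}" for l
    proof -
      have "(\<Sum>i=1..h. u (l, i)) = (\<Sum>i=1..h. v (l, i))"
        using u v l by (simp add: other_rows_def)
      moreover have "(\<Sum>i=2..h. u (l, i)) = (\<Sum>i=2..h. v (l, i))"
        using e l by (intro sum.cong) (auto simp: R_def)
      ultimately show ?thesis unfolding I by simp
    qed
    then have "u q = v q" if "q \<in> ({1..k} - {fst p}) \<times> {1..h}" for q
      using that e I by (cases q; cases "snd q = 1") (auto simp: R_def)
    then show "u = v" using u v
      by (intro PiE_ext[of u "({1..k} - {fst p}) \<times> {1..h}" D]) (auto simp: other_rows_def)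
  qed
  have "(\<lambda>u. restrict u R) ` other_rows k h D p z \<subseteq> R \<rightarrow>\<^sub>E G"
    
  proof (rule image_subsetI)
    fix u assume "u \<in> other_rows k h D p z"
    then have "u \<in> Pi\<^sub>E (({1..k} - {fst p}) \<times> {1..h}) D" by (simp add: other_rows_def)
    then show "restrict u R \<in> R \<rightarrow>\<^sub>E G"
      by (rule restrict_in_PiE) (use assms(4) in \<open>auto simp: R_def\<close>)
  qed
  then have "card (other_rows k h D p z) \<le> card (R \<rightarrow>\<^sub>E G)"
    using inj assms(3) by (intro card_inj_on_le[OF inj]) (auto simp: R_def intro!: finite_PiE)
  moreover have "finite R" by (simp add: R_def)
  ultimately show ?thesis using \<open>card R = _\<close> by (simp add: card_funcsetE)
qed

lemma row_completions_upd [simp]: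
  "row_completions h (D(p := B)) p = row_completions h D p"
proof -
  have "Pi\<^sub>E ({1..h} - {snd p}) (\<lambda>i. (D(p := B)) (fst p, i)) = Pi\<^sub>E ({1..h} - {snd p}) (\<lambda>i. D (fst p, i))"
    by (rule PiE_cong) (cases p, auto)
  then show ?thesis by (simp add: row_completions_def fun_eq_iff)
qed

lemma other_rows_upd [simp]:
  "other_rows k h (D(p := B)) p = other_rows k h D p"
proof -
  have "Pi\<^sub>E (({1..k} - {fst p}) \<times> {1..h}) (D(p := B)) = Pi\<^sub>E (({1..k} - {fst p}) \<times> {1..h}) D"
    by (rule PiE_cong) auto
  then show ?thesis by (simp add: other_rows_def fun_eq_iff)
qed

section \<open>Lower bound for the number of solutions by convexity\<close>

lemma sum_power_mean:
  fixes a :: "'a \<Rightarrow> real"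
  assumes "finite Z" "Z \<noteq> {}" "\<And>z. z \<in> Z \<Longrightarrow> a z \<ge> 0" "k \<ge> 1"
  shows "(\<Sum>z\<in>Z. a z) ^ k \<le> real (card Z) ^ (k - 1) * (\<Sum>z\<in>Z. a z ^ k)"
proof -
  have c: "real (card Z) > 0" using assms by (simp add: card_gt_0_iff)
  have "(\<Sum>z\<in>Z. (1 / card Z) *\<^sub>R a z) ^ k \<le> (\<Sum>z\<in>Z. (1 / card Z) * a z ^ k)"
  proof (rule convex_on_sum[OF assms(1,2)])
    show "convex_on {0..} (\<lambda>x::real. x ^ k)"
      by (cases "even k") (auto intro: convex_power_odd convex_on_subset[OF convex_power_even])
  qed (use assms c in auto)
  then have "((\<Sum>z\<in>Z. a z) / card Z) ^ k \<le> (\<Sum>z\<in>Z. a z ^ k) / card Z"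
    by (simp add: sum_divide_distrib)
  then have "(\<Sum>z\<in>Z. a z) ^ k \<le> (\<Sum>z\<in>Z. a z ^ k) / card Z * card Z ^ k"
    using c by (simp add: power_divide divide_le_eq)
  also have "\<dots> = card Z ^ (k - 1) * (\<Sum>z\<in>Z. a z ^ k)"
    using c assms(4) by (cases k) auto
  finally show ?thesis by simp
qed

text \<open>Using the same sets in every row makes the number of solutions a \<open>k\<close>-th moment of the
  representation function, so convexity bounds it from below.\<close>

lemma card_solutions_ge:
  fixes B :: "nat \<Rightarrow> 'a::ab_group_add set"
  assumes k: "k \<ge> 1" and fin: "\<And>i. finite (B i)" "finite Z" "Z \<noteq> {}"
    and Z: "\<And>u. u \<in> Pi\<^sub>E {1..h} B \<Longrightarrow> (\<Sum>i=1..h. u i) \<in> Z"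
  shows "real (\<Prod>i=1..h. card (B i)) ^ k \<le> real (card Z) ^ (k - 1) * real (card (solutions k h (\<lambda>q. B (snd q))))"
proof -
  define R where "R z = {u \<in> Pi\<^sub>E {1..h} B. (\<Sum>i=1..h. u i) = z}" for z
  have finR: "finite (R z)" for z
    unfolding R_def by (rule finite_subset[OF _ finite_PiE[of "{1..h}" B]]) (auto simp: fin)
  have "(\<Prod>i=1..h. card (B i)) = card (Pi\<^sub>E {1..h} B)" by (simp add: card_PiE)
  also have "Pi\<^sub>E {1..h} B = (\<Union>z\<in>Z. R z)" using Z by (auto simp: R_def)
  also have "card \<dots> = (\<Sum>z\<in>Z. card (R z))"
    using fin finR by (intro card_UN_disjoint) (auto simp: R_def)
  finally have tot: "real (\<Prod>i=1..h. card (B i)) = (\<Sum>z\<in>Z. real (card (R z)))" by simp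
  \<comment> \<open>A sum z with k independent representations of it is a solution. Reading z off
    row 1 makes the encoding injective, which uses \<open>k \<ge> 1\<close>.\<close>
  define S where "S = (SIGMA z:Z. {1..k} \<rightarrow>\<^sub>E R z)"
  define m :: "'a \<times> (nat \<Rightarrow> nat \<Rightarrow> 'a) \<Rightarrow> nat \<times> nat \<Rightarrow> 'a" where
    "m = (\<lambda>(z, g). \<lambda>q\<in>{1..k} \<times> {1..h}. g (fst q) (snd q))"
  have m: "m (z, g) (l, i) = g l i" if "l \<in> {1..k}" "i \<in> {1..h}" for z g l i
    using that by (simp add: m_def)
  have inj: "inj_on m S"
  proof (rule inj_onI)
    fix a b assume a: "a \<in> S" and b: "b \<in> S" and eq: "m a = m b"
    obtain z g where zg: "a = (z, g)" by force
    obtain z' g' where zg': "b = (z', g')" by force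
    have g: "g l \<in> R z" "g' l \<in> R z'" if "l \<in> {1..k}" for l
      using a b zg zg' that by (auto simp: S_def)
    have e: "g l i = g' l i" if "l \<in> {1..k}" "i \<in> {1..h}" for l i
      using m[OF that] eq zg zg' by metis
    have gl: "g l = g' l" if l: "l \<in> {1..k}" for l
      using g[OF l] e[OF l] by (intro PiE_ext[of "g l" "{1..h}" B]) (auto simp: R_def)
    then have "g = g'" using a b zg zg'
      by (intro PiE_ext[of g "{1..k}" "\<lambda>_. R z" g' ]) (auto simp: S_def PiE_iff)
    moreover have "z = z'" using g[of 1] gl[of 1] k by (auto simp: R_def)
    ultimately show "a = b" using zg zg' by simp
  qed
  have "m ` S \<subseteq> solutions k h (\<lambda>q. B (snd q))"
  proof
    fix x assume "x \<in> m ` S"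
    then obtain z g where x: "x = m (z, g)" and zg: "(z, g) \<in> S"
      by force
    have g: "g l \<in> R z" if "l \<in> {1..k}" for l using zg that by (auto simp: S_def)
    have "x \<in> Pi\<^sub>E ({1..k} \<times> {1..h}) (\<lambda>q. B (snd q))"
      using g by (auto simp: x m_def R_def PiE_iff Ball_def)
    moreover have "(\<Sum>i=1..h. x (l, i)) = z" if l: "l \<in> {1..k}" for l
    proof -
      have "(\<Sum>i=1..h. x (l, i)) = (\<Sum>i=1..h. g l i)"
        using l by (intro sum.cong) (auto simp: x m_def)
      then show ?thesis using g[OF l] by (simp add: R_def)
    qed
    ultimately show "x \<in> solutions k h (\<lambda>q. B (snd q))" by (simp add: solutions_def)
  qed
  then have "card S \<le> card (solutions k h (\<lambda>q. B (snd q)))"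
    using inj fin by (intro card_inj_on_le[OF inj] finite_solutions)
  moreover have "card S = (\<Sum>z\<in>Z. card (R z) ^ k)"
    unfolding S_def using fin finR by (simp add: card_SigmaI finite_PiE card_funcsetE)
  ultimately have "(\<Sum>z\<in>Z. real (card (R z)) ^ k) \<le> real (card (solutions k h (\<lambda>q. B (snd q))))"
    by (simp flip: of_nat_power of_nat_sum)
  then show ?thesis unfolding tot
    using sum_power_mean[OF fin(2,3), of "\<lambda>z. real (card (R z))" k] k
    by (meson mult_left_mono of_nat_0_le_iff order_trans zero_le_power)
qed

section \<open>Containers for solution-free families\<close>

lemma grid_eq_image: "(grid n :: (int ^ 'd) set) = vec_lambda ` (UNIV \<rightarrow>\<^sub>E {1..int n})"
proof
  show "(grid n :: (int ^ 'd) set) \<subseteq> vec_lambda ` (UNIV \<rightarrow>\<^sub>E {1..int n})"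
  proof
    fix x :: "int ^ 'd" assume "x \<in> grid n"
    then have "x = vec_lambda (vec_nth x)" "vec_nth x \<in> UNIV \<rightarrow>\<^sub>E {1..int n}"
      by (simp_all add: grid_def PiE_iff)
    then show "x \<in> vec_lambda ` (UNIV \<rightarrow>\<^sub>E {1..int n})" by blast
  qed
qed (auto simp: grid_def PiE_iff)

lemma finite_grid [simp]: "finite (grid n :: (int ^ 'd::finite) set)"
  unfolding grid_eq_image by (intro finite_imageI finite_PiE) auto

lemma card_grid: "card (grid n :: (int ^ 'd::finite) set) = n ^ CARD('d)"
proof -
  have "inj_on vec_lambda (UNIV \<rightarrow>\<^sub>E {1..int n} :: ('d \<Rightarrow> int) set)"
    by (simp add: inj_on_def vec_lambda_inject)
  then show ?thesis unfolding grid_eq_image by (simp add: card_image card_funcsetE)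
qed

lemma grid_add: "x \<in> grid a \<Longrightarrow> y \<in> grid b \<Longrightarrow> x + y \<in> grid (a + b)"
  by (auto simp: grid_def) (smt (verit))+

text \<open>The index set is any nonempty set of size at most h, to cover both a full row and a row
  with one slot removed.\<close>

lemma grid_sum:
  fixes u :: "'i \<Rightarrow> int ^ 'd"
  assumes "finite I" "I \<noteq> {}" "card I \<le> h" "\<And>i. i \<in> I \<Longrightarrow> u i \<in> grid n"
  shows "sum u I \<in> grid (h * n)"
proof -
  have "1 \<le> sum u I $ j \<and> sum u I $ j \<le> int (h * n)" for j
  proof
    have u: "1 \<le> u i $ j" "u i $ j \<le> int n" if "i \<in> I" for i
      using assms(4)[OF that] by (auto simp: grid_def)
    have "1 \<le> int (card I) * 1"
      using assms by (simp add: Suc_le_eq card_gt_0_iff)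
    also have "\<dots> \<le> (\<Sum>i\<in>I. u i $ j)" using sum_bounded_below[of I 1 "\<lambda>i. u i $ j"] u by simp
    finally show "1 \<le> sum u I $ j" by (simp add: sum_component)
    have "(\<Sum>i\<in>I. u i $ j) \<le> int (card I) * int n" using sum_bounded_above[of I "\<lambda>i. u i $ j" "int n"] u by simp
    also have "\<dots> \<le> int (h * n)" using assms(3) by (simp add: mult_right_mono)
    finally show "sum u I $ j \<le> int (h * n)" by (simp add: sum_component)
  qed
  then show ?thesis by (auto simp: grid_def)
qed

section \<open>Entropy of small sets\<close>

lemma sum_power_card_Pow:
  fixes x :: "'b::comm_semiring_1"
  assumes "finite S" shows "(\<Sum>E\<in>Pow S. x ^ card E) = (1 + x) ^ card S"
  using prod_add[OF assms, of "\<lambda>_. x" "\<lambda>_. 1"] by (simp add: add.commute)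

text \<open>Exponential Markov inequality: for x < 1 a small set E satisfies
  \<open>1 \<le> x ^ card E / x powr (\<alpha> * M)\<close>, and the weighted sum over all subsets
  factors. With \<rho> = r the weight counts the ways to recolor the points of E freely.\<close>

lemma weighted_count_small_subsets:
  fixes b \<rho> :: real
  assumes b: "b > 1" and \<rho>: "\<rho> \<ge> 1"
  shows "\<exists>\<alpha>>0. \<forall>S M. finite S \<longrightarrow> real (card S) \<le> M \<longrightarrow>
    (\<Sum>E | E \<subseteq> S \<and> real (card E) \<le> \<alpha> * M. \<rho> ^ card E) \<le> b powr M"
proof -
  \<comment> \<open>Of the budget b per point, one factor sqrt b is spent on
    \<open>1 + x * \<rho>\<close>.\<close>
  define x where "x = min (1/2) ((sqrt b - 1) / \<rho>)"
  have sb: "sqrt b > 1" using b by simp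
  have x: "0 < x" "x < 1" using sb \<rho> by (auto simp: x_def)
  have x1: "1 + x * \<rho> \<le> sqrt b"
  proof -
    have "x * \<rho> \<le> (sqrt b - 1) / \<rho> * \<rho>" using \<rho> by (intro mult_right_mono) (auto simp: x_def)
    then show ?thesis using \<rho> by simp
  qed
  \<comment> \<open>The other factor sqrt b pays for the division: \<alpha> solves
    \<open>x powr \<alpha> = 1 / sqrt b\<close>.\<close>
  define \<alpha> where "\<alpha> = ln (sqrt b) / (- ln x)"
  have lx: "ln x < 0" using x by simp
  have \<alpha>: "\<alpha> > 0" unfolding \<alpha>_def using sb lx by (intro divide_pos_pos) auto
  have xa: "x powr \<alpha> = 1 / sqrt b"
    unfolding powr_def \<alpha>_def using lx x sb by (simp add: exp_minus inverse_eq_divide)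
  have main: "(\<Sum>E | E \<subseteq> S \<and> real (card E) \<le> \<alpha> * M. \<rho> ^ card E) \<le> b powr M"
    if S: "finite S" "real (card S) \<le> M" for S :: "'a set" and M
  proof -
    have "(\<Sum>E | E \<subseteq> S \<and> real (card E) \<le> \<alpha> * M. \<rho> ^ card E)
       \<le> (\<Sum>E | E \<subseteq> S \<and> real (card E) \<le> \<alpha> * M. (x * \<rho>) ^ card E / x powr (\<alpha> * M))"
    proof (intro sum_mono)
      fix E assume "E \<in> {E. E \<subseteq> S \<and> real (card E) \<le> \<alpha> * M}"
      then have "x powr (\<alpha> * M) \<le> x powr (real (card E))"
        using x by (intro powr_mono') auto
      then have "x powr (\<alpha> * M) \<le> x ^ card E" using x by (simp add: powr_realpow)
      then have "\<rho> ^ card E * x powr (\<alpha> * M) \<le> \<rho> ^ card E * x ^ card E"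
        using \<rho> by (intro mult_left_mono) auto
      then show "\<rho> ^ card E \<le> (x * \<rho>) ^ card E / x powr (\<alpha> * M)"
        using x by (simp add: le_divide_eq power_mult_distrib mult_ac)
    qed
    also have "\<dots> \<le> (\<Sum>E\<in>Pow S. (x * \<rho>) ^ card E / x powr (\<alpha> * M))"
      using S x \<rho> by (intro sum_mono2) auto
    also have "\<dots> = (1 + x * \<rho>) ^ card S / x powr (\<alpha> * M)"
      using S by (simp add: sum_power_card_Pow flip: sum_divide_distrib)
    also have "x powr (\<alpha> * M) = 1 / sqrt b powr M"
      using sb by (simp add: powr_powr[symmetric] xa powr_divide)
    also have "(1 + x * \<rho>) ^ card S / (1 / sqrt b powr M) = (1 + x * \<rho>) ^ card S * sqrt b powr M" by simp
    also have "(1 + x * \<rho>) ^ card S \<le> sqrt b ^ card S"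
      using x1 x \<rho> by (intro power_mono) auto
    also have "sqrt b ^ card S = sqrt b powr real (card S)" using sb by (simp add: powr_realpow)
    also have "sqrt b powr real (card S) \<le> sqrt b powr M" using S sb by (intro powr_mono) auto
    finally have "(\<Sum>E | E \<subseteq> S \<and> real (card E) \<le> \<alpha> * M. \<rho> ^ card E) \<le> sqrt b powr M * sqrt b powr M"
      by (simp add: mult_right_mono)
    also have "\<dots> = b powr M" using b by (simp flip: powr_mult)
    finally show ?thesis .
  qed
  show ?thesis using \<alpha> main by blast
qed

lemma count_small_subsets:
  fixes b :: real
  assumes b: "b > 1"
  shows "\<exists>\<alpha>>0. \<forall>S M. finite S \<longrightarrow> real (card S) \<le> M \<longrightarrow>
    real (card {E. E \<subseteq> S \<and> real (card E) \<le> \<alpha> * M}) \<le> b powr M"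
  using weighted_count_small_subsets[OF b, of 1] by simp

text \<open>The number of solutions with x in slot p, divided by its order of magnitude: k rows of h
  points with a common sum have k * (h - 1) + 1 free points, and x uses one of them.\<close>

definition slot_degree ::
  "nat \<Rightarrow> nat \<Rightarrow> nat \<Rightarrow> (nat \<times> nat \<Rightarrow> (int ^ 'd::finite) set) \<Rightarrow> nat \<times> nat \<Rightarrow> int ^ 'd \<Rightarrow> real" where
  "slot_degree k h n D p x =
     real (\<Sum>y\<in>grid (h * n). card (row_completions h D p y) * card (other_rows k h D p (x + y)))
       / real (n ^ CARD('d)) ^ (k * (h - 1))"

lemma card_solutions_slot_degree:
  fixes D :: "nat \<times> nat \<Rightarrow> (int ^ 'd::finite) set"
  assumes "h \<ge> 2" "p \<in> {1..k} \<times> {1..h}" "\<And>q. D q \<subseteq> grid n" "n \<ge> 1"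
  shows "real (card (solutions k h D)) =
    real (n ^ CARD('d)) ^ (k * (h - 1)) * (\<Sum>x\<in>D p. slot_degree k h n D p x)"
proof -
  have fin: "finite (D q)" for q using assms(3) finite_subset finite_grid by blast
  have "(\<Sum>i\<in>{1..h} - {snd p}. u i) \<in> grid (h * n)"
    if u: "u \<in> Pi\<^sub>E ({1..h} - {snd p}) (\<lambda>i. D (fst p, i))" for u
  proof (rule grid_sum)
    have "card ({1..h} - {snd p}) = h - 1" using assms(2) by (auto simp: card_Diff_singleton)
    then show "card ({1..h} - {snd p}) \<le> h" by simp
    have "1 \<in> {1..h} - {snd p} \<or> 2 \<in> {1..h} - {snd p}" using assms(1) by auto
    then show "{1..h} - {snd p} \<noteq> {}" by blast
    show "u i \<in> grid n" if "i \<in> {1..h} - {snd p}" for i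
      using PiE_mem[OF u that] assms(3) by blast
  qed simp
  then have "card (solutions k h D) = (\<Sum>x\<in>D p. \<Sum>y\<in>grid (h * n). card (row_completions h D p y) * card (other_rows k h D p (x + y)))"
    using fin by (intro card_solutions_by_slot[OF assms(2)]) auto
  then show ?thesis
    using assms(4) unfolding slot_degree_def by (simp flip: sum_divide_distrib)
qed

text \<open>The degree at p ignores the set in slot p itself. Replacing that set by a sublevel set
  of its own degree therefore leaves the degree function unchanged.\<close>

lemma slot_degree_upd [simp]: "slot_degree k h n (D(p := B)) p = slot_degree k h n D p"
  by (simp add: slot_degree_def fun_eq_iff)

lemma slot_degree_nonneg: "slot_degree k h n D p x \<ge> 0"
  unfolding slot_degree_def by (intro divide_nonneg_nonneg of_nat_0_le_iff zero_le_power)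

lemma grid_power_ge: "(n::nat) \<le> n ^ CARD('d::finite)"
  by (cases "n = 0") (simp_all add: self_le_power)

text \<open>The net consists of the correlations of pairs of sparse sets, so its size is at most the
  number of such pairs. It does not depend on D.\<close>

lemma slot_degree_net:
  fixes \<epsilon> b :: real
  assumes h: "h \<ge> 2" and p: "p \<in> {1..k} \<times> {1..h}" and e: "\<epsilon> > 0" and b: "b > 1"
  shows "\<exists>n0. \<forall>n\<ge>n0. \<exists>\<N> :: (int ^ 'd::finite \<Rightarrow> real) set.
    finite \<N> \<and> real (card \<N>) \<le> b ^ (n ^ CARD('d)) \<and>
    (\<forall>D. (\<forall>q. D q \<subseteq> grid n) \<longrightarrow>
      (\<exists>g\<in>\<N>. (\<Sum>x\<in>grid n. \<bar>slot_degree k h n D p x - g x\<bar>) \<le> \<epsilon> * real (n ^ CARD('d))))"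
proof -
  \<comment> \<open>x + y ranges over \<open>grid ((h + 1) * n)\<close>, which has K * N
    points.\<close>
  define K :: real where "K = real ((h + 1) ^ CARD('d))"
  have K: "K \<ge> 1" unfolding K_def by (simp flip: of_nat_power add: Suc_leI)
  \<comment> \<open>Two sparse sets, each in at most K * N points, cost b' to the power 2 * K * N,
    that is b^N.\<close>
  define b' where "b' = b powr (1 / (2 * K))"
  have b': "b' > 1" unfolding b'_def using b K by (simp add: gr_one_powr)
  obtain \<alpha> where \<alpha>: "\<alpha> > 0" and small: "\<And>(S :: (int ^ 'd) set) M. finite S \<Longrightarrow> real (card S) \<le> M \<Longrightarrow>
    real (card {E. E \<subseteq> S \<and> real (card E) \<le> \<alpha> * M}) \<le> b' powr M"
    using count_small_subsets[OF b', where 'a = "int ^ 'd"] by blast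
  \<comment> \<open>The rounded sets have at most \<open>2 * \<gamma> * K * N\<close> points, which
    has to stay below the entropy threshold \<open>\<alpha> * (K * N)\<close>.\<close>
  define \<gamma> where "\<gamma> = min 1 (\<alpha> / 2)"
  have g: "0 < \<gamma>" "\<gamma> \<le> 1" "2 * \<gamma> \<le> \<alpha>" using \<alpha> by (auto simp: \<gamma>_def)
  define n0 where "n0 = nat \<lceil>max 1 (max ((1 + 1 / \<gamma>\<^sup>2) / (\<gamma> * K)) (8 * K / \<gamma> ^ 3 / \<epsilon>\<^sup>2))\<rceil>"
  have "\<exists>\<N> :: (int ^ 'd \<Rightarrow> real) set.
    finite \<N> \<and> real (card \<N>) \<le> b ^ (n ^ CARD('d)) \<and>
    (\<forall>D. (\<forall>q. D q \<subseteq> grid n) \<longrightarrow>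
      (\<exists>g\<in>\<N>. (\<Sum>x\<in>grid n. \<bar>slot_degree k h n D p x - g x\<bar>) \<le> \<epsilon> * real (n ^ CARD('d))))"
    if n: "n \<ge> n0" for n
  proof -
    define G where "G = (grid n :: (int ^ 'd) set)"
    define Y where "Y = (grid (h * n) :: (int ^ 'd) set)"
    define Z where "Z = (grid (n + h * n) :: (int ^ 'd) set)"
    define N where "N = real (card G)"
    have NN: "N = real (n ^ CARD('d))" by (simp add: N_def G_def card_grid)
    have "max 1 (max ((1 + 1 / \<gamma>\<^sup>2) / (\<gamma> * K)) (8 * K / \<gamma> ^ 3 / \<epsilon>\<^sup>2)) \<le> real n0"
      unfolding n0_def by linarith
    also have "\<dots> \<le> N" unfolding NN using n grid_power_ge[of n, where 'd = 'd] by linarith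
    finally have N: "N \<ge> 1" "(1 + 1 / \<gamma>\<^sup>2) / (\<gamma> * K) \<le> N" "8 * K / \<gamma> ^ 3 / \<epsilon>\<^sup>2 \<le> N" by auto
    have N1: "1 + 1 / \<gamma>\<^sup>2 \<le> \<gamma> * K * N" using N(2) g K by (simp add: divide_le_eq mult_ac)
    have N2: "8 * K / \<gamma> ^ 3 \<le> \<epsilon>\<^sup>2 * N" using N(3) e by (subst (asm) pos_divide_le_eq) (auto simp: mult_ac)
    have n1: "n \<ge> 1" using N(1) unfolding NN by (cases n) (auto simp: power_0_left)
    have cZ: "real (card Z) = K * N"
    proof -
      have "n + h * n = (h + 1) * n" by simp
      then show ?thesis unfolding Z_def NN K_def card_grid by (simp only: power_mult_distrib of_nat_mult)
    qed
    have "card Y \<le> card Z" unfolding Y_def Z_def card_grid by (intro power_mono) auto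
    then have cY: "real (card Y) \<le> K * N" using cZ by linarith
    define \<E> where "\<E> = (\<lambda>S :: (int ^ 'd) set. {E. E \<subseteq> S \<and> real (card E) \<le> \<alpha> * (K * N)})"
    define \<N> where "\<N> = (\<lambda>(F, E) x. real (card {y\<in>F. x + y \<in> E}) / (\<gamma>\<^sup>2 * N)) ` (\<E> Y \<times> \<E> Z)"
    have fE: "finite (\<E> S)" if "finite S" for S unfolding \<E>_def using that by simp
    have fin: "finite G" "finite Y" "finite Z" by (auto simp: G_def Y_def Z_def)
    have "real (card \<N>) \<le> real (card (\<E> Y \<times> \<E> Z))"
      unfolding \<N>_def of_nat_le_iff using fin fE by (intro card_image_le finite_cartesian_product)
    also have "\<dots> = real (card (\<E> Y)) * real (card (\<E> Z))" by (simp add: card_cartesian_product)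
    also have "\<dots> \<le> b' powr (K * N) * b' powr (K * N)"
      using small[OF fin(2) cY] small[OF fin(3), of "K * N"] cZ unfolding \<E>_def by (intro mult_mono) auto
    also have "\<dots> = b powr N"
      unfolding b'_def using K by (simp add: powr_powr flip: powr_add)
    also have "\<dots> = b ^ (n ^ CARD('d))" unfolding NN using b by (subst powr_realpow) auto
    finally have card: "real (card \<N>) \<le> b ^ (n ^ CARD('d))" .
    have "\<exists>g\<in>\<N>. (\<Sum>x\<in>G. \<bar>slot_degree k h n D p x - g x\<bar>) \<le> \<epsilon> * N"
      if D: "\<And>q. D q \<subseteq> G" for D
    proof -
      define f where "f y = real (card (row_completions h D p y)) / N ^ (h - 2)" for y
      define W where "W z = real (card (other_rows k h D p z)) / N ^ ((k - 1) * (h - 1))" for z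
      have f: "0 \<le> f y \<and> f y \<le> 1" for y
      proof -
        have "card (row_completions h D p y) \<le> card G ^ (h - 2)"
          using h p fin D by (intro card_row_completions_le) auto
        then have "real (card (row_completions h D p y)) \<le> N ^ (h - 2)"
          unfolding N_def by (simp flip: of_nat_power)
        then show ?thesis using N(1) by (simp add: f_def divide_le_eq)
      qed
      have W: "0 \<le> W y \<and> W y \<le> 1" for y
      proof -
        have "card (other_rows k h D p y) \<le> card G ^ ((k - 1) * (h - 1))"
          using h p fin D by (intro card_other_rows_le) auto
        then have "real (card (other_rows k h D p y)) \<le> N ^ ((k - 1) * (h - 1))"
          unfolding N_def by (simp flip: of_nat_power)
        then show ?thesis using N(1) by (simp add: W_def divide_le_eq)
      qed
      have "\<exists>F\<subseteq>Y. \<exists>E\<subseteq>Z. real (card F) \<le> 2 * \<gamma> * K * N \<and> real (card E) \<le> 2 * \<gamma> * K * N \<and>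
        (\<Sum>x\<in>G. \<bar>(\<Sum>y\<in>Y. f y * W (x + y)) / N - real (card {y\<in>F. x + y \<in> E}) / (\<gamma>\<^sup>2 * N)\<bar>) \<le> \<epsilon> * N"
        unfolding N_def
      proof (rule correlation_net[OF fin _ _ f W g(1,2) _ _ e])
        show "G \<noteq> {}" using N(1) by (auto simp: N_def)
        show "x + y \<in> Z" if "x \<in> G" "y \<in> Y" for x y
          using that grid_add unfolding G_def Y_def Z_def by blast
      qed (use cY cZ N1 N2 in \<open>auto simp: N_def\<close>)
      then obtain F E where FE: "F \<subseteq> Y" "E \<subseteq> Z" "real (card F) \<le> 2 * \<gamma> * K * N" "real (card E) \<le> 2 * \<gamma> * K * N"
        "(\<Sum>x\<in>G. \<bar>(\<Sum>y\<in>Y. f y * W (x + y)) / N - real (card {y\<in>F. x + y \<in> E}) / (\<gamma>\<^sup>2 * N)\<bar>) \<le> \<epsilon> * N" by blast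
      have le: "2 * \<gamma> * K * N \<le> \<alpha> * (K * N)"
        using mult_right_mono[OF g(3), of "K * N"] K N(1) by (simp add: mult_ac)
      have "(F, E) \<in> \<E> Y \<times> \<E> Z" using FE le by (auto simp: \<E>_def)
      then have mem: "(\<lambda>x. real (card {y\<in>F. x + y \<in> E}) / (\<gamma>\<^sup>2 * N)) \<in> \<N>"
        unfolding \<N>_def by (rule rev_image_eqI) simp
      \<comment> \<open>The normalization splits into one factor N for averaging over y and the two
        factors that bring f and W into [0,1].\<close>
      have "k * (h - 1) = 1 + (h - 2) + (k - 1) * (h - 1)"
      proof -
        have "k \<ge> 1" using p by auto
        then obtain k' where "k = Suc k'" by (cases k) auto
        moreover obtain h' where "h = 2 + h'" using h le_Suc_ex by blast
        ultimately show ?thesis by simp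
      qed
      then have "N ^ (k * (h - 1)) = N * N ^ (h - 2) * N ^ ((k - 1) * (h - 1))"
        by (simp only: power_add power_one_right)
      then have "slot_degree k h n D p x = (\<Sum>y\<in>Y. f y * W (x + y)) / N" for x
        unfolding slot_degree_def f_def W_def Y_def NN[symmetric]
        by (simp add: sum_divide_distrib mult_ac)
      then show ?thesis using FE(5) by (intro bexI[OF _ mem]) simp
    qed
    moreover have "finite \<N>" unfolding \<N>_def using fin fE by (intro finite_imageI finite_cartesian_product)
    ultimately show ?thesis using card unfolding G_def NN by (intro exI[of _ \<N>] conjI) blast+
  qed
  then show ?thesis by blast
qed

text \<open>E is large enough by Markov: few solutions means a small total degree on D p, while g
  exceeds \<tau> on D p - E. E is small enough because its degrees are at most \<tau> up to the
  approximation error. The bound on the number of solutions worsens from \<eta>' to \<eta>.\<close>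

lemma closure_step:
  fixes D :: "nat \<times> nat \<Rightarrow> (int ^ 'd::finite) set"
  defines "G \<equiv> (grid :: nat \<Rightarrow> (int ^ 'd) set)"
  defines "N \<equiv> (\<lambda>n. real (n ^ CARD('d)))"
  assumes h: "h \<ge> 2" and p: "p \<in> {1..k} \<times> {1..h}" and D: "\<And>q. D q \<subseteq> G n" and n: "n \<ge> 1"
    and few: "real (card (solutions k h D)) \<le> \<eta>' * N n ^ (k * (h - 1) + 1)"
    and g: "(\<Sum>x\<in>G n. \<bar>slot_degree k h n D p x - g x\<bar>) \<le> \<epsilon> * N n"
    and \<tau>: "\<tau> > 0" and \<eta>: "\<eta>' + \<epsilon> \<le> \<eta> * \<tau>" "\<tau> + \<epsilon> \<le> \<eta>"
  defines "E \<equiv> {x\<in>G n. g x \<le> \<tau>}"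
  shows "real (card (D p - E)) \<le> \<eta> * N n"
    and "real (card (solutions k h (D(p := E)))) \<le> \<eta> * N n ^ (k * (h - 1) + 1)"
proof -
  have N: "N n > 0" using n by (simp add: N_def)
  have fin: "finite (G n)" by (simp add: G_def)
  define u where "u = slot_degree k h n D p"
  have u0: "u x \<ge> 0" for x unfolding u_def by (rule slot_degree_nonneg)
  have err: "(\<Sum>x\<in>B. \<bar>u x - g x\<bar>) \<le> \<epsilon> * N n" if "B \<subseteq> G n" for B
    using g sum_mono2[OF fin that, of "\<lambda>x. \<bar>u x - g x\<bar>"] unfolding u_def by simp
  have finD: "finite (D p)" using D fin finite_subset by blast
  have "N n ^ (k * (h - 1)) * (\<Sum>x\<in>D p. u x) = real (card (solutions k h D))"
    unfolding u_def N_def using card_solutions_slot_degree[OF h p _ n, of D] D unfolding G_def by simp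
  then have "N n ^ (k * (h - 1)) * (\<Sum>x\<in>D p. u x) \<le> N n ^ (k * (h - 1)) * (\<eta>' * N n)"
    using few by (simp add: mult_ac)
  then have uD: "(\<Sum>x\<in>D p. u x) \<le> \<eta>' * N n" using N by (simp add: mult_le_cancel_left)
  have "real (card (D p - E)) * \<tau> \<le> (\<Sum>x\<in>D p - E. g x)"
    using D[of p] by (intro sum_bounded_below[where K = \<tau>, simplified]) (auto simp: E_def)
  also have "\<dots> \<le> (\<Sum>x\<in>D p - E. u x + \<bar>u x - g x\<bar>)" by (intro sum_mono) linarith
  also have "\<dots> = (\<Sum>x\<in>D p - E. u x) + (\<Sum>x\<in>D p - E. \<bar>u x - g x\<bar>)" by (rule sum.distrib)
  also have "(\<Sum>x\<in>D p - E. u x) \<le> (\<Sum>x\<in>D p. u x)" using finD u0 by (intro sum_mono2) auto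
  also have "(\<Sum>x\<in>D p - E. \<bar>u x - g x\<bar>) \<le> \<epsilon> * N n" using D[of p] by (intro err) blast
  finally have "real (card (D p - E)) * \<tau> \<le> (\<eta>' + \<epsilon>) * N n" using uD by (simp add: algebra_simps)
  also have "\<dots> \<le> (\<eta> * \<tau>) * N n" using \<eta> N by (intro mult_right_mono) auto
  finally have "\<tau> * real (card (D p - E)) \<le> \<tau> * (\<eta> * N n)" by (simp add: mult_ac)
  then show "real (card (D p - E)) \<le> \<eta> * N n" using \<tau> by simp
  have EG: "E \<subseteq> G n" by (auto simp: E_def)
  have "(\<Sum>x\<in>E. u x) \<le> (\<Sum>x\<in>E. g x + \<bar>u x - g x\<bar>)" by (intro sum_mono) linarith
  also have "\<dots> = (\<Sum>x\<in>E. g x) + (\<Sum>x\<in>E. \<bar>u x - g x\<bar>)" by (rule sum.distrib)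
  also have "(\<Sum>x\<in>E. \<bar>u x - g x\<bar>) \<le> \<epsilon> * N n" using EG by (rule err)
  also have "(\<Sum>x\<in>E. g x) \<le> real (card E) * \<tau>"
    by (intro sum_bounded_above[where K = \<tau>, simplified]) (auto simp: E_def)
  also have "real (card E) * \<tau> \<le> N n * \<tau>"
  proof (intro mult_right_mono)
    have "card E \<le> card (G n)" using EG fin by (rule card_mono[rotated])
    then show "real (card E) \<le> N n" by (simp add: N_def G_def card_grid flip: of_nat_power)
  qed (use \<tau> in simp)
  also have "N n * \<tau> + \<epsilon> * N n = (\<tau> + \<epsilon>) * N n"
    by (simp add: algebra_simps)
  also have "\<dots> \<le> \<eta> * N n" using \<eta> N by (intro mult_right_mono) auto
  finally have "(\<Sum>x\<in>E. u x) \<le> \<eta> * N n" by simp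
  then have "N n ^ (k * (h - 1)) * (\<Sum>x\<in>E. u x) \<le> N n ^ (k * (h - 1)) * (\<eta> * N n)"
    using N by (intro mult_left_mono) auto
  moreover have "real (card (solutions k h (D(p := E)))) = N n ^ (k * (h - 1)) * (\<Sum>x\<in>E. u x)"
    using card_solutions_slot_degree[OF h p _ n, of "D(p := E)"] D EG
    unfolding u_def N_def G_def by simp
  ultimately show "real (card (solutions k h (D(p := E)))) \<le> \<eta> * N n ^ (k * (h - 1) + 1)"
    by (simp only: power_add power_one_right mult_ac)
qed

text \<open>The invariant of the slot-by-slot replacement. The families \<S> are quantified before
  D, so they serve all solution-free D at once; slots outside S keep their original sets.\<close>

definition closes_slots ::
  "nat \<Rightarrow> nat \<Rightarrow> (nat \<times> nat) set \<Rightarrow> real \<Rightarrow> nat \<Rightarrow> (nat \<times> nat \<Rightarrow> (int ^ 'd::finite) set set) \<Rightarrow> bool" where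
  "closes_slots k h S \<eta> n \<S> \<longleftrightarrow>
    (\<forall>D. (\<forall>q. D q \<subseteq> grid n) \<longrightarrow> solutions k h D = {} \<longrightarrow>
      (\<exists>F. (\<forall>q. F q \<subseteq> grid n) \<and>
           (\<forall>p\<in>S. F p \<in> \<S> p \<and> real (card (D p - F p)) \<le> \<eta> * real (n ^ CARD('d))) \<and>
           (\<forall>p. p \<notin> S \<longrightarrow> F p = D p) \<and>
           real (card (solutions k h F)) \<le> \<eta> * real (n ^ CARD('d)) ^ (k * (h - 1) + 1)))"

text \<open>The slots are closed up one at a time: the set in slot \<open>p\<close> is replaced by the sublevel set of
  the approximate number of completions, computed from the sets already replaced and the
  remaining original ones.\<close>

lemma closure_slots:
  fixes \<eta> b :: real
  assumes h: "h \<ge> 2" and "finite S" "S \<subseteq> {1..k} \<times> {1..h}" "\<eta> > 0" and b: "b > 1"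
  shows "\<exists>n0. \<forall>n\<ge>n0. \<exists>\<S> :: nat \<times> nat \<Rightarrow> (int ^ 'd::finite) set set.
    (\<forall>p\<in>S. finite (\<S> p) \<and> real (card (\<S> p)) \<le> b ^ (n ^ CARD('d))) \<and> closes_slots k h S \<eta> n \<S>"
  using assms(2-4)
proof (induction S arbitrary: \<eta> rule: finite_induct)
  case empty
  have "closes_slots k h {} \<eta> n \<S>" for n and \<S> :: "nat \<times> nat \<Rightarrow> (int ^ 'd) set set"
    unfolding closes_slots_def
  proof (intro allI impI)
    fix D :: "nat \<times> nat \<Rightarrow> (int ^ 'd) set"
    assume "\<forall>q. D q \<subseteq> grid n" "solutions k h D = {}"
    then show "\<exists>F. (\<forall>q. F q \<subseteq> grid n) \<and>
           (\<forall>p\<in>{}. F p \<in> \<S> p \<and> real (card (D p - F p)) \<le> \<eta> * real (n ^ CARD('d))) \<and>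
           (\<forall>p. p \<notin> {} \<longrightarrow> F p = D p) \<and>
           real (card (solutions k h F)) \<le> \<eta> * real (n ^ CARD('d)) ^ (k * (h - 1) + 1)"
      using empty.prems by (intro exI[of _ D]) simp
  qed
  then show ?case by simp
next
  case (insert p S)
  have p: "p \<in> {1..k} \<times> {1..h}" and S: "S \<subseteq> {1..k} \<times> {1..h}" using insert.prems(1) by blast+
  \<comment> \<open>The cutoff and the two errors are chosen to satisfy the two inequalities
    \<open>par\<close> demanded by \<open>closure_step\<close>; \<open>\<eta>' \<le> \<eta>\<close>
    also keeps the losses in the earlier slots within \<eta>.\<close>
  define \<tau> where "\<tau> = \<eta> / 2"
  define \<epsilon> where "\<epsilon> = min (\<eta> / 2) (\<eta> * \<tau> / 2)"
  define \<eta>' where "\<eta>' = min \<eta> (\<eta> * \<tau> / 2)"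
  have pos: "\<tau> > 0" "\<epsilon> > 0" "\<eta>' > 0" "\<eta>' \<le> \<eta>"
    using insert.prems(2) by (simp_all add: \<tau>_def \<epsilon>_def \<eta>'_def)
  have "\<epsilon> \<le> \<eta> / 2" "\<epsilon> \<le> \<eta> * \<tau> / 2" "\<eta>' \<le> \<eta> * \<tau> / 2" "\<tau> = \<eta> / 2"
    by (simp_all add: \<epsilon>_def \<eta>'_def \<tau>_def)
  then have par: "\<eta>' + \<epsilon> \<le> \<eta> * \<tau>" "\<tau> + \<epsilon> \<le> \<eta>" by linarith+
  obtain n1 where n1: "\<forall>n\<ge>n1. \<exists>\<S> :: nat \<times> nat \<Rightarrow> (int ^ 'd) set set.
    (\<forall>p\<in>S. finite (\<S> p) \<and> real (card (\<S> p)) \<le> b ^ (n ^ CARD('d))) \<and> closes_slots k h S \<eta>' n \<S>"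
    using insert.IH[OF S pos(3)] by blast
  obtain n2 where n2: "\<forall>n\<ge>n2. \<exists>\<N> :: (int ^ 'd \<Rightarrow> real) set.
    finite \<N> \<and> real (card \<N>) \<le> b ^ (n ^ CARD('d)) \<and>
    (\<forall>D. (\<forall>q. D q \<subseteq> grid n) \<longrightarrow>
      (\<exists>g\<in>\<N>. (\<Sum>x\<in>grid n. \<bar>slot_degree k h n D p x - g x\<bar>) \<le> \<epsilon> * real (n ^ CARD('d))))"
    using slot_degree_net[OF h p pos(2) b, where 'd = 'd] by blast
  show ?case
  proof (intro exI[of _ "max 1 (max n1 n2)"] allI impI)
    fix n assume "n \<ge> max 1 (max n1 n2)"
    then have n: "n \<ge> 1" "n \<ge> n1" "n \<ge> n2" by auto
    obtain \<S> :: "nat \<times> nat \<Rightarrow> (int ^ 'd) set set" where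
      S1: "\<forall>p\<in>S. finite (\<S> p) \<and> real (card (\<S> p)) \<le> b ^ (n ^ CARD('d))"
      and S2: "closes_slots k h S \<eta>' n \<S>"
      using n1 n(2) by blast
    obtain \<N> :: "(int ^ 'd \<Rightarrow> real) set" where N1: "finite \<N>" "real (card \<N>) \<le> b ^ (n ^ CARD('d))"
      and N2: "\<forall>D. (\<forall>q. D q \<subseteq> grid n) \<longrightarrow>
        (\<exists>g\<in>\<N>. (\<Sum>x\<in>grid n. \<bar>slot_degree k h n D p x - g x\<bar>) \<le> \<epsilon> * real (n ^ CARD('d)))"
      using n2[rule_format, OF n(3)] by (elim exE conjE)
    \<comment> \<open>The cutoff \<tau> is fixed, so each function of the net yields one set and T
      is no larger than the net.\<close>
    define T where "T = (\<lambda>g :: int ^ 'd \<Rightarrow> real. {x\<in>grid n. g x \<le> \<tau>}) ` \<N>"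
    have "card T \<le> card \<N>" unfolding T_def using N1(1) by (rule card_image_le)
    then have T: "finite T" "real (card T) \<le> b ^ (n ^ CARD('d))"
      using N1 by (simp_all add: T_def)
    have "closes_slots k h (insert p S) \<eta> n (\<S>(p := T))"
      unfolding closes_slots_def
    proof (intro allI impI)
      fix D :: "nat \<times> nat \<Rightarrow> (int ^ 'd) set"
      assume D: "\<forall>q. D q \<subseteq> grid n" and sol: "solutions k h D = {}"
      obtain F where FG: "\<forall>q. F q \<subseteq> grid n"
        and F1: "\<forall>q\<in>S. F q \<in> \<S> q \<and> real (card (D q - F q)) \<le> \<eta>' * real (n ^ CARD('d))"
        and F2: "\<forall>q. q \<notin> S \<longrightarrow> F q = D q"
        and F3: "real (card (solutions k h F)) \<le> \<eta>' * real (n ^ CARD('d)) ^ (k * (h - 1) + 1)"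
        using S2[unfolded closes_slots_def, rule_format, OF D[rule_format] sol] by (elim exE conjE)
      obtain g where g: "g \<in> \<N>" "(\<Sum>x\<in>grid n. \<bar>slot_degree k h n F p x - g x\<bar>) \<le> \<epsilon> * real (n ^ CARD('d))"
        using N2[THEN spec, THEN mp, OF FG] by (elim bexE)
      define E where "E = {x\<in>grid n. g x \<le> \<tau>}"
      note step = closure_step[OF h p FG[rule_format] n(1) F3 g(2) pos(1) par, folded E_def]
      have Fp: "F p = D p" using F2 insert.hyps by blast
      have le: "\<eta>' * real (n ^ CARD('d)) \<le> \<eta> * real (n ^ CARD('d))"
        using pos by (intro mult_right_mono) auto
      show "\<exists>F. (\<forall>q. F q \<subseteq> grid n) \<and>
           (\<forall>q\<in>insert p S. F q \<in> (\<S>(p := T)) q \<and> real (card (D q - F q)) \<le> \<eta> * real (n ^ CARD('d))) \<and>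
           (\<forall>q. q \<notin> insert p S \<longrightarrow> F q = D q) \<and>
           real (card (solutions k h F)) \<le> \<eta> * real (n ^ CARD('d)) ^ (k * (h - 1) + 1)"
      proof (intro exI[of _ "F(p := E)"] conjI ballI allI impI)
        fix q assume q: "q \<in> insert p S"
        show "(F(p := E)) q \<in> (\<S>(p := T)) q"
          using q F1 g(1) by (cases "q = p") (simp_all add: T_def E_def)
        show "real (card (D q - (F(p := E)) q)) \<le> \<eta> * real (n ^ CARD('d))"
        proof (cases "q = p")
          case True
          then show ?thesis using step(1) Fp by simp
        next
          case False
          then have "real (card (D q - F q)) \<le> \<eta>' * real (n ^ CARD('d))" using q F1 by blast
          then show ?thesis using False le by simp
        qed
      next
        fix q assume "q \<notin> insert p S"
        then have "q \<noteq> p" "F q = D q" using F2 by blast+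
        then show "(F(p := E)) q = D q" by simp
      next
        show "real (card (solutions k h (F(p := E)))) \<le> \<eta> * real (n ^ CARD('d)) ^ (k * (h - 1) + 1)"
          by (rule step(2))
      next
        fix q show "(F(p := E)) q \<subseteq> grid n" using FG[THEN spec, of q] by (cases "q = p") (auto simp: E_def)
      qed
    qed
    moreover have "\<forall>q\<in>insert p S. finite ((\<S>(p := T)) q) \<and> real (card ((\<S>(p := T)) q)) \<le> b ^ (n ^ CARD('d))"
      using S1 T by simp
    ultimately show "\<exists>\<S> :: nat \<times> nat \<Rightarrow> (int ^ 'd) set set.
      (\<forall>q\<in>insert p S. finite (\<S> q) \<and> real (card (\<S> q)) \<le> b ^ (n ^ CARD('d))) \<and> closes_slots k h (insert p S) \<eta> n \<S>"
      by blast
  qed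
qed

section \<open>Templates of lists of colors\<close>

text \<open>The possible color patterns of a rainbow solution. Each pattern turns a rainbow-free
  coloring into a solution-free family of color classes, and each gets its own containers.\<close>

definition arrangements :: "nat \<Rightarrow> nat \<Rightarrow> nat \<Rightarrow> (nat \<times> nat \<Rightarrow> nat) set" where
  "arrangements k h r = {a \<in> {1..k} \<times> {1..h} \<rightarrow>\<^sub>E {1..r}. inj_on a ({1..k} \<times> {1..h})}"

lemma finite_arrangements: "finite (arrangements k h r)"
  unfolding arrangements_def
  by (rule finite_subset[OF _ finite_PiE[of "{1..k} \<times> {1..h}" "\<lambda>_. {1..r}"]]) auto

lemma color_classes_solution_free:
  assumes c: "c \<in> rainbow_free_colorings k h r A" and a: "a \<in> arrangements k h r"
  shows "solutions k h (\<lambda>p. {x \<in> A. c x = a p}) = {}"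
proof (rule ccontr)
  assume "\<not> ?thesis"
  then obtain x where x: "x \<in> solutions k h (\<lambda>p. {x \<in> A. c x = a p})" by blast
  have xp: "x p \<in> A \<and> c (x p) = a p" if "p \<in> {1..k} \<times> {1..h}" for p
  proof -
    have "x \<in> Pi\<^sub>E ({1..k} \<times> {1..h}) (\<lambda>p. {x \<in> A. c x = a p})" using x by (simp add: solutions_def)
    from PiE_mem[OF this that] show ?thesis by simp
  qed
  have "B_solution k h A (\<lambda>l i. x (l, i))"
    unfolding B_solution_def
  proof (intro conjI ballI)
    fix l i assume "l \<in> {1..k}" "i \<in> {1..h}"
    then show "x (l, i) \<in> A" using xp[of "(l, i)"] by blast
  next
    fix l m assume "l \<in> {1..k}" "m \<in> {1..k}"
    then show "(\<Sum>i=1..h. x (l, i)) = (\<Sum>i=1..h. x (m, i))" using x unfolding solutions_def by blast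
  qed
  moreover have "rainbow k h c (\<lambda>l i. x (l, i))"
    unfolding rainbow_def
  proof (rule inj_onI)
    fix p q assume pq: "p \<in> {1..k} \<times> {1..h}" "q \<in> {1..k} \<times> {1..h}"
      and "(case p of (l, i) \<Rightarrow> c (x (l, i))) = (case q of (l, i) \<Rightarrow> c (x (l, i)))"
    then have "a p = a q" using xp[OF pq(1)] xp[OF pq(2)] by (simp add: case_prod_unfold)
    moreover have "inj_on a ({1..k} \<times> {1..h})" using a unfolding arrangements_def by blast
    ultimately show "p = q" using pq by (simp only: inj_on_eq_iff)
  qed
  ultimately show False using c unfolding rainbow_free_colorings_def by blast
qed

text \<open>If all columns had density at least \<delta>, convexity would give at least
  \<delta>^(kh) N^(kh) / (h^d N)^(k-1) solutions, where h^d N is the number of possible row sums.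
  Since kh = (k - 1) + (k (h - 1) + 1), this has the same order in N as the assumed upper bound, and
  \<open>small\<close> makes it larger.\<close>

lemma solutions_supersaturation:
  fixes F :: "nat \<times> nat \<Rightarrow> (int ^ 'd::finite) set" and \<delta> \<eta> :: real
  assumes k: "k \<ge> 1" and h: "h \<ge> 1" and n: "n \<ge> 1" and \<delta>: "\<delta> > 0"
    and few: "real (card (solutions k h F)) \<le> \<eta> * real (n ^ CARD('d)) ^ (k * (h - 1) + 1)"
    and F: "\<And>q. F q \<subseteq> grid n"
    and B: "\<And>l i. l \<in> {1..k} \<Longrightarrow> i \<in> {1..h} \<Longrightarrow> B i \<subseteq> F (l, i)" "\<And>i. B i \<subseteq> grid n"
    and small: "\<eta> * real ((h ^ CARD('d)) ^ (k - 1)) < \<delta> ^ (k * h)"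
  shows "\<exists>i\<in>{1..h}. real (card (B i)) < \<delta> * real (n ^ CARD('d))"
proof (rule ccontr)
  define N where "N = real (n ^ CARD('d))"
  have N: "N > 0" using n by (simp add: N_def)
  assume "\<not> ?thesis"
  then have big: "\<delta> * N \<le> real (card (B i))" if "i \<in> {1..h}" for i
    using that unfolding N_def by (meson not_less)
  have fin: "finite (B i)" "finite (F q)" for i q
    by (rule finite_subset[OF B(2) finite_grid], rule finite_subset[OF F finite_grid])
  have "(\<delta> * N) ^ h = (\<Prod>i=1..h. \<delta> * N)" by simp
  also have "\<dots> \<le> (\<Prod>i=1..h. real (card (B i)))" using big N \<delta> by (intro prod_mono) auto
  finally have "((\<delta> * N) ^ h) ^ k \<le> real (\<Prod>i=1..h. card (B i)) ^ k"
    using N \<delta> by (intro power_mono) auto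
  also have "\<dots> \<le> real (card (grid (h * n) :: (int ^ 'd) set)) ^ (k - 1) * real (card (solutions k h (\<lambda>q. B (snd q))))"
  proof (rule card_solutions_ge[OF k])
    show "(grid (h * n) :: (int ^ 'd) set) \<noteq> {}"
      using n h card_grid[of "h * n", where 'd = 'd] by (metis card.empty mult_is_0 not_one_le_zero power_not_zero)
    show "(\<Sum>i=1..h. u i) \<in> grid (h * n)" if u: "u \<in> Pi\<^sub>E {1..h} B" for u
      using PiE_mem[OF u] B(2) h by (intro grid_sum) auto
  qed (use fin in auto)
  also have "\<dots> \<le> real (card (grid (h * n) :: (int ^ 'd) set)) ^ (k - 1) * real (card (solutions k h F))"
  proof (intro mult_left_mono of_nat_mono card_mono finite_solutions solutions_mono fin(2))
    fix q assume "q \<in> {1..k} \<times> {1..h}"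
    then show "B (snd q) \<subseteq> F q" using B(1)[of "fst q" "snd q"] by (simp add: mem_Times_iff)
  qed simp
  also have "real (card (grid (h * n) :: (int ^ 'd) set)) = real (h ^ CARD('d)) * N"
    by (simp add: card_grid N_def power_mult_distrib)
  also have "(real (h ^ CARD('d)) * N) ^ (k - 1) * real (card (solutions k h F)) \<le>
      (real (h ^ CARD('d)) * N) ^ (k - 1) * (\<eta> * N ^ (k * (h - 1) + 1))"
    using few N by (intro mult_left_mono) (auto simp: N_def)
  also have "\<dots> = \<eta> * real ((h ^ CARD('d)) ^ (k - 1)) * N ^ (k * h)"
  proof -
    obtain k' h' where "k = Suc k'" "h = Suc h'" using k h by (metis Suc_le_D One_nat_def)
    then have "k * h = (k - 1) + (k * (h - 1) + 1)" by simp
    then show ?thesis by (simp only: power_mult_distrib power_add of_nat_power mult_ac)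
  qed
  also have "((\<delta> * N) ^ h) ^ k = \<delta> ^ (k * h) * N ^ (k * h)"
    by (simp add: power_mult_distrib mult.commute flip: power_mult)
  finally have "\<delta> ^ (k * h) * N ^ (k * h) \<le> \<eta> * real ((h ^ CARD('d)) ^ (k - 1)) * N ^ (k * h)"
    by simp
  then show False using small N by simp
qed

text \<open>The hypothesis on \<open>P\<close> in the next two lemmas says that the template \<open>P\<close> has few rainbow solutions.\<close>

lemma few_large_lists:
  assumes P: "\<And>a B. a \<in> arrangements k h r \<Longrightarrow> (\<And>i. B i \<subseteq> A) \<Longrightarrow>
      (\<And>l i x. l \<in> {1..k} \<Longrightarrow> i \<in> {1..h} \<Longrightarrow> x \<in> B i \<Longrightarrow> a (l, i) \<in> P x) \<Longrightarrow> \<exists>i\<in>{1..h}. real (card (B i)) < t"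
    and S: "S \<subseteq> {1..r}" "card S = k * h"
  shows "real (card {x\<in>A. S \<subseteq> P x}) < t"
proof -
  have "finite S" using S(1) finite_subset by blast
  moreover have "card ({1..k} \<times> {1..h}) = card S" using S by (simp add: card_cartesian_product)
  ultimately obtain a where a: "bij_betw a ({1..k} \<times> {1..h}) S"
    using finite_same_card_bij[of "{1..k} \<times> {1..h}" S] by auto
  define a' where "a' = restrict a ({1..k} \<times> {1..h})"
  have a': "a' p \<in> S" if "p \<in> {1..k} \<times> {1..h}" for p
    using a that by (simp add: a'_def bij_betwE)
  have "inj_on a' ({1..k} \<times> {1..h})"
    using a unfolding a'_def inj_on_restrict_eq by (rule bij_betw_imp_inj_on)
  moreover have "a' \<in> {1..k} \<times> {1..h} \<rightarrow>\<^sub>E {1..r}"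
  proof (rule PiE_I)
    show "a' p \<in> {1..r}" if "p \<in> {1..k} \<times> {1..h}" for p using a'[OF that] S(1) by blast
  qed (simp add: a'_def)
  ultimately have arr: "a' \<in> arrangements k h r" by (simp add: arrangements_def)
  \<comment> \<open>All columns receive the same set, on which every color of S is
    available.\<close>
  have "\<exists>i\<in>{1..h}. real (card {x\<in>A. S \<subseteq> P x}) < t"
  proof (rule P[OF arr])
    fix l i x assume "l \<in> {1..k}" "i \<in> {1..h}" "x \<in> {x\<in>A. S \<subseteq> P x}"
    then show "a' (l, i) \<in> P x" using a'[of "(l, i)"] by blast
  qed blast
  then show ?thesis by blast
qed

lemma one_popular_list:
  assumes k: "k \<ge> 1" and h: "h \<ge> 2"
    and P: "\<And>a B. a \<in> arrangements k h r \<Longrightarrow> (\<And>i. B i \<subseteq> A) \<Longrightarrow>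
      (\<And>l i x. l \<in> {1..k} \<Longrightarrow> i \<in> {1..h} \<Longrightarrow> x \<in> B i \<Longrightarrow> a (l, i) \<in> P x) \<Longrightarrow> \<exists>i\<in>{1..h}. real (card (B i)) < t"
    and L: "L \<subseteq> {1..r}" "card L = k * h - 1" and M: "M \<subseteq> {1..r}" "card M = k * h - 1" and "L \<noteq> M"
  shows "real (card {x\<in>A. L \<subseteq> P x}) < t \<or> real (card {x\<in>A. M \<subseteq> P x}) < t"
proof -
  have fin: "finite L" "finite M" using L(1) M(1) finite_subset by blast+
  have "\<not> M \<subseteq> L" using card_subset_eq[OF fin(1), of M] L(2) M(2) \<open>L \<noteq> M\<close> by auto
  then obtain b where b: "b \<in> M" "b \<notin> L" by blast
  have "k * 2 \<le> k * h" using h by (rule mult_le_mono2)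
  moreover have "card (M - {b}) = k * h - 1 - 1" using M(2) b(1) fin by simp
  ultimately have "k - 1 \<le> card (M - {b})" using k by linarith
  then obtain K0 where K0: "K0 \<subseteq> M - {b}" "card K0 = k - 1" by (meson obtain_subset_with_card_n)
  \<comment> \<open>K supplies the k colors of column 1, taken from M and including a color b
    outside L. The other k * (h - 1) slots are to be filled with colors of L - K.\<close>
  define K where "K = insert b K0"
  have K: "K \<subseteq> M" "card K = k" "b \<in> K" "finite K"
    using K0 b k fin finite_subset[of K0 M] by (auto simp: K_def card_insert_if subset_iff)
  \<comment> \<open>Because b is not in L, removing K costs L at most k - 1 colors. This leaves
    exactly enough: kh - 1 - (k - 1) = k (h - 1).\<close>
  have "card L \<le> card (L - K) + card (K - {b})"
  proof -
    have "L \<subseteq> (L - K) \<union> (K - {b})" using b by blast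
    then have "card L \<le> card ((L - K) \<union> (K - {b}))" using fin K by (intro card_mono) auto
    also have "\<dots> \<le> card (L - K) + card (K - {b})" by (rule card_Un_le)
    finally show ?thesis .
  qed
  then have "k * (h - 1) \<le> card (L - K)" using K L(2) k by (simp add: diff_mult_distrib2)
  then obtain J where J: "J \<subseteq> L - K" "card J = k * (h - 1)" by (meson obtain_subset_with_card_n)
  have finJ: "finite J" using J fin finite_subset by (metis finite_Diff)
  obtain f where f: "bij_betw f {1..k} K"
    using finite_same_card_bij[of "{1..k}" K] K by auto
  have "card ({1..k} \<times> {2..h}) = card J" using J h by (simp add: card_cartesian_product)
  then obtain g where g: "bij_betw g ({1..k} \<times> {2..h}) J"
    using finite_same_card_bij[of "{1..k} \<times> {2..h}" J] finJ by auto
  define a where "a = (\<lambda>p\<in>{1..k} \<times> {1..h}. if snd p = 1 then f (fst p) else g p)"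
  have a1: "a (l, 1) = f l" if "l \<in> {1..k}" for l using that h by (simp add: a_def)
  have a2: "a (l, i) = g (l, i)" if "l \<in> {1..k}" "i \<in> {2..h}" for l i using that by (simp add: a_def)
  have fK: "f l \<in> K" if "l \<in> {1..k}" for l using f that by (auto simp: bij_betw_def)
  have gJ: "g (l, i) \<in> J" if "l \<in> {1..k}" "i \<in> {2..h}" for l i using g that by (auto simp: bij_betw_def)
  have split: "i = 1 \<or> i \<in> {2..h}" if "i \<in> {1..h}" for i using that by auto
  have inj: "inj_on a ({1..k} \<times> {1..h})"
  proof (rule inj_onI)
    fix p q assume p: "p \<in> {1..k} \<times> {1..h}" and q: "q \<in> {1..k} \<times> {1..h}" and eq: "a p = a q"
    obtain l i where pl: "p = (l, i)" by force
    obtain m j where qm: "q = (m, j)" by force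
    have l: "l \<in> {1..k}" "i \<in> {1..h}" "m \<in> {1..k}" "j \<in> {1..h}" using p q pl qm by auto
    have disj: "f l' \<noteq> g (m', j')" if "l' \<in> {1..k}" "m' \<in> {1..k}" "j' \<in> {2..h}" for l' m' j'
      using fK[OF that(1)] gJ[OF that(2,3)] J by auto
    have injf: "inj_on f {1..k}" and injg: "inj_on g ({1..k} \<times> {2..h})"
      using f g by (auto simp: bij_betw_def)
    consider "i = 1" "j = 1" | "i = 1" "j \<in> {2..h}" | "i \<in> {2..h}" "j = 1" | "i \<in> {2..h}" "j \<in> {2..h}"
      using split[OF l(2)] split[OF l(4)] by blast
    then show "p = q"
    proof cases
      case 1
      then have "f l = f m" using eq unfolding pl qm 1 a1[OF l(1)] a1[OF l(3)] by simp
      then show ?thesis using l injf unfolding pl qm 1 by (simp only: inj_on_eq_iff)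
    next
      case 2
      then show ?thesis using eq disj[OF l(1,3) 2(2)] unfolding pl qm 2(1) a1[OF l(1)] a2[OF l(3) 2(2)] by blast
    next
      case 3
      then show ?thesis using eq disj[OF l(3,1) 3(1)] unfolding pl qm 3(2) a1[OF l(3)] a2[OF l(1) 3(1)] by (metis)
    next
      case 4
      then have "g (l, i) = g (m, j)" using eq unfolding pl qm a2[OF l(1) 4(1)] a2[OF l(3) 4(2)] by simp
      then show ?thesis unfolding pl qm by (rule inj_onD[OF injg]) (use 4 l in blast)+
    qed
  qed
  have "a p \<in> {1..r}" if "p \<in> {1..k} \<times> {1..h}" for p
  proof -
    obtain l i where pl: "p = (l, i)" by force
    then have l: "l \<in> {1..k}" "i \<in> {1..h}" using that by auto
    from split[OF l(2)] show ?thesis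
    proof
      assume "i = 1"
      then show ?thesis using fK[OF l(1)] K(1) M(1) unfolding pl by (simp only: a1[OF l(1)]) blast
    next
      assume i: "i \<in> {2..h}"
      then show ?thesis using gJ[OF l(1) i] J(1) L(1) unfolding pl by (simp only: a2[OF l(1) i]) blast
    qed
  qed
  then have "a \<in> {1..k} \<times> {1..h} \<rightarrow>\<^sub>E {1..r}" by (rule PiE_I) (simp_all add: a_def)
  then have arr: "a \<in> arrangements k h r" using inj by (simp add: arrangements_def)
  \<comment> \<open>Column 1 uses only colors of M, all other columns only colors of L, so the two
    popular sets can be put in whole columns.\<close>
  define B where "B i = (if i = 1 then {x\<in>A. M \<subseteq> P x} else {x\<in>A. L \<subseteq> P x})" for i :: nat
  have "\<exists>i\<in>{1..h}. real (card (B i)) < t"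
  proof (rule P[OF arr])
    fix l i x assume l: "l \<in> {1..k}" "i \<in> {1..h}" and x: "x \<in> B i"
    show "a (l, i) \<in> P x"
    proof (cases "i = 1")
      case True
      then show ?thesis using x fK[OF l(1)] K(1) a1[OF l(1)] by (auto simp: B_def)
    next
      case False
      then have i2: "i \<in> {2..h}" using l by auto
      then show ?thesis using x gJ[OF l(1) i2] J(1) a2[OF l(1) i2] False by (auto simp: B_def)
    qed
  qed (auto simp: B_def)
  then show ?thesis by (auto simp: B_def split: if_splits)
qed

text \<open>Points of E are recolored freely, at a factor r each; \<open>max 1\<close> keeps the
  product from vanishing when such a point has an empty list.\<close>

lemma card_almost_in_lists:
  fixes A :: "'a set" and t :: real
  assumes A: "finite A" and P: "\<And>x. finite (P x)"
  shows "real (card {c \<in> A \<rightarrow>\<^sub>E {1..r}. \<exists>E\<subseteq>A. real (card E) \<le> t \<and> (\<forall>x\<in>A - E. c x \<in> P x)})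
    \<le> (\<Sum>E | E \<subseteq> A \<and> real (card E) \<le> t. real r ^ card E) * real (\<Prod>x\<in>A. max 1 (card (P x)))"
proof -
  let ?C = "{c \<in> A \<rightarrow>\<^sub>E {1..r}. \<exists>E\<subseteq>A. real (card E) \<le> t \<and> (\<forall>x\<in>A - E. c x \<in> P x)}"
  define \<E> where "\<E> = {E. E \<subseteq> A \<and> real (card E) \<le> t}"
  define C where "C E = Pi\<^sub>E A (\<lambda>x. if x \<in> E then {1..r} else P x)" for E
  have fin: "finite \<E>" using A by (simp add: \<E>_def)
  have finC: "finite (C E)" for E unfolding C_def using A P by (intro finite_PiE) auto
  have "?C \<subseteq> (\<Union>E\<in>\<E>. C E)"
  proof
    fix c assume "c \<in> ?C"
    then obtain E where c: "c \<in> A \<rightarrow>\<^sub>E {1..r}" and E: "E \<subseteq> A" "real (card E) \<le> t" "\<forall>x\<in>A - E. c x \<in> P x" by blast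
    have "c \<in> C E" unfolding C_def
    proof (rule PiE_I)
      fix x assume "x \<in> A"
      then show "c x \<in> (if x \<in> E then {1..r} else P x)" using E(3) PiE_mem[OF c] by auto
    qed (use PiE_arb[OF c] in simp)
    then show "c \<in> (\<Union>E\<in>\<E>. C E)" using E by (auto simp: \<E>_def)
  qed
  then have "card ?C \<le> card (\<Union>E\<in>\<E>. C E)"
    using fin finC by (intro card_mono) auto
  also have "\<dots> \<le> (\<Sum>E\<in>\<E>. card (C E))" using fin by (rule card_UN_le)
  also have "\<dots> \<le> (\<Sum>E\<in>\<E>. r ^ card E * (\<Prod>x\<in>A. max 1 (card (P x))))"
  proof (intro sum_mono)
    fix E assume "E \<in> \<E>"
    then have E: "E \<subseteq> A" by (simp add: \<E>_def)
    have "card (C E) = (\<Prod>x\<in>A. card (if x \<in> E then {1..r} else P x))"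
      unfolding C_def using A by (rule card_PiE)
    also have "\<dots> \<le> (\<Prod>x\<in>A. (if x \<in> E then r else 1) * max 1 (card (P x)))"
      by (intro prod_mono) auto
    also have "\<dots> = (\<Prod>x\<in>A. if x \<in> E then r else 1) * (\<Prod>x\<in>A. max 1 (card (P x)))" by (rule prod.distrib)
    also have "(\<Prod>x\<in>A. if x \<in> E then r else 1) = r ^ card E"
      using A E by (simp add: prod.If_cases Int_absorb1)
    finally show "card (C E) \<le> r ^ card E * (\<Prod>x\<in>A. max 1 (card (P x)))" .
  qed
  also have "\<dots> = (\<Sum>E\<in>\<E>. r ^ card E) * (\<Prod>x\<in>A. max 1 (card (P x)))" by (simp add: sum_distrib_right)
  finally have "real (card ?C)
    \<le> real ((\<Sum>E\<in>\<E>. r ^ card E) * (\<Prod>x\<in>A. max 1 (card (P x))))" by (simp only: of_nat_le_iff)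
  then show ?thesis by (simp add: \<E>_def)
qed

text \<open>Compared with q choices at every point, a long list gains at most a factor r and a short
  list loses at least (q - 1) / q. The condition \<open>q \<ge> 2\<close> makes this true for empty
  lists too, which count as 1.\<close>

lemma prod_list_sizes_le:
  fixes A :: "'a set"
  assumes A: "finite A" and P: "\<And>x. P x \<subseteq> {1..r}" and r: "r \<ge> 1" and q: "q \<ge> 2"
  shows "real (\<Prod>x\<in>A. max 1 (card (P x)))
    \<le> real r ^ card {x\<in>A. card (P x) > q} * (real q ^ card A * ((real q - 1) / real q) ^ card {x\<in>A. card (P x) < q})"
proof -
  have "real (\<Prod>x\<in>A. max 1 (card (P x)))
     \<le> (\<Prod>x\<in>A. (if card (P x) > q then real r else 1) * (real q * (if card (P x) < q then (real q - 1) / real q else 1)))"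
    unfolding of_nat_prod
  proof (intro prod_mono conjI)
    fix x
    have "card (P x) \<le> r" using card_mono[OF _ P[of x]] by simp
    moreover have "real r \<le> real r * real q" using q mult_left_mono[of 1 "real q" "real r"] by simp
    ultimately have "real (card (P x)) \<le> real r * real q" by linarith
    then show "real (max 1 (card (P x))) \<le> (if card (P x) > q then real r else 1) * (real q * (if card (P x) < q then (real q - 1) / real q else 1))"
      using q by (auto simp: max_def)
  qed simp
  also have "\<dots> = (\<Prod>x\<in>A. if card (P x) > q then real r else 1) *
    ((\<Prod>x\<in>A. real q) * (\<Prod>x\<in>A. if card (P x) < q then (real q - 1) / real q else 1))"
    by (simp add: prod.distrib)
  also have "(\<Prod>x\<in>A. if card (P x) > q then real r else 1) = real r ^ card {x\<in>A. card (P x) > q}"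
    using A by (simp add: prod.If_cases Int_def)
  also have "(\<Prod>x\<in>A. if card (P x) < q then (real q - 1) / real q else 1) = ((real q - 1) / real q) ^ card {x\<in>A. card (P x) < q}"
    using A by (simp add: prod.If_cases Int_def)
  finally show ?thesis by simp
qed

text \<open>A list longer than q contains one of the rare (q + 1)-sets. Of the lists of size q at
  most one is popular, and by \<open>pop\<close> even that one misses u points of A. The remaining
  points must have short lists; each of the two unions over rare sets loses at most 2^r * t
  points.\<close>

lemma card_nonuniform_lists_le:
  fixes A :: "'a set" and t u :: real
  assumes A: "finite A" and P: "\<And>x. P x \<subseteq> {1..r}" and t: "t \<ge> 0" "u \<le> real (card A)"
    and large: "\<And>S. S \<subseteq> {1..r} \<Longrightarrow> card S = q + 1 \<Longrightarrow> real (card {x\<in>A. S \<subseteq> P x}) \<le> t"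
    and one: "\<And>L M. L \<subseteq> {1..r} \<Longrightarrow> card L = q \<Longrightarrow> M \<subseteq> {1..r} \<Longrightarrow> card M = q \<Longrightarrow> L \<noteq> M \<Longrightarrow>
        real (card {x\<in>A. L \<subseteq> P x}) \<le> t \<or> real (card {x\<in>A. M \<subseteq> P x}) \<le> t"
    and pop: "\<And>L. L \<subseteq> {1..r} \<Longrightarrow> card L = q \<Longrightarrow> real (card {x\<in>A. P x = L}) \<le> real (card A) - u"
  shows "real (card {x\<in>A. card (P x) > q}) \<le> 2 ^ r * t"
    and "real (card {x\<in>A. card (P x) < q}) \<ge> u - 2 * 2 ^ r * t"
proof -
  define \<L> where "\<L> = {L. L \<subseteq> {1..r} \<and> card L = q}"
  define \<U> where "\<U> = {S. S \<subseteq> {1..r} \<and> card S = q + 1}"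
  have fin: "finite \<L>" "finite \<U>" by (simp_all add: \<L>_def \<U>_def)
  have cL: "real (card \<X>) \<le> 2 ^ r" if "\<X> \<subseteq> Pow {1..r}" for \<X> :: "nat set set"
  proof -
    have "card \<X> \<le> card (Pow {1..r})" using that by (intro card_mono) auto
    then show ?thesis by (simp add: card_Pow flip: of_nat_power)
  qed
  have UN: "real (card (\<Union>L\<in>\<X>. X L)) \<le> 2 ^ r * t"
    if "\<X> \<subseteq> Pow {1..r}" "\<And>L. L \<in> \<X> \<Longrightarrow> real (card (X L)) \<le> t" for \<X> :: "nat set set" and X :: "nat set \<Rightarrow> 'a set"
  proof -
    have "finite \<X>" using that(1) finite_subset by blast
    then have "card (\<Union>L\<in>\<X>. X L) \<le> (\<Sum>L\<in>\<X>. card (X L))" by (rule card_UN_le)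
    then have "real (card (\<Union>L\<in>\<X>. X L)) \<le> (\<Sum>L\<in>\<X>. real (card (X L)))" by (simp flip: of_nat_sum)
    also have "\<dots> \<le> real (card \<X>) * t" using that(2) by (intro sum_bounded_above) auto
    also have "\<dots> \<le> 2 ^ r * t" using cL[OF that(1)] t by (intro mult_right_mono) auto
    finally show ?thesis .
  qed
  have "{x\<in>A. card (P x) > q} \<subseteq> (\<Union>S\<in>\<U>. {x\<in>A. S \<subseteq> P x})"
  proof
    fix x assume x: "x \<in> {x\<in>A. card (P x) > q}"
    then obtain S where S: "S \<subseteq> P x" "card S = q + 1"
      using obtain_subset_with_card_n[of "q + 1" "P x"] by auto
    then have "S \<in> \<U>" using P[of x] by (auto simp: \<U>_def)
    then show "x \<in> (\<Union>S\<in>\<U>. {x\<in>A. S \<subseteq> P x})" using S x by blast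
  qed
  then have "card {x\<in>A. card (P x) > q} \<le> card (\<Union>S\<in>\<U>. {x\<in>A. S \<subseteq> P x})"
    using A fin by (intro card_mono) auto
  moreover have "real (card (\<Union>S\<in>\<U>. {x\<in>A. S \<subseteq> P x})) \<le> 2 ^ r * t"
    by (rule UN) (auto simp: \<U>_def large)
  ultimately show big: "real (card {x\<in>A. card (P x) > q}) \<le> 2 ^ r * t" by linarith
  have mono: "real (card {x\<in>A. P x = L}) \<le> real (card {x\<in>A. L \<subseteq> P x})" for L
    using A by (simp add: card_mono Collect_mono)
  have eq: "real (card {x\<in>A. card (P x) = q}) \<le> real (card A) - u + 2 ^ r * t"
  proof (cases "\<exists>L0\<in>\<L>. real (card {x\<in>A. P x = L0}) > t")
    case True
    then obtain L0 where L0: "L0 \<in> \<L>" "real (card {x\<in>A. P x = L0}) > t" by blast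
    have "{x\<in>A. card (P x) = q} \<subseteq> {x\<in>A. P x = L0} \<union> (\<Union>L\<in>\<L> - {L0}. {x\<in>A. P x = L})"
      using P by (auto simp: \<L>_def)
    then have "card {x\<in>A. card (P x) = q} \<le> card ({x\<in>A. P x = L0} \<union> (\<Union>L\<in>\<L> - {L0}. {x\<in>A. P x = L}))"
      using A fin by (intro card_mono) auto
    also have "\<dots> \<le> card {x\<in>A. P x = L0} + card (\<Union>L\<in>\<L> - {L0}. {x\<in>A. P x = L})" by (rule card_Un_le)
    finally have "real (card {x\<in>A. card (P x) = q}) \<le> real (card {x\<in>A. P x = L0}) + real (card (\<Union>L\<in>\<L> - {L0}. {x\<in>A. P x = L}))"
      by linarith
    moreover have "real (card (\<Union>L\<in>\<L> - {L0}. {x\<in>A. P x = L})) \<le> 2 ^ r * t"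
    proof (rule UN)
      fix L assume L: "L \<in> \<L> - {L0}"
      have "real (card {x\<in>A. L \<subseteq> P x}) \<le> t \<or> real (card {x\<in>A. L0 \<subseteq> P x}) \<le> t"
        using L L0(1) by (intro one) (auto simp: \<L>_def)
      then show "real (card {x\<in>A. P x = L}) \<le> t" using L0(2) mono[of L] mono[of L0] by linarith
    qed (auto simp: \<L>_def)
    moreover have "real (card {x\<in>A. P x = L0}) \<le> real (card A) - u"
      using L0 by (intro pop) (auto simp: \<L>_def)
    ultimately show ?thesis by linarith
  next
    case False
    \<comment> \<open>No list of size q is popular here, so 2^r * t alone bounds their points;
      \<open>u \<le> card A\<close> turns this into the common bound.\<close>
    have "{x\<in>A. card (P x) = q} \<subseteq> (\<Union>L\<in>\<L>. {x\<in>A. P x = L})"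
      using P by (auto simp: \<L>_def)
    then have "card {x\<in>A. card (P x) = q} \<le> card (\<Union>L\<in>\<L>. {x\<in>A. P x = L})"
      using A fin by (intro card_mono) auto
    moreover have "real (card (\<Union>L\<in>\<L>. {x\<in>A. P x = L})) \<le> 2 ^ r * t"
    proof (rule UN)
      fix L assume "L \<in> \<L>"
      then show "real (card {x\<in>A. P x = L}) \<le> t" using False by (meson not_less)
    qed (auto simp: \<L>_def)
    ultimately show ?thesis using t by linarith
  qed
  have "card A = card ({x\<in>A. card (P x) > q} \<union> ({x\<in>A. card (P x) = q} \<union> {x\<in>A. card (P x) < q}))"
    by (rule arg_cong[of _ _ card]) auto
  also have "\<dots> = card {x\<in>A. card (P x) > q} + (card {x\<in>A. card (P x) = q} + card {x\<in>A. card (P x) < q})"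
    using A by (subst card_Un_disjoint card_Un_disjoint, auto)+
  finally show "real (card {x\<in>A. card (P x) < q}) \<ge> u - 2 * 2 ^ r * t"
    using eq big by linarith
qed

text \<open>Color j stays available at x only if x lies in all containers that stand for class j.
  Hence any pattern a drawn from the lists lies in the container family of a, which has few
  solutions.\<close>

definition template ::
  "nat \<Rightarrow> nat \<Rightarrow> nat \<Rightarrow> ((nat \<times> nat \<Rightarrow> nat) \<times> nat \<times> nat \<Rightarrow> 'a set) \<Rightarrow> 'a \<Rightarrow> nat set" where
  "template k h r F x = {j\<in>{1..r}. \<forall>a\<in>arrangements k h r. \<forall>p\<in>{1..k} \<times> {1..h}. a p = j \<longrightarrow> x \<in> F (a, p)}"

definition far_colorings :: "nat \<Rightarrow> nat \<Rightarrow> nat \<Rightarrow> real \<Rightarrow> (int ^ 'd) set \<Rightarrow> (int ^ 'd \<Rightarrow> nat) set" where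
  "far_colorings k h r t A = {c \<in> rainbow_free_colorings k h r A.
     \<forall>L\<subseteq>{1..r}. card L = k * h - 1 \<longrightarrow> t < real (card {x\<in>A. c x \<notin> L})}"

text \<open>Where the color of x is missing from its list, x was lost from a color class when one of
  the containers was formed; summing these losses over all pairs of an arrangement and a slot bounds
  the exceptions. The family F' extends F to slots outside the array, where F is not
  constrained.\<close>

lemma template_captures_coloring:
  fixes A :: "(int ^ 'd::finite) set"
  assumes c: "c \<in> rainbow_free_colorings k h r A" and A: "A \<subseteq> grid n"
    and close: "closes_slots k h ({1..k} \<times> {1..h}) \<eta> n \<S>"
  shows "\<exists>F \<in> (\<Pi>\<^sub>E ap\<in>arrangements k h r \<times> ({1..k} \<times> {1..h}). \<S> (snd ap)).
    (\<forall>a\<in>arrangements k h r. \<exists>F'. (\<forall>p\<in>{1..k} \<times> {1..h}. F' p = F (a, p)) \<and> (\<forall>q. F' q \<subseteq> grid n) \<and>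
       real (card (solutions k h F')) \<le> \<eta> * real (n ^ CARD('d)) ^ (k * (h - 1) + 1)) \<and>
    real (card {x\<in>A. c x \<notin> template k h r F x})
       \<le> real (card (arrangements k h r \<times> ({1..k} \<times> {1..h}))) * (\<eta> * real (n ^ CARD('d)))"
proof -
  define \<A> where "\<A> = arrangements k h r"
  define I where "I = {1..k} \<times> {1..h}"
  define D where "D a p = {x\<in>A. c x = a p}" for a :: "nat \<times> nat \<Rightarrow> nat" and p
  have "\<exists>F. (\<forall>q. F q \<subseteq> grid n) \<and>
           (\<forall>p\<in>I. F p \<in> \<S> p \<and> real (card (D a p - F p)) \<le> \<eta> * real (n ^ CARD('d))) \<and>
           real (card (solutions k h F)) \<le> \<eta> * real (n ^ CARD('d)) ^ (k * (h - 1) + 1)"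
    if "a \<in> \<A>" for a
  proof -
    have sol: "solutions k h (D a) = {}"
      unfolding D_def using c that unfolding \<A>_def by (rule color_classes_solution_free)
    have DG: "\<forall>q. D a q \<subseteq> grid n" using A unfolding D_def by blast
    from close[unfolded closes_slots_def, THEN spec, THEN mp, THEN mp, OF DG sol]
    show ?thesis unfolding I_def by (elim ex_forward) (elim conjE, intro conjI)
  qed
  then obtain F where F: "\<And>a q. a \<in> \<A> \<Longrightarrow> F a q \<subseteq> grid n"
    "\<And>a p. a \<in> \<A> \<Longrightarrow> p \<in> I \<Longrightarrow> F a p \<in> \<S> p \<and> real (card (D a p - F a p)) \<le> \<eta> * real (n ^ CARD('d))"
    "\<And>a. a \<in> \<A> \<Longrightarrow> real (card (solutions k h (F a))) \<le> \<eta> * real (n ^ CARD('d)) ^ (k * (h - 1) + 1)"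
    by metis
  \<comment> \<open>Restricting to the finite index set places the containers in an extensional
    product, whose cardinality is a product.\<close>
  define G where "G = (\<lambda>ap\<in>\<A> \<times> I. F (fst ap) (snd ap))"
  have G: "G (a, p) = F a p" if "a \<in> \<A>" "p \<in> I" for a p using that by (simp add: G_def)
  have finAI: "finite (\<A> \<times> I)" by (simp add: \<A>_def I_def finite_arrangements)
  have finA: "finite A" using A finite_subset finite_grid by blast
  have "G \<in> (\<Pi>\<^sub>E ap\<in>\<A> \<times> I. \<S> (snd ap))"
  proof (rule PiE_I)
    fix ap assume "ap \<in> \<A> \<times> I"
    then show "G ap \<in> \<S> (snd ap)" using F(2)[of "fst ap" "snd ap"] by (simp add: G_def mem_Times_iff)
  qed (simp add: G_def)
  moreover have "\<forall>a\<in>\<A>. \<exists>F'. (\<forall>p\<in>I. F' p = G (a, p)) \<and> (\<forall>q. F' q \<subseteq> grid n) \<and>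
       real (card (solutions k h F')) \<le> \<eta> * real (n ^ CARD('d)) ^ (k * (h - 1) + 1)"
  proof
    fix a assume a: "a \<in> \<A>"
    show "\<exists>F'. (\<forall>p\<in>I. F' p = G (a, p)) \<and> (\<forall>q. F' q \<subseteq> grid n) \<and>
       real (card (solutions k h F')) \<le> \<eta> * real (n ^ CARD('d)) ^ (k * (h - 1) + 1)"
      using G[OF a] F(1,3)[OF a] by (intro exI[of _ "F a"]) simp
  qed
  moreover have "real (card {x\<in>A. c x \<notin> template k h r G x}) \<le> real (card (\<A> \<times> I)) * (\<eta> * real (n ^ CARD('d)))"
  proof -
    have "{x\<in>A. c x \<notin> template k h r G x} \<subseteq> (\<Union>ap\<in>\<A> \<times> I. D (fst ap) (snd ap) - F (fst ap) (snd ap))"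
    proof
      fix x assume x: "x \<in> {x\<in>A. c x \<notin> template k h r G x}"
      have "c \<in> A \<rightarrow>\<^sub>E {1..r}" using c by (simp add: rainbow_free_colorings_def)
      then have "c x \<in> {1..r}" by (rule PiE_mem) (use x in blast)
      then obtain a p where ap: "a \<in> \<A>" "p \<in> I" "a p = c x" "x \<notin> G (a, p)"
        using x unfolding template_def \<A>_def I_def by blast
      then have "x \<in> D (fst (a, p)) (snd (a, p)) - F (fst (a, p)) (snd (a, p))" using x G by (simp add: D_def)
      then show "x \<in> (\<Union>ap\<in>\<A> \<times> I. D (fst ap) (snd ap) - F (fst ap) (snd ap))"
        using ap by blast
    qed
    then have "card {x\<in>A. c x \<notin> template k h r G x} \<le> card (\<Union>ap\<in>\<A> \<times> I. D (fst ap) (snd ap) - F (fst ap) (snd ap))"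
      using finA finAI by (intro card_mono) (auto simp: D_def)
    also have "\<dots> \<le> (\<Sum>ap\<in>\<A> \<times> I. card (D (fst ap) (snd ap) - F (fst ap) (snd ap)))"
      using finAI by (rule card_UN_le)
    finally have "real (card {x\<in>A. c x \<notin> template k h r G x}) \<le> (\<Sum>ap\<in>\<A> \<times> I. real (card (D (fst ap) (snd ap) - F (fst ap) (snd ap))))"
      by (simp flip: of_nat_sum)
    also have "\<dots> \<le> real (card (\<A> \<times> I)) * (\<eta> * real (n ^ CARD('d)))"
    proof (rule sum_bounded_above)
      fix ap assume "ap \<in> \<A> \<times> I"
      then show "real (card (D (fst ap) (snd ap) - F (fst ap) (snd ap))) \<le> \<eta> * real (n ^ CARD('d))"
        using F(2)[of "fst ap" "snd ap"] by (simp add: mem_Times_iff)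
    qed
    finally show ?thesis .
  qed
  ultimately show ?thesis unfolding \<A>_def I_def by blast
qed

text \<open>A template that almost captures a coloring far from every palette cannot have one
  dominant list. So linearly many lists are short, and their losses are weighed against the few long
  lists. The bound no longer mentions c.\<close>

lemma template_product_le:
  fixes A :: "(int ^ 'd::finite) set" and F
  defines "N \<equiv> (\<lambda>n. real (n ^ CARD('d)))"
  assumes kh: "k \<ge> 2" "h \<ge> 2" and r: "r \<ge> k * h" and n: "n \<ge> 1" and A: "A \<subseteq> grid n"
    and \<delta>: "\<delta> > 0" "\<eta> * real ((h ^ CARD('d)) ^ (k - 1)) < \<delta> ^ (k * h)"
    and F: "\<forall>a\<in>arrangements k h r. \<exists>F'. (\<forall>p\<in>{1..k} \<times> {1..h}. F' p = F (a, p)) \<and> (\<forall>q. F' q \<subseteq> grid n) \<and>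
       real (card (solutions k h F')) \<le> \<eta> * N n ^ (k * (h - 1) + 1)"
    and c: "c \<in> far_colorings k h r (\<beta> * N n) A"
    and ex: "real (card {x\<in>A. c x \<notin> template k h r F x}) \<le> \<xi> * N n"
    and par: "\<xi> \<ge> 0" "\<beta> - \<xi> - 2 * 2 ^ r * \<delta> \<ge> \<beta> / 2"
  shows "real (\<Prod>x\<in>A. max 1 (card (template k h r F x)))
    \<le> real r powr (2 ^ r * \<delta> * N n) * (real (k * h - 1) ^ card A *
        ((real (k * h - 1) - 1) / real (k * h - 1)) powr (\<beta> / 2 * N n))"
proof -
  define q where "q = k * h - 1"
  have "2 * 2 \<le> k * h" using kh by (intro mult_le_mono)
  then have q: "q \<ge> 3" "q + 1 = k * h" by (simp_all add: q_def)
  have r1: "r \<ge> 1" using q r by linarith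
  have N: "N n > 0" using n by (simp add: N_def)
  have finA: "finite A" using A finite_subset finite_grid by blast
  define P where "P = template k h r F"
  have Pr: "P x \<subseteq> {1..r}" for x by (auto simp: P_def template_def)
  have star: "\<exists>i\<in>{1..h}. real (card (B i)) < \<delta> * N n"
    if a: "a \<in> arrangements k h r" and B: "\<And>i. B i \<subseteq> A"
      and aP: "\<And>l i x. l \<in> {1..k} \<Longrightarrow> i \<in> {1..h} \<Longrightarrow> x \<in> B i \<Longrightarrow> a (l, i) \<in> P x" for a B
  proof -
    obtain F' where F': "\<forall>p\<in>{1..k} \<times> {1..h}. F' p = F (a, p)" "\<forall>q. F' q \<subseteq> grid n"
       "real (card (solutions k h F')) \<le> \<eta> * N n ^ (k * (h - 1) + 1)"
      using F[rule_format, OF a] by (elim exE conjE)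
    show ?thesis unfolding N_def
    proof (rule solutions_supersaturation[OF _ _ n \<delta>(1) F'(3)[unfolded N_def] _ _ _ \<delta>(2)])
      show "B i \<subseteq> F' (l, i)" if l: "l \<in> {1..k}" "i \<in> {1..h}" for l i
      proof
        fix x assume "x \<in> B i"
        from aP[OF l this] have "x \<in> F (a, (l, i))" using a l unfolding P_def template_def by blast
        then show "x \<in> F' (l, i)" using F'(1) l by blast
      qed
    qed (use kh F'(2) B A in blast | use kh in linarith)+
  qed
  have far: "\<beta> * N n < real (card {x\<in>A. c x \<notin> L})" if "L \<subseteq> {1..r}" "card L = q" for L
    using c that unfolding far_colorings_def q_def by blast
  \<comment> \<open>Points with list L and points colored outside L overlap only where the color is
    missing from the list, that is in at most \<xi> N points.\<close>
  have far': "real (card {x\<in>A. P x = L}) \<le> real (card A) - (\<beta> - \<xi>) * N n" if L: "L \<subseteq> {1..r}" "card L = q" for L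
  proof -
    have "{x\<in>A. P x = L} \<union> {x\<in>A. c x \<notin> L} \<subseteq> A" by blast
    then have "card ({x\<in>A. P x = L} \<union> {x\<in>A. c x \<notin> L}) \<le> card A" using finA by (rule card_mono[rotated])
    moreover have "{x\<in>A. P x = L} \<inter> {x\<in>A. c x \<notin> L} \<subseteq> {x\<in>A. c x \<notin> P x}" by blast
    then have "card ({x\<in>A. P x = L} \<inter> {x\<in>A. c x \<notin> L}) \<le> card {x\<in>A. c x \<notin> P x}" using finA by (intro card_mono) auto
    moreover have "card {x\<in>A. P x = L} + card {x\<in>A. c x \<notin> L} =
        card ({x\<in>A. P x = L} \<union> {x\<in>A. c x \<notin> L}) + card ({x\<in>A. P x = L} \<inter> {x\<in>A. c x \<notin> L})"
      using finA by (intro card_Un_Int) auto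
    ultimately have "real (card {x\<in>A. P x = L}) + real (card {x\<in>A. c x \<notin> L}) \<le> real (card A) + real (card {x\<in>A. c x \<notin> P x})"
      by linarith
    then show ?thesis using far[OF L] ex unfolding P_def[symmetric] by (simp add: left_diff_distrib)
  qed
  obtain L where L: "L \<subseteq> {1..r}" "card L = q"
    using obtain_subset_with_card_n[of q "{1..r}"] r q by auto
  have "real (card {x\<in>A. c x \<notin> L}) \<le> real (card A)" using finA by (simp add: card_mono)
  then have uA: "(\<beta> - \<xi>) * N n \<le> real (card A)"
    using far[OF L] par N by (smt (verit) mult_right_mono)
  have t: "\<delta> * N n \<ge> 0" using \<delta> N by simp
  have large: "real (card {x\<in>A. S \<subseteq> P x}) \<le> \<delta> * N n" if "S \<subseteq> {1..r}" "card S = q + 1" for S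
    using few_large_lists[of k h r A P "\<delta> * N n", OF star that(1)] that(2) q(2) by fastforce
  have one: "real (card {x\<in>A. L \<subseteq> P x}) \<le> \<delta> * N n \<or> real (card {x\<in>A. M \<subseteq> P x}) \<le> \<delta> * N n"
    if "L \<subseteq> {1..r}" "card L = q" "M \<subseteq> {1..r}" "card M = q" "L \<noteq> M" for L M
    using one_popular_list[of k h r A P "\<delta> * N n" L M, OF _ _ star] that kh unfolding q_def by fastforce
  have b1: "real (card {x\<in>A. card (P x) > q}) \<le> 2 ^ r * (\<delta> * N n)"
    using card_nonuniform_lists_le(1)[OF finA Pr t uA large one far'] by blast
  have "real (card {x\<in>A. card (P x) < q}) \<ge> (\<beta> - \<xi>) * N n - 2 * 2 ^ r * (\<delta> * N n)"
    using card_nonuniform_lists_le(2)[OF finA Pr t uA large one far'] by blast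
  also have "(\<beta> - \<xi>) * N n - 2 * 2 ^ r * (\<delta> * N n) = (\<beta> - \<xi> - 2 * 2 ^ r * \<delta>) * N n" by (simp add: algebra_simps)
  finally have "(\<beta> - \<xi> - 2 * 2 ^ r * \<delta>) * N n \<le> real (card {x\<in>A. card (P x) < q})" .
  moreover have "\<beta> / 2 * N n \<le> (\<beta> - \<xi> - 2 * 2 ^ r * \<delta>) * N n" using par N by (intro mult_right_mono) auto
  ultimately have b2: "\<beta> / 2 * N n \<le> real (card {x\<in>A. card (P x) < q})" by linarith
  define \<theta> where "\<theta> = (real q - 1) / real q"
  have \<theta>: "0 < \<theta>" "\<theta> \<le> 1" using q by (simp_all add: \<theta>_def)
  have "real (\<Prod>x\<in>A. max 1 (card (P x))) \<le> real r ^ card {x\<in>A. card (P x) > q} *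
      (real q ^ card A * \<theta> ^ card {x\<in>A. card (P x) < q})"
    unfolding \<theta>_def using q by (intro prod_list_sizes_le[OF finA Pr r1]) simp
  also have "\<dots> \<le> real r powr (2 ^ r * \<delta> * N n) * (real q ^ card A * \<theta> powr (\<beta> / 2 * N n))"
  proof (intro mult_mono mult_left_mono)
    have "real r ^ card {x\<in>A. card (P x) > q} = real r powr real (card {x\<in>A. card (P x) > q})"
      using r1 by (simp add: powr_realpow)
    also have "\<dots> \<le> real r powr (2 ^ r * \<delta> * N n)" using b1 r1 by (intro powr_mono) (auto simp: mult.assoc)
    finally show "real r ^ card {x\<in>A. card (P x) > q} \<le> real r powr (2 ^ r * \<delta> * N n)" .
    have "\<theta> ^ card {x\<in>A. card (P x) < q} = \<theta> powr real (card {x\<in>A. card (P x) < q})"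
      using \<theta> by (simp add: powr_realpow)
    also have "\<dots> \<le> \<theta> powr (\<beta> / 2 * N n)" using b2 \<theta> by (intro powr_mono') auto
    finally show "\<theta> ^ card {x\<in>A. card (P x) < q} \<le> \<theta> powr (\<beta> / 2 * N n)" .
  qed (use \<theta> in auto)
  finally show ?thesis unfolding P_def \<theta>_def q_def .
qed

text \<open>A union bound over templates. A factor b^N is paid for each container, for the
  exceptional set and for the long lists, R + 2 in all, against the gain \<kappa>0^N from short
  lists.\<close>

lemma far_colorings_few:
  fixes \<beta> :: real
  assumes k: "k \<ge> 2" and h: "h \<ge> 2" and r: "r \<ge> k * h" and \<beta>: "\<beta> > 0"
  shows "\<exists>\<kappa> n0. 0 < \<kappa> \<and> \<kappa> < 1 \<and> (\<forall>n\<ge>n0. \<forall>A\<subseteq>(grid n :: (int ^ 'd::finite) set).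
    real (card (far_colorings k h r (\<beta> * real (n ^ CARD('d))) A)) \<le> real (k * h - 1) ^ card A * \<kappa> ^ (n ^ CARD('d)))"
proof -
  define q where "q = k * h - 1"
  have "2 * 2 \<le> k * h" using k h by (intro mult_le_mono)
  then have q: "q \<ge> 3" and r4: "r \<ge> 4" using r by (simp_all add: q_def)
  define \<theta> where "\<theta> = (real q - 1) / real q"
  have \<theta>: "0 < \<theta>" "\<theta> < 1" using q by (simp_all add: \<theta>_def)
  define \<Phi> where "\<Phi> = arrangements k h r \<times> ({1..k} \<times> {1..h})"
  have fin\<Phi>: "finite \<Phi>" by (simp add: \<Phi>_def finite_arrangements)
  define R where "R = card \<Phi>"
  define \<kappa>0 where "\<kappa>0 = \<theta> powr (\<beta> / 2)"
  have \<kappa>0: "0 < \<kappa>0" "\<kappa>0 < 1"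
    using \<theta> \<beta> powr_less_mono'[of \<theta> 0 "\<beta> / 2"] by (auto simp: \<kappa>0_def)
  \<comment> \<open>Chosen so that b^(R+2) is the inverse square root of \<kappa>0; the net gain is
    still \<open>\<kappa>0 powr (1 / 2)\<close>.\<close>
  define b where "b = \<kappa>0 powr (- 1 / (2 * real (R + 2)))"
  have b: "b > 1"
    unfolding b_def using \<kappa>0 powr_less_mono'[of \<kappa>0 "- 1 / (2 * real (R + 2))" 0] by (simp add: divide_neg_pos)
  define \<kappa> where "\<kappa> = \<kappa>0 powr (1 / 2)"
  have \<kappa>: "0 < \<kappa>" "\<kappa> < 1"
    using \<kappa>0 powr_less_mono'[of \<kappa>0 0 "1/2"] by (auto simp: \<kappa>_def)
  have b\<kappa>: "b ^ (R + 2) * \<kappa>0 = \<kappa>"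
  proof -
    have "b ^ (R + 2) = b powr real (R + 2)" using b by (subst powr_realpow) auto
    also have "\<dots> = \<kappa>0 powr (- 1 / (2 * real (R + 2)) * real (R + 2))" unfolding b_def by (rule powr_powr)
    also have "\<dots> = \<kappa>0 powr (- 1 / 2)" by (rule arg_cong[of _ _ "(powr) \<kappa>0"]) (simp add: field_simps)
    finally have "b ^ (R + 2) * \<kappa>0 = \<kappa>0 powr (- 1 / 2) * \<kappa>0 powr 1" using \<kappa>0 by simp
    also have "\<dots> = \<kappa>" unfolding \<kappa>_def powr_add[symmetric] by simp
    finally show ?thesis .
  qed
  obtain \<alpha> where \<alpha>: "\<alpha> > 0" and small: "\<And>(S :: (int ^ 'd) set) M. finite S \<Longrightarrow> real (card S) \<le> M \<Longrightarrow>
    (\<Sum>E | E \<subseteq> S \<and> real (card E) \<le> \<alpha> * M. real r ^ card E) \<le> b powr M"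
    using weighted_count_small_subsets[OF b, of "real r", where 'a = "int ^ 'd"] r4 by auto
  \<comment> \<open>The bound \<beta>/8 leaves at least \<beta>/2 for the short lists in
    \<open>template_product_le\<close>; the bound by logarithms makes the long lists cost at most
    b^N.\<close>
  define \<delta> where "\<delta> = min (\<beta> / 8) (ln b / ln (real r)) / 2 ^ r"
  have lnr: "ln (real r) > 0" using r4 by simp
  have "2 ^ r * \<delta> = min (\<beta> / 8) (ln b / ln (real r))" by (simp add: \<delta>_def)
  moreover have "\<delta> > 0" using \<beta> b lnr by (simp add: \<delta>_def)
  ultimately have \<delta>: "\<delta> > 0" "2 ^ r * \<delta> \<le> \<beta> / 8" "2 ^ r * \<delta> \<le> ln b / ln (real r)"
    by linarith+
  define H where "H = real ((h ^ CARD('d)) ^ (k - 1))"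
  have H: "H > 0" using h by (simp add: H_def)
  \<comment> \<open>The R container losses must stay below the entropy threshold \<alpha> and below
    \<beta>/4, and \<eta> must be small enough for \<open>solutions_supersaturation\<close>.\<close>
  define \<eta> where "\<eta> = min (min \<alpha> (\<beta> / 4) / (real R + 1)) (\<delta> ^ (k * h) / (2 * H))"
  have \<eta>0: "\<eta> > 0" using \<alpha> \<beta> \<delta> H by (simp add: \<eta>_def)
  have "\<eta> * H \<le> \<delta> ^ (k * h) / (2 * H) * H" using H by (intro mult_right_mono) (simp_all add: \<eta>_def)
  also have "\<dots> < \<delta> ^ (k * h)" using H \<delta> by simp
  finally have \<eta>H: "\<eta> * H < \<delta> ^ (k * h)" .
  have "real R * \<eta> \<le> (real R + 1) * \<eta>" using \<eta>0 by (intro mult_right_mono) auto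
  also have "\<dots> \<le> (real R + 1) * (min \<alpha> (\<beta> / 4) / (real R + 1))"
    by (intro mult_left_mono) (auto simp: \<eta>_def)
  finally have R\<eta>: "real R * \<eta> \<le> min \<alpha> (\<beta> / 4)" by simp
  obtain n0 where n0: "\<forall>n\<ge>n0. \<exists>\<S> :: nat \<times> nat \<Rightarrow> (int ^ 'd) set set.
    (\<forall>p\<in>{1..k} \<times> {1..h}. finite (\<S> p) \<and> real (card (\<S> p)) \<le> b ^ (n ^ CARD('d))) \<and> closes_slots k h ({1..k} \<times> {1..h}) \<eta> n \<S>"
    using closure_slots[OF h _ subset_refl \<eta>0 b, of k, where 'd = 'd] by auto
  have "real (card (far_colorings k h r (\<beta> * real (n ^ CARD('d))) A)) \<le> real (k * h - 1) ^ card A * \<kappa> ^ (n ^ CARD('d))"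
    if n: "n \<ge> max 1 n0" and A: "A \<subseteq> (grid n :: (int ^ 'd) set)" for n A
  proof -
    define N where "N = n ^ CARD('d)"
    have n1: "n \<ge> 1" "n \<ge> n0" using n by auto
    obtain \<S> :: "nat \<times> nat \<Rightarrow> (int ^ 'd) set set" where
      S: "\<forall>p\<in>{1..k} \<times> {1..h}. finite (\<S> p) \<and> real (card (\<S> p)) \<le> b ^ N"
      and close: "closes_slots k h ({1..k} \<times> {1..h}) \<eta> n \<S>"
      using n0[rule_format, OF n1(2)] unfolding N_def by blast
    have finA: "finite A" using A finite_subset finite_grid by blast
    have cA: "real (card A) \<le> real N"
      using card_mono[OF finite_grid A] by (simp add: N_def card_grid flip: of_nat_power)
    define \<F> where "\<F> = (\<Pi>\<^sub>E ap\<in>\<Phi>. \<S> (snd ap))"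
    define C where "C F = {c \<in> A \<rightarrow>\<^sub>E {1..r}. \<exists>E\<subseteq>A. real (card E) \<le> \<alpha> * real N \<and> (\<forall>x\<in>A - E. c x \<in> template k h r F x)}" for F
    \<comment> \<open>Only templates with a small product enter the union bound. Every far coloring
      yields such a template, though other container families may not.\<close>
    define good where "good F \<longleftrightarrow> real (\<Prod>x\<in>A. max 1 (card (template k h r F x))) \<le> b ^ N * (real q ^ card A * \<kappa>0 ^ N)" for F
    have finF: "finite \<F>" unfolding \<F>_def
      using S fin\<Phi> by (intro finite_PiE) (auto simp: \<Phi>_def)
    have cF: "real (card \<F>) \<le> (b ^ N) ^ R"
    proof -
      have "real (card \<F>) = (\<Prod>ap\<in>\<Phi>. real (card (\<S> (snd ap))))"
        unfolding \<F>_def using fin\<Phi> by (simp add: card_PiE)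
      also have "\<dots> \<le> (\<Prod>ap\<in>\<Phi>. b ^ N)" using S by (intro prod_mono) (auto simp: \<Phi>_def)
      finally show ?thesis by (simp add: R_def)
    qed
    have cover: "far_colorings k h r (\<beta> * real N) A \<subseteq> (\<Union>F\<in>{F\<in>\<F>. good F}. C F)"
    proof
      fix c assume c: "c \<in> far_colorings k h r (\<beta> * real N) A"
      then have rf: "c \<in> rainbow_free_colorings k h r A" by (simp add: far_colorings_def)
      obtain F where F: "F \<in> \<F>"
        "\<forall>a\<in>arrangements k h r. \<exists>F'. (\<forall>p\<in>{1..k} \<times> {1..h}. F' p = F (a, p)) \<and> (\<forall>q. F' q \<subseteq> grid n) \<and>
          real (card (solutions k h F')) \<le> \<eta> * real (n ^ CARD('d)) ^ (k * (h - 1) + 1)"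
        "real (card {x\<in>A. c x \<notin> template k h r F x}) \<le> real R * (\<eta> * real (n ^ CARD('d)))"
        using template_captures_coloring[OF rf A close] unfolding \<F>_def \<Phi>_def R_def by (elim bexE conjE)
      have ex: "real (card {x\<in>A. c x \<notin> template k h r F x}) \<le> (real R * \<eta>) * real (n ^ CARD('d))"
        using F(3) by (simp only: mult.assoc)
      have par: "real R * \<eta> \<ge> 0" "\<beta> - real R * \<eta> - 2 * 2 ^ r * \<delta> \<ge> \<beta> / 2"
        using \<eta>0 R\<eta> \<delta>(2) by auto
      have "real (\<Prod>x\<in>A. max 1 (card (template k h r F x)))
        \<le> real r powr (2 ^ r * \<delta> * real (n ^ CARD('d))) * (real (k * h - 1) ^ card A *
        ((real (k * h - 1) - 1) / real (k * h - 1)) powr (\<beta> / 2 * real (n ^ CARD('d))))"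
        by (rule template_product_le[OF k h r n1(1) A \<delta>(1) \<eta>H[unfolded H_def] F(2) c[unfolded N_def] ex par])
      also have "\<dots> = real r powr (2 ^ r * \<delta> * real N) * (real q ^ card A * \<theta> powr (\<beta> / 2 * real N))"
        by (simp only: N_def q_def \<theta>_def)
      also have "\<dots> \<le> b ^ N * (real q ^ card A * \<kappa>0 ^ N)"
      proof (intro mult_mono mult_left_mono)
        have "real r powr (2 ^ r * \<delta>) \<le> real r powr (ln b / ln (real r))"
          using \<delta>(3) r4 by (intro powr_mono) auto
        also have "\<dots> = b" using lnr b r4 by (simp add: powr_def)
        finally have "(real r powr (2 ^ r * \<delta>)) powr real N \<le> b powr real N" by (intro powr_mono2) auto
        then show "real r powr (2 ^ r * \<delta> * real N) \<le> b ^ N"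
          using b by (simp add: powr_powr powr_realpow)
        have "\<theta> powr (\<beta> / 2 * real N) = \<kappa>0 powr real N" unfolding \<kappa>0_def by (simp add: powr_powr)
        then show "\<theta> powr (\<beta> / 2 * real N) \<le> \<kappa>0 ^ N" using \<kappa>0 by (simp add: powr_realpow)
      qed (use b in auto)
      finally have "good F" by (simp only: good_def)
      moreover have "c \<in> C F" unfolding C_def
      proof (intro CollectI conjI exI[of _ "{x\<in>A. c x \<notin> template k h r F x}"])
        show "c \<in> A \<rightarrow>\<^sub>E {1..r}" using rf by (simp add: rainbow_free_colorings_def)
        have "real R * \<eta> * real (n ^ CARD('d)) \<le> \<alpha> * real (n ^ CARD('d))"
          using R\<eta> by (intro mult_right_mono) auto
        then show "real (card {x\<in>A. c x \<notin> template k h r F x}) \<le> \<alpha> * real N" using ex unfolding N_def by linarith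
      qed blast+
      ultimately show "c \<in> (\<Union>F\<in>{F\<in>\<F>. good F}. C F)" using F(1) by blast
    qed
    have CF: "real (card (C F)) \<le> b ^ N * (b ^ N * (real q ^ card A * \<kappa>0 ^ N))" if "good F" for F
    proof -
      have "finite (template k h r F x)" for x by (simp add: template_def)
      then have "real (card (C F)) \<le> (\<Sum>E | E \<subseteq> A \<and> real (card E) \<le> \<alpha> * real N. real r ^ card E) * real (\<Prod>x\<in>A. max 1 (card (template k h r F x)))"
        unfolding C_def using finA by (intro card_almost_in_lists)
      also have "\<dots> \<le> b powr real N * (b ^ N * (real q ^ card A * \<kappa>0 ^ N))"
        by (rule mult_mono[OF small[OF finA cA] that[unfolded good_def] powr_ge_zero of_nat_0_le_iff])
      also have "b powr real N = b ^ N" using b by (subst powr_realpow) auto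
      finally show ?thesis .
    qed
    have "finite (C F)" for F
      unfolding C_def by (rule finite_subset[OF _ finite_PiE[OF finA, of "\<lambda>_. {1..r}"]]) auto
    then have "card (far_colorings k h r (\<beta> * real N) A) \<le> card (\<Union>F\<in>{F\<in>\<F>. good F}. C F)"
      using cover finF by (intro card_mono) auto
    also have "\<dots> \<le> (\<Sum>F\<in>{F\<in>\<F>. good F}. card (C F))" using finF by (intro card_UN_le) auto
    finally have "real (card (far_colorings k h r (\<beta> * real N) A)) \<le> (\<Sum>F\<in>{F\<in>\<F>. good F}. real (card (C F)))"
      by (simp flip: of_nat_sum)
    also have "\<dots> \<le> real (card {F\<in>\<F>. good F}) * (b ^ N * (b ^ N * (real q ^ card A * \<kappa>0 ^ N)))"
      using CF by (intro sum_bounded_above) auto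
    also have "\<dots> \<le> (b ^ N) ^ R * (b ^ N * (b ^ N * (real q ^ card A * \<kappa>0 ^ N)))"
    proof (rule mult_right_mono)
      have "card {F\<in>\<F>. good F} \<le> card \<F>" using finF by (intro card_mono) auto
      then show "real (card {F\<in>\<F>. good F}) \<le> (b ^ N) ^ R" using cF by linarith
    qed (use b \<kappa>0 in auto)
    also have "\<dots> = real q ^ card A * (b ^ (R + 2) * \<kappa>0) ^ N"
      by (simp add: power_mult_distrib power_add power_mult[symmetric] mult_ac power2_eq_square)
    finally show ?thesis unfolding b\<kappa> q_def N_def .
  qed
  then show ?thesis using \<kappa> by blast
qed

section \<open>Colorings close to a palette\<close>

text \<open>Disjoint blocks are independent: each one excludes one of its (card L)^m patterns, so a
  random coloring survives it with probability 1 - 1 / (card L)^m. The induction splits off one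
  block.\<close>

lemma card_avoiding_blocks:
  fixes p :: "'t \<Rightarrow> 'a \<Rightarrow> 'b" and B :: "'t \<Rightarrow> 'a set"
  assumes "finite T" "finite D" and L: "finite L" "card L \<ge> 1"
    and "\<And>t. t \<in> T \<Longrightarrow> B t \<subseteq> D" "\<And>t. t \<in> T \<Longrightarrow> card (B t) = m"
    and "\<And>t t'. t \<in> T \<Longrightarrow> t' \<in> T \<Longrightarrow> t \<noteq> t' \<Longrightarrow> B t \<inter> B t' = {}"
    and "\<And>t. t \<in> T \<Longrightarrow> p t \<in> B t \<rightarrow>\<^sub>E L"
  shows "real (card {c \<in> D \<rightarrow>\<^sub>E L. \<forall>t\<in>T. restrict c (B t) \<noteq> p t})
    \<le> real (card L) ^ card D * (1 - 1 / real (card L) ^ m) ^ card T"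
  using assms(1,2,5-8)
proof (induction T arbitrary: D rule: finite_induct)
  case empty
  then show ?case by (simp add: card_funcsetE)
next
  case (insert t T)
  define q where "q = real (card L)"
  have q: "q \<ge> 1" using L by (simp add: q_def)
  define D' where "D' = D - B t"
  have Bt: "B t \<subseteq> D" "card (B t) = m" "p t \<in> B t \<rightarrow>\<^sub>E L" using insert.prems by auto
  have fin: "finite D" "finite D'" "finite (B t)"
    using insert.prems(1) Bt(1) finite_subset by (auto simp: D'_def)
  have DD: "card D = m + card D'" unfolding D'_def using Bt fin card_mono[of D "B t"] by (simp add: card_Diff_subset)
  define C where "C = {c \<in> D \<rightarrow>\<^sub>E L. \<forall>t\<in>insert t T. restrict c (B t) \<noteq> p t}"
  define C' where "C' = {c \<in> D' \<rightarrow>\<^sub>E L. \<forall>t\<in>T. restrict c (B t) \<noteq> p t}"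
  have sub: "B s \<subseteq> D'" if "s \<in> T" for s
    using insert.prems(2)[of s] insert.prems(4)[of t s] insert.hyps(2) that by (auto simp: D'_def)
  have IH: "real (card C') \<le> q ^ card D' * (1 - 1 / q ^ m) ^ card T"
    unfolding C'_def q_def using insert.prems sub fin by (intro insert.IH) auto
  have inj: "inj_on (\<lambda>c. (restrict c (B t), restrict c D')) C"
  proof (rule inj_onI)
    fix c d assume c: "c \<in> C" and d: "d \<in> C" and eq: "(restrict c (B t), restrict c D') = (restrict d (B t), restrict d D')"
    have "c \<in> D \<rightarrow>\<^sub>E L" "d \<in> D \<rightarrow>\<^sub>E L" using c d by (simp_all add: C_def)
    then show "c = d"
    proof (rule PiE_ext)
      fix x assume "x \<in> D"
      then have "x \<in> B t \<or> x \<in> D'" by (auto simp: D'_def)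
      then show "c x = d x" using eq by (metis prod.inject restrict_apply')
    qed
  qed
  have img: "(\<lambda>c. (restrict c (B t), restrict c D')) ` C \<subseteq> ((B t \<rightarrow>\<^sub>E L) - {p t}) \<times> C'"
  proof (rule image_subsetI)
    fix c assume c: "c \<in> C"
    then have cD: "c \<in> D \<rightarrow>\<^sub>E L" by (simp add: C_def)
    have res: "restrict c S \<in> S \<rightarrow>\<^sub>E L" if "S \<subseteq> D" for S
      using cD that by (rule restrict_in_PiE) simp
    have "restrict (restrict c D') (B s) \<noteq> p s" if "s \<in> T" for s
      using c that sub[OF that] by (simp add: C_def restrict_restrict Int_absorb1)
    then have "restrict c D' \<in> C'" using res[of D'] by (simp add: C'_def D'_def)
    moreover have "restrict c (B t) \<noteq> p t" using c by (simp add: C_def)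
    ultimately show "(restrict c (B t), restrict c D') \<in> ((B t \<rightarrow>\<^sub>E L) - {p t}) \<times> C'"
      using res[OF Bt(1)] by simp
  qed
  have finC': "finite C'" unfolding C'_def
    by (rule finite_subset[OF _ finite_PiE[OF fin(2), of "\<lambda>_. L"]]) (use L in auto)
  have "card C \<le> card (((B t \<rightarrow>\<^sub>E L) - {p t}) \<times> C')"
    using finC' fin L by (intro card_inj_on_le[OF inj img] finite_cartesian_product finite_Diff finite_PiE) auto
  also have "\<dots> = (card L ^ m - 1) * card C'"
    using Bt fin by (simp add: card_cartesian_product card_funcsetE)
  finally have "real (card C) \<le> real ((card L ^ m - 1) * card C')" by (simp only: of_nat_le_iff)
  also have "\<dots> = (real (card L ^ m) - 1) * real (card C')" using L by (simp add: of_nat_diff)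
  also have "\<dots> = (q ^ m - 1) * real (card C')" by (simp add: q_def)
  also have "\<dots> \<le> (q ^ m - 1) * (q ^ card D' * (1 - 1 / q ^ m) ^ card T)"
    using IH q by (intro mult_left_mono) auto
  also have "\<dots> = q ^ card D * (1 - 1 / q ^ m) ^ card (insert t T)"
  proof -
    have "q ^ m - 1 = q ^ m * (1 - 1 / q ^ m)" using q by (simp add: right_diff_distrib)
    then show ?thesis using insert.hyps by (simp add: DD power_add)
  qed
  finally show ?case unfolding C_def q_def .
qed

text \<open>A \<open>k \<times> h\<close> array of distinct non-negative integers with constant row sums and entry \<open>0\<close> at \<open>(1,1)\<close>:
  the second column balances the sums of consecutive integers in the other columns.\<close>

lemma balanced_array_exists:
  fixes k h :: nat
  assumes h: "h \<ge> 2"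
  shows "\<exists>(\<beta> :: nat \<times> nat \<Rightarrow> int) S. inj_on \<beta> ({1..k} \<times> {1..h}) \<and> (\<forall>p\<in>{1..k} \<times> {1..h}. 0 \<le> \<beta> p \<and> \<beta> p \<le> S)
    \<and> (\<forall>l\<in>{1..k}. (\<Sum>i=1..h. \<beta> (l, i)) = S) \<and> \<beta> (1, 1) = 0"
proof -
  \<comment> \<open>Numbers the slots row by row from 0 to kh - 1.\<close>
  define u :: "nat \<Rightarrow> nat \<Rightarrow> int" where "u l i = (int l - 1) * int h + (int i - 1)" for l i
  define e where "e l = (\<Sum>i\<in>{1..h} - {2}. u l i)" for l
  \<comment> \<open>Large enough that every balancing entry S - e l is at least kh, above all
    entries u of the other columns.\<close>
  define S where "S = int (k * h) + int (k * h) * int h"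
  define \<beta> where "\<beta> p = (if snd p = 2 then S - e (fst p) else u (fst p) (snd p))" for p
  have u: "0 \<le> u l i" "u l i < int (k * h)" if "l \<in> {1..k}" "i \<in> {1..h}" for l i
  proof -
    show "0 \<le> u l i" using that by (simp add: u_def)
    have "u l i \<le> (int k - 1) * int h + (int h - 1)"
      unfolding u_def using that by (intro add_mono mult_right_mono) auto
    then show "u l i < int (k * h)" by (simp add: algebra_simps)
  qed
  have u_inj: "l = l' \<and> i = i'" if "u l i = u l' i'" "i \<in> {1..h}" "i' \<in> {1..h}" for l i l' i'
  proof -
    have "u l i div int h = int l - 1" "u l' i' div int h = int l' - 1"
      using that(2,3) h by (simp_all add: u_def)
    then have "l = l'" using that(1) by simp
    then show ?thesis using that(1) by (simp add: u_def)
  qed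
  have card1: "card ({1..h} - {2::nat}) = h - 1" using h by (simp add: card_Diff_singleton)
  have e: "0 \<le> e l" "e l \<le> int (k * h) * (int h - 1)" if l: "l \<in> {1..k}" for l
  proof -
    show "0 \<le> e l" unfolding e_def using u(1)[OF l] by (intro sum_nonneg) auto
    have "e l \<le> of_nat (card ({1..h} - {2::nat})) * int (k * h)"
      unfolding e_def using u(2)[OF l] by (intro sum_bounded_above less_imp_le) auto
    then show "e l \<le> int (k * h) * (int h - 1)" using h unfolding card1 by (simp add: of_nat_diff mult_ac)
  qed
  have e_inj: "l = l'" if "e l = e l'" for l l'
  proof -
    \<comment> \<open>The partial row sum is affine in l with slope (h - 1) h, which is nonzero, so
      the balancing entries are distinct.\<close>
    have "e l = int (h - 1) * ((int l - 1) * int h) + (\<Sum>i\<in>{1..h} - {2}. int i - 1)" for l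
      unfolding e_def u_def sum.distrib using card1 by simp
    then have "int (h - 1) * ((int l - 1) * int h) = int (h - 1) * ((int l' - 1) * int h)"
      using that by simp
    then show ?thesis using h by simp
  qed
  have big: "S - e l \<ge> int (k * h)" if "l \<in> {1..k}" for l
  proof -
    have "int (k * h) * (int h - 1) \<le> int (k * h) * int h" by (intro mult_left_mono) auto
    then show ?thesis using e(2)[OF that] unfolding S_def by linarith
  qed
  have "inj_on \<beta> ({1..k} \<times> {1..h})"
  proof (rule inj_onI)
    fix p p' assume p: "p \<in> {1..k} \<times> {1..h}" and p': "p' \<in> {1..k} \<times> {1..h}" and eq: "\<beta> p = \<beta> p'"
    obtain l i l' i' where pl: "p = (l, i)" "p' = (l', i')" by (metis prod.exhaust)
    have m: "l \<in> {1..k}" "i \<in> {1..h}" "l' \<in> {1..k}" "i' \<in> {1..h}" using p p' by (simp_all add: pl)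
    have b: "\<beta> p = (if i = 2 then S - e l else u l i)" "\<beta> p' = (if i' = 2 then S - e l' else u l' i')"
      by (simp_all add: \<beta>_def pl)
    show "p = p'"
    proof (cases "i = 2"; cases "i' = 2")
      assume "i = 2" "i' = 2"
      then show ?thesis using eq b e_inj[of l l'] by (simp add: pl)
    next
      assume "i = 2" "i' \<noteq> 2"
      then show ?thesis using eq b big[OF m(1)] u(2)[OF m(3,4)] by simp
    next
      assume "i \<noteq> 2" "i' = 2"
      then show ?thesis using eq b big[OF m(3)] u(2)[OF m(1,2)] by simp
    next
      assume "i \<noteq> 2" "i' \<noteq> 2"
      then show ?thesis using eq b u_inj[OF _ m(2,4), of l l'] by (simp add: pl)
    qed
  qed
  moreover have "0 \<le> \<beta> p \<and> \<beta> p \<le> S" if p: "p \<in> {1..k} \<times> {1..h}" for p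
  proof -
    obtain l i where pl: "p = (l, i)" by force
    have m: "l \<in> {1..k}" "i \<in> {1..h}" using p by (simp_all add: pl)
    have "int (k * h) \<ge> 0" "S \<ge> int (k * h)" by (simp_all add: S_def)
    then show ?thesis using u[OF m] big[OF m(1)] e(1)[OF m(1)] by (auto simp: \<beta>_def pl)
  qed
  moreover have "(\<Sum>i=1..h. \<beta> (l, i)) = S" for l
  proof -
    have "(\<Sum>i=1..h. \<beta> (l, i)) = \<beta> (l, 2) + (\<Sum>i\<in>{1..h} - {2}. \<beta> (l, i))"
      using h by (intro sum.remove) auto
    also have "(\<Sum>i\<in>{1..h} - {2}. \<beta> (l, i)) = e l" unfolding e_def by (intro sum.cong) (auto simp: \<beta>_def)
    finally show ?thesis by (simp add: \<beta>_def)
  qed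
  moreover have "\<beta> (1, 1) = 0" by (simp add: \<beta>_def u_def)
  ultimately show ?thesis by blast
qed

text \<open>A sunflower of solutions with kernel y. Injectivity in the pair (t, p) makes petals of
  different t disjoint and also gives each petal kh - 1 distinct points.\<close>

definition solution_star ::
  "nat \<Rightarrow> nat \<Rightarrow> nat \<Rightarrow> int ^ 'd \<Rightarrow> (int ^ 'd) set \<Rightarrow> (int ^ 'd \<Rightarrow> nat \<times> nat \<Rightarrow> int ^ 'd) \<Rightarrow> bool" where
  "solution_star k h n y T X \<longleftrightarrow>
    (\<forall>t\<in>T. X t (1, 1) = y \<and> (\<forall>p\<in>{1..k} \<times> {1..h}. X t p \<in> grid n) \<and>
      (\<forall>l\<in>{1..k}. \<forall>m\<in>{1..k}. (\<Sum>i=1..h. X t (l, i)) = (\<Sum>i=1..h. X t (m, i)))) \<and>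
    (\<forall>t\<in>T. \<forall>t'\<in>T. \<forall>p\<in>{1..k} \<times> {1..h} - {(1, 1)}. \<forall>p'\<in>{1..k} \<times> {1..h} - {(1, 1)}.
      X t p = X t' p' \<longrightarrow> t = t' \<and> p = p')"

text \<open>Through \<open>y\<close> pass the solutions with entries \<open>y \<plusminus> (\<alpha> M \<tau> + \<beta>)\<close>, where \<open>\<beta>\<close> is the balanced array and the
  row sums of \<open>\<alpha> \<in> {0,1,2}\<close> agree; signs are chosen to point away from the nearest face, and
  \<open>\<beta>\<close> modulo \<open>M\<close> identifies the slot.\<close>

lemma disjoint_solutions_through_point:
  fixes k h :: nat
  assumes h: "h \<ge> 2"
  shows "\<exists>(c::real) n0. c > 0 \<and> (\<forall>n\<ge>n0. \<forall>y\<in>(grid n :: (int ^ 'd::finite) set).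
    \<exists>(T :: (int ^ 'd) set) X. finite T \<and> real (card T) \<ge> c * real (n ^ CARD('d)) \<and>
      solution_star k h n y T X)"
proof -
  obtain \<beta> :: "nat \<times> nat \<Rightarrow> int" and S where \<beta>: "inj_on \<beta> ({1..k} \<times> {1..h})"
    "\<And>p. p \<in> {1..k} \<times> {1..h} \<Longrightarrow> 0 \<le> \<beta> p \<and> \<beta> p \<le> S"
    "\<And>l. l \<in> {1..k} \<Longrightarrow> (\<Sum>i=1..h. \<beta> (l, i)) = S" "\<beta> (1, 1) = 0"
    using balanced_array_exists[OF h, of k] by blast
  \<comment> \<open>M exceeds every entry of \<beta>, so that the entries are residues modulo M. The
    maximum covers k = 0, where nothing bounds S from below.\<close>
  define M where "M = nat (max S 0) + 1"
  have \<beta>M: "0 \<le> \<beta> p" "\<beta> p < int M" if "p \<in> {1..k} \<times> {1..h}" for p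
    using \<beta>(2)[OF that] by (simp_all add: M_def)
  have M: "M \<ge> 1" by (simp add: M_def)
  \<comment> \<open>Row 1 is 0, 2, 1, ..., 1 and every other row is constantly 1, so all rows sum to
    h. Only slot (1,1) has coefficient 0: there t disappears, and from every other slot t can be
    recovered.\<close>
  define \<alpha> :: "nat \<times> nat \<Rightarrow> int" where "\<alpha> p = (if p = (1, 1) then 0 else if p = (1, 2) then 2 else 1)" for p
  have \<alpha>: "0 \<le> \<alpha> p" "\<alpha> p \<le> 2" for p by (simp_all add: \<alpha>_def)
  have \<alpha>sum: "(\<Sum>i=1..h. \<alpha> (l, i)) = int h" for l
  proof (cases "l = 1")
    case True
    have "{1..h} = insert 1 (insert 2 {3..h})" using h by auto
    then have "(\<Sum>i=1..h. \<alpha> (1, i)) = 2 + (\<Sum>i=3..h. \<alpha> (1, i))" by (simp add: \<alpha>_def)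
    also have "(\<Sum>i=3..h. \<alpha> (1, i)) = (\<Sum>i=3..h. 1)" by (intro sum.cong) (auto simp: \<alpha>_def)
    finally show ?thesis using True h by simp
  next
    case False
    then show ?thesis by (simp add: \<alpha>_def)
  qed
  define c where "c = (1 / (16 * real M)) ^ CARD('d)"
  have c: "c > 0" using M by (simp add: c_def)
  have main: "\<exists>(T :: (int ^ 'd) set) X. finite T \<and> real (card T) \<ge> c * real (n ^ CARD('d)) \<and>
      solution_star k h n y T X"
    if n: "n \<ge> 16 * M + 2" and y: "y \<in> (grid n :: (int ^ 'd) set)" for n y
  proof -
    \<comment> \<open>The displacement is at most 2 M m + M and must not exceed (n - 1) / 2; for
      \<open>n \<ge> 16 * M + 2\<close> this choice ensures it and still has m at least n / (16 M),
      whence the constant c.\<close>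
    define m where "m = (n - 1) div (8 * M)"
    \<comment> \<open>In the chosen direction there is room for at least (n - 1) / 2 steps inside
      the grid.\<close>
    define \<sigma> :: "'d \<Rightarrow> int" where "\<sigma> j = (if 2 * y $ j \<le> int n then 1 else -1)" for j
    define w where "w t p j = \<alpha> p * int M * (t $ j) + \<beta> p" for t :: "int ^ 'd" and p j
    define X where "X t p = (\<chi> j. y $ j + \<sigma> j * w t p j)" for t p
    have m8: "8 * M * m \<le> n - 1" unfolding m_def by simp
    have "n - 1 < 8 * M + m * (8 * M)"
      unfolding m_def using M by (intro dividend_less_div_times) simp
    then have "real (n - 1) < real (8 * M + m * (8 * M))" by (simp only: of_nat_less_iff)
    then have "real n - 1 < 8 * real M + real m * (8 * real M)" using n by (simp add: of_nat_diff)
    then have "real n \<le> 16 * real M * real m" using n by (simp add: algebra_simps)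
    then have mn: "real n / (16 * real M) \<le> real m" using M by (simp add: divide_le_eq mult_ac)
    have card: "real (card (grid m :: (int ^ 'd) set)) \<ge> c * real (n ^ CARD('d))"
    proof -
      have "c * real (n ^ CARD('d)) = (real n / (16 * real M)) ^ CARD('d)"
        by (simp add: c_def power_mult_distrib power_divide)
      also have "\<dots> \<le> real m ^ CARD('d)" using mn by (intro power_mono) auto
      finally show ?thesis by (simp add: card_grid)
    qed
    have w: "0 \<le> w t p j" "2 * w t p j \<le> int n - 1" if t: "t \<in> grid m" and p: "p \<in> {1..k} \<times> {1..h}" for t p j
    proof -
      have tj: "1 \<le> t $ j" "t $ j \<le> int m" using t by (simp_all add: grid_def)
      show "0 \<le> w t p j" unfolding w_def using \<alpha>(1) \<beta>M(1)[OF p] tj by simp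
      have "\<alpha> p * int M * (t $ j) \<le> 2 * int M * int m"
        using \<alpha>[of p] tj by (intro mult_mono) auto
      then have "2 * w t p j \<le> 4 * int M * int m + 2 * int M"
        unfolding w_def using \<beta>M(2)[OF p] by simp
      moreover have "int (8 * M * m) \<le> int (n - 1)" using m8 by (simp only: of_nat_le_iff)
      then have "8 * int M * int m \<le> int n - 1" using n by (simp add: of_nat_diff)
      moreover have "16 * int M + 2 \<le> int n" using n by simp
      ultimately show "2 * w t p j \<le> int n - 1" by simp
    qed
    have Xgrid: "X t p \<in> grid n" if "t \<in> grid m" "p \<in> {1..k} \<times> {1..h}" for t p
    proof -
      have "1 \<le> y $ j + \<sigma> j * w t p j \<and> y $ j + \<sigma> j * w t p j \<le> int n" for j
      proof -
        have "1 \<le> y $ j" "y $ j \<le> int n" using y by (simp_all add: grid_def)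
        then show ?thesis using w[OF that, of j] by (auto simp: \<sigma>_def)
      qed
      then show ?thesis by (simp add: grid_def X_def)
    qed
    have Xsum: "(\<Sum>i=1..h. X t (l, i)) = (\<chi> j. int h * y $ j + \<sigma> j * (int M * (t $ j) * int h + S))"
      if l: "l \<in> {1..k}" for t l
    proof (intro vec_eq_iff[THEN iffD2] allI)
      fix j
      have "(\<Sum>i=1..h. X t (l, i)) $ j = (\<Sum>i=1..h. y $ j + \<sigma> j * w t (l, i) j)"
        by (simp add: X_def sum_component)
      also have "\<dots> = int h * y $ j + \<sigma> j * (\<Sum>i=1..h. w t (l, i) j)"
        by (simp add: sum.distrib sum_distrib_left)
      also have "(\<Sum>i=1..h. w t (l, i) j) = (\<Sum>i=1..h. \<alpha> (l, i)) * (int M * (t $ j)) + (\<Sum>i=1..h. \<beta> (l, i))"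
        unfolding w_def sum.distrib by (simp add: sum_distrib_right mult.assoc)
      also have "\<dots> = int M * (t $ j) * int h + S" unfolding \<alpha>sum \<beta>(3)[OF l] by (simp add: mult_ac)
      finally show "(\<Sum>i=1..h. X t (l, i)) $ j = (\<chi> j. int h * y $ j + \<sigma> j * (int M * (t $ j) * int h + S)) $ j" by simp
    qed
    have Xy: "X t (1, 1) = y" for t using \<beta>(4) by (simp add: X_def w_def \<alpha>_def vec_eq_iff)
    have inj: "t = t' \<and> p = p'"
      if p: "p \<in> {1..k} \<times> {1..h}" "p \<noteq> (1, 1)" and p': "p' \<in> {1..k} \<times> {1..h}" and eq: "X t p = X t' p'" for t t' p p'
    proof -
      have weq: "w t p j = w t' p' j" for j
      proof -
        have "X t p $ j = X t' p' $ j" using eq by simp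
        then show ?thesis by (simp add: X_def \<sigma>_def split: if_splits)
      qed
      have wm: "w t p j mod int M = \<beta> p" if "p \<in> {1..k} \<times> {1..h}" for t p j
      proof -
        have "w t p j = \<beta> p + int M * (\<alpha> p * t $ j)" by (simp add: w_def mult_ac)
        then show ?thesis using \<beta>M[OF that] by simp
      qed
      have "\<beta> p = \<beta> p'" using wm[OF p(1)] wm[OF p'] weq by metis
      then have pp: "p = p'" using \<beta>(1) p(1) p' by (simp only: inj_on_eq_iff)
      have "t $ j = t' $ j" for j
      proof -
        have "\<alpha> p * int M * (t $ j) = \<alpha> p * int M * (t' $ j)" using weq[of j] pp by (simp add: w_def)
        moreover have "\<alpha> p \<noteq> 0" using p(2) by (simp add: \<alpha>_def)
        ultimately show ?thesis using M by simp
      qed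
      then show ?thesis using pp by (simp add: vec_eq_iff)
    qed
    show ?thesis unfolding solution_star_def
    proof (intro exI[of _ "grid m"] exI[of _ X] conjI ballI impI)
      fix t t' p p' assume *: "p \<in> {1..k} \<times> {1..h} - {(1, 1)}" "p' \<in> {1..k} \<times> {1..h} - {(1, 1)}" "X t p = X t' p'"
      then show "t = t'" "p = p'" using inj[of p p' t t'] by blast+
    qed (use card Xy Xgrid Xsum in \<open>simp_all\<close>)
  qed
  show ?thesis using c main by (intro exI[of _ c] exI[of _ "16 * M + 2"] conjI allI impI ballI)
qed

section \<open>Colorings with few outliers from a palette\<close>

definition near_colorings :: "nat \<Rightarrow> nat \<Rightarrow> nat \<Rightarrow> real \<Rightarrow> (int ^ 'd) set \<Rightarrow> (int ^ 'd \<Rightarrow> nat) set" where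
  "near_colorings k h r t A = {c \<in> rainbow_free_colorings k h r A.
     \<exists>L\<subseteq>{1..r}. card L = k * h - 1 \<and> real (card {x\<in>A. c x \<notin> L}) \<le> t}"

lemma finite_rainbow_free_colorings:
  assumes "finite A" shows "finite (rainbow_free_colorings k h r A)"
  unfolding rainbow_free_colorings_def
  by (rule finite_subset[OF _ finite_PiE[OF assms, of "\<lambda>_. {1..r}"]]) auto

lemma rainbow_free_eq_far_near:
  "rainbow_free_colorings k h r A = far_colorings k h r t A \<union> near_colorings k h r t A"
  unfolding far_colorings_def near_colorings_def by (auto simp: not_le)

text \<open>There are at most 2^r palettes, and off a small freely colored set only kh - 1 colors
  remain. No density of A is required, so the bound can serve sparse sets.\<close>

lemma card_near_colorings_le:
  assumes A: "finite A" and q: "k * h - 1 \<ge> 1"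
  shows "real (card (near_colorings k h r t A))
    \<le> 2 ^ r * ((\<Sum>E | E \<subseteq> A \<and> real (card E) \<le> t. real r ^ card E) * real (k * h - 1) ^ card A)"
proof -
  define q where "q = k * h - 1"
  define \<L> where "\<L> = {L. L \<subseteq> {1..r} \<and> card L = q}"
  define C where "C L = {c \<in> A \<rightarrow>\<^sub>E {1..r}. \<exists>E\<subseteq>A. real (card E) \<le> t \<and> (\<forall>x\<in>A - E. c x \<in> L)}" for L
  have fin: "finite \<L>" by (simp add: \<L>_def)
  have "near_colorings k h r t A \<subseteq> (\<Union>L\<in>\<L>. C L)"
  proof
    fix c assume "c \<in> near_colorings k h r t A"
    then obtain L where rf: "c \<in> rainbow_free_colorings k h r A" and L: "L \<in> \<L>" and le: "real (card {x\<in>A. c x \<notin> L}) \<le> t"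
      unfolding near_colorings_def \<L>_def q_def by blast
    have "c \<in> C L" unfolding C_def
    proof (intro CollectI conjI exI[of _ "{x\<in>A. c x \<notin> L}"])
      show "c \<in> A \<rightarrow>\<^sub>E {1..r}" using rf by (simp add: rainbow_free_colorings_def)
    qed (use le in blast)+
    then show "c \<in> (\<Union>L\<in>\<L>. C L)" using L by blast
  qed
  moreover have "finite (C L)" for L
    unfolding C_def by (rule finite_subset[OF _ finite_PiE[OF A, of "\<lambda>_. {1..r}"]]) auto
  ultimately have "card (near_colorings k h r t A) \<le> card (\<Union>L\<in>\<L>. C L)" using fin by (intro card_mono) auto
  also have "\<dots> \<le> (\<Sum>L\<in>\<L>. card (C L))" using fin by (rule card_UN_le)
  finally have "real (card (near_colorings k h r t A)) \<le> (\<Sum>L\<in>\<L>. real (card (C L)))" by (simp flip: of_nat_sum)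
  also have "\<dots> \<le> real (card \<L>) * ((\<Sum>E | E \<subseteq> A \<and> real (card E) \<le> t. real r ^ card E) * real q ^ card A)"
  proof (rule sum_bounded_above)
    fix L assume L: "L \<in> \<L>"
    then have finL: "finite L" using finite_subset by (auto simp: \<L>_def)
    have "max 1 (card L) = q" using L q by (simp add: \<L>_def q_def)
    then show "real (card (C L)) \<le> (\<Sum>E | E \<subseteq> A \<and> real (card E) \<le> t. real r ^ card E) * real q ^ card A"
      using card_almost_in_lists[OF A, of "\<lambda>_. L" r t] finL unfolding C_def by simp
  qed
  also have "\<dots> \<le> 2 ^ r * ((\<Sum>E | E \<subseteq> A \<and> real (card E) \<le> t. real r ^ card E) * real q ^ card A)"
  proof (rule mult_right_mono)
    have "card \<L> \<le> card (Pow {1..r})" by (intro card_mono) (auto simp: \<L>_def)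
    then show "real (card \<L>) \<le> 2 ^ r" by (simp add: card_Pow flip: of_nat_power)
  qed (intro mult_nonneg_nonneg sum_nonneg; simp)
  finally show ?thesis unfolding q_def .
qed

text \<open>Each solution through \<open>y\<close> forbids one pattern on its other \<open>k * h - 1\<close> points once \<open>y\<close> has a color
  outside \<open>L\<close>, and these point sets are disjoint.\<close>

lemma card_colorings_with_outlier_le:
  fixes A E T :: "(int ^ 'd::finite) set"
  assumes k: "k \<ge> 2" and h: "h \<ge> 2" and A: "A \<subseteq> grid n" and L: "L \<subseteq> {1..r}" "card L = k * h - 1"
    and E: "E \<subseteq> A" "y \<in> E" and T: "finite T"
    and star: "solution_star k h n y T X"
    and u: "real (card (grid n - A)) + real (card E) + u \<le> real (card T)"
  shows "real (card {c \<in> rainbow_free_colorings k h r A. {x\<in>A. c x \<notin> L} = E})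
    \<le> real r ^ card E * (real (k * h - 1) ^ card A * (1 - 1 / real (k * h - 1) ^ (k * h - 1)) powr u)"
proof -
  define slots where "slots = {1..k} \<times> {1..h} - {(1, 1)}"
  note X = star[unfolded solution_star_def, THEN conjunct1]
    and X_inj = star[unfolded solution_star_def, THEN conjunct2, folded slots_def]
  define q where "q = k * h - 1"
  have "2 * 2 \<le> k * h" using k h by (intro mult_le_mono)
  then have q: "q \<ge> 3" by (simp add: q_def)
  have finA: "finite A" and finE: "finite E" and finL: "finite L"
    using finite_subset[OF A finite_grid] finite_subset[OF E(1)] finite_subset[OF L(1)] by auto
  have fins: "finite slots" by (simp add: slots_def)
  have "(1, 1) \<in> {1..k} \<times> {1..h}" using k h by simp
  then have cs: "card slots = q" unfolding slots_def q_def
    by (subst card_Diff_singleton) (simp_all add: card_cartesian_product)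
  \<comment> \<open>The kh - 1 colors of L are spread over the kh - 1 slots other than (1,1). A
    petal colored this way completes y, whose color is not in L, to a rainbow solution.\<close>
  obtain \<phi> where \<phi>: "bij_betw \<phi> slots L"
    using finite_same_card_bij[OF fins finL] cs L(2) q_def by auto
  \<comment> \<open>Only petals within A - E help, since there the coloring takes values in
    L.\<close>
  define T' where "T' = {t\<in>T. \<forall>p\<in>slots. X t p \<in> A - E}"
  define B where "B t = X t ` slots" for t
  have injX: "inj_on (X t) slots" if "t \<in> T" for t using X_inj that by (intro inj_onI) blast
  define pat where "pat t = restrict (\<phi> \<circ> the_inv_into slots (X t)) (B t)" for t
  have pat: "pat t (X t p) = \<phi> p" if "t \<in> T" "p \<in> slots" for t p
    using that injX by (simp add: pat_def B_def the_inv_into_f_f)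
  have finT': "finite T'" using T by (simp add: T'_def)
  define D where "D = {c \<in> (A - E) \<rightarrow>\<^sub>E L. \<forall>t\<in>T'. restrict c (B t) \<noteq> pat t}"
  have D: "real (card D) \<le> real (card L) ^ card (A - E) * (1 - 1 / real (card L) ^ q) ^ card T'"
    unfolding D_def
  proof (rule card_avoiding_blocks[OF finT' _ finL])
    fix t assume t: "t \<in> T'"
    then have tT: "t \<in> T" by (simp add: T'_def)
    show "B t \<subseteq> A - E" using t by (auto simp: B_def T'_def)
    show "card (B t) = q" unfolding B_def card_image[OF injX[OF tT]] by (rule cs)
    show "pat t \<in> B t \<rightarrow>\<^sub>E L"
    proof (rule PiE_I)
      fix x assume "x \<in> B t"
      then obtain p where "p \<in> slots" "x = X t p" by (auto simp: B_def)
      then show "pat t x \<in> L" using pat[OF tT] \<phi> by (auto simp: bij_betw_def)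
    qed (simp add: pat_def)
  next
    fix t t' assume "t \<in> T'" "t' \<in> T'" "t \<noteq> t'"
    then have "t \<in> T" "t' \<in> T" "t \<noteq> t'" by (simp_all add: T'_def)
    then show "B t \<inter> B t' = {}" using X_inj unfolding B_def by blast
  qed (use finA q L(2) in \<open>simp_all add: q_def\<close>)
  have T'u: "u \<le> real (card T')"
  proof -
    \<comment> \<open>Each discarded t has a petal point outside A or in E, and disjoint petals have
      different such points. So at most |grid - A| + |E| of them are lost, and at least u
      remain.\<close>
    define bad where "bad t = (SOME x. x \<in> B t \<and> x \<in> (grid n - A) \<union> E)" for t
    have bad: "bad t \<in> B t \<and> bad t \<in> (grid n - A) \<union> E" if t: "t \<in> T - T'" for t
    proof -
      obtain p where p: "p \<in> slots" "X t p \<notin> A - E" using t unfolding T'_def by blast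
      moreover have "X t p \<in> grid n" using X t p(1) unfolding slots_def by blast
      ultimately have "X t p \<in> B t \<and> X t p \<in> (grid n - A) \<union> E" by (auto simp: B_def)
      then show ?thesis unfolding bad_def by (rule someI)
    qed
    have "inj_on bad (T - T')"
    proof (rule inj_onI)
      fix t t' assume t: "t \<in> T - T'" "t' \<in> T - T'" and eq: "bad t = bad t'"
      obtain p p' where "p \<in> slots" "p' \<in> slots" "bad t = X t p" "bad t' = X t' p'"
        using bad[OF t(1)] bad[OF t(2)] by (auto simp: B_def)
      then show "t = t'" using X_inj t eq by (metis DiffD1)
    qed
    then have "card (T - T') \<le> card ((grid n - A) \<union> E)"
      using bad finE by (intro card_inj_on_le) auto
    also have "\<dots> \<le> card (grid n - A) + card E" by (rule card_Un_le)
    finally have "card (T - T') \<le> card (grid n - A) + card E" .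
    moreover have "card T = card T' + card (T - T')"
      using T card_Diff_subset[of T' T] card_mono[of T T'] finT' by (simp add: T'_def)
    ultimately show ?thesis using u by linarith
  qed
  define C where "C = {c \<in> rainbow_free_colorings k h r A. {x\<in>A. c x \<notin> L} = E}"
  have cPi: "c \<in> A \<rightarrow>\<^sub>E {1..r}" if "c \<in> C" for c using that by (simp add: C_def rainbow_free_colorings_def)
  have inj: "inj_on (\<lambda>c. (restrict c E, restrict c (A - E))) C"
  proof (rule inj_onI)
    fix c d assume c: "c \<in> C" and d: "d \<in> C" and eq: "(restrict c E, restrict c (A - E)) = (restrict d E, restrict d (A - E))"
    show "c = d"
    proof (rule PiE_ext[OF cPi[OF c] cPi[OF d]])
      fix x assume "x \<in> A"
      then have "x \<in> E \<or> x \<in> A - E" by blast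
      then show "c x = d x" using eq by (metis prod.inject restrict_apply')
    qed
  qed
  have "(\<lambda>c. (restrict c E, restrict c (A - E))) ` C \<subseteq> (E \<rightarrow>\<^sub>E {1..r}) \<times> D"
  proof (rule image_subsetI)
    fix c assume c: "c \<in> C"
    have "restrict c E \<in> E \<rightarrow>\<^sub>E {1..r}" using cPi[OF c] E(1) by (rule restrict_in_PiE) simp
    moreover have "restrict c (A - E) \<in> (A - E) \<rightarrow>\<^sub>E L"
    proof (rule PiE_I)
      fix x assume "x \<in> A - E"
      then show "restrict c (A - E) x \<in> L" using c by (auto simp: C_def)
    qed auto
    moreover have "restrict (restrict c (A - E)) (B t) \<noteq> pat t" if t: "t \<in> T'" for t
    proof
      assume eq: "restrict (restrict c (A - E)) (B t) = pat t"
      have tT: "t \<in> T" using t by (simp add: T'_def)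
      have cX: "c (X t p) = \<phi> p" if "p \<in> slots" for p
      proof -
        have m: "X t p \<in> B t" "X t p \<in> A - E" using t that by (auto simp: B_def T'_def)
        have "c (X t p) = restrict (restrict c (A - E)) (B t) (X t p)" using m by simp
        also have "\<dots> = pat t (X t p)" unfolding eq ..
        also have "\<dots> = \<phi> p" using tT that by (rule pat)
        finally show ?thesis .
      qed
      have Xy: "X t (1, 1) = y" using X tT by blast
      have cy: "c y \<notin> L" using c E(2) by (auto simp: C_def)
      have split: "p \<in> slots \<or> p = (1, 1)" if "p \<in> {1..k} \<times> {1..h}" for p
        using that unfolding slots_def by blast
      have cL: "c (X t p) \<in> L" if "p \<in> slots" for p
        using cX[OF that] \<phi> that by (auto simp: bij_betw_def)
      have "B_solution k h A (\<lambda>l i. X t (l, i))"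
        unfolding B_solution_def
      proof (intro conjI ballI)
        fix l i assume "l \<in> {1..k}" "i \<in> {1..h}"
        then have "(l, i) \<in> slots \<or> (l, i) = (1, 1)" using split by blast
        then show "X t (l, i) \<in> A" using t Xy E unfolding T'_def by auto
      next
        fix l m assume "l \<in> {1..k}" "m \<in> {1..k}"
        then show "(\<Sum>i=1..h. X t (l, i)) = (\<Sum>i=1..h. X t (m, i))" using X tT by blast
      qed
      moreover have "rainbow k h c (\<lambda>l i. X t (l, i))"
        unfolding rainbow_def
      proof (rule inj_onI)
        fix p p' assume p: "p \<in> {1..k} \<times> {1..h}" and p': "p' \<in> {1..k} \<times> {1..h}"
          and "(case p of (l, i) \<Rightarrow> c (X t (l, i))) = (case p' of (l, i) \<Rightarrow> c (X t (l, i)))"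
        then have eq: "c (X t p) = c (X t p')" by (simp add: case_prod_unfold)
        consider "p \<in> slots" "p' \<in> slots" | "p = (1, 1)" "p' = (1, 1)" | "p \<in> slots" "p' = (1, 1)" | "p = (1, 1)" "p' \<in> slots"
          using split[OF p] split[OF p'] by blast
        then show "p = p'"
        proof cases
          case 1
          then have "\<phi> p = \<phi> p'" using eq cX by simp
          then show ?thesis using bij_betw_imp_inj_on[OF \<phi>] 1 by (simp only: inj_on_eq_iff)
        next
          case 2
          then show ?thesis by simp
        next
          case 3
          then have "c y \<in> L" using cL[OF 3(1)] eq Xy by metis
          then show ?thesis using cy by simp
        next
          case 4
          then have "c y \<in> L" using cL[OF 4(2)] eq Xy by metis
          then show ?thesis using cy by simp
        qed
      qed
      ultimately show False using c unfolding C_def rainbow_free_colorings_def by blast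
    qed
    ultimately show "(restrict c E, restrict c (A - E)) \<in> (E \<rightarrow>\<^sub>E {1..r}) \<times> D" by (simp add: D_def)
  qed
  moreover have "finite D" unfolding D_def
    by (rule finite_subset[OF _ finite_PiE[of "A - E" "\<lambda>_. L"]]) (use finA finL in auto)
  ultimately have "card C \<le> card ((E \<rightarrow>\<^sub>E {1..r}) \<times> D)"
    using finE by (intro card_inj_on_le[OF inj] finite_cartesian_product finite_PiE) auto
  also have "\<dots> = r ^ card E * card D" using finE by (simp add: card_cartesian_product card_funcsetE)
  finally have "real (card C) \<le> real (r ^ card E * card D)" by (simp only: of_nat_le_iff)
  also have "\<dots> = real r ^ card E * real (card D)" by simp
  also have "\<dots> \<le> real r ^ card E * (real q ^ card A * (1 - 1 / real q ^ q) powr u)"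
  proof (intro mult_left_mono)
    define \<rho> where "\<rho> = 1 - 1 / real q ^ q"
    have "real q ^ q > 1" using q by (intro one_less_power) auto
    then have \<rho>: "0 < \<rho>" "\<rho> < 1" using q by (simp_all add: \<rho>_def)
    have "real (card D) \<le> real q ^ card (A - E) * \<rho> ^ card T'" using D L(2) by (simp add: \<rho>_def q_def)
    also have "\<dots> \<le> real q ^ card A * \<rho> powr u"
    proof (intro mult_mono)
      show "real q ^ card (A - E) \<le> real q ^ card A"
        using q finA by (intro power_increasing card_mono) auto
      have "\<rho> ^ card T' = \<rho> powr real (card T')" using \<rho> by (simp add: powr_realpow)
      also have "\<dots> \<le> \<rho> powr u" using T'u \<rho> by (intro powr_mono') auto
      finally show "\<rho> ^ card T' \<le> \<rho> powr u" .
    qed (use \<rho> in auto)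
    finally show "real (card D) \<le> real q ^ card A * (1 - 1 / real q ^ q) powr u" by (simp add: \<rho>_def)
  qed simp
  finally show ?thesis unfolding C_def q_def .
qed

lemma power_le_eventually:
  fixes x \<epsilon> :: real
  assumes "0 \<le> x" "x < 1" "\<epsilon> > 0"
  shows "\<exists>m. \<forall>j\<ge>m. x ^ j \<le> \<epsilon>"
proof -
  obtain m where m: "x ^ m < \<epsilon>" using real_arch_pow_inv[OF assms(3,2)] by blast
  have "x ^ j \<le> \<epsilon>" if "j \<ge> m" for j
    using power_decreasing[OF that assms(1)] assms(2) m by linarith
  then show ?thesis by blast
qed

text \<open>With more than kh - 1 colors the outlier set E of any palette is nonempty and contains a
  kernel y. Choosing and coloring E costs b^N, while the petals at y save a fixed power of \<rho>^N.
  This needs A dense enough that a positive fraction of the petals survives.\<close>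

lemma near_multicolored_few:
  assumes k: "k \<ge> 2" and h: "h \<ge> 2" and r: "r \<ge> k * h"
  shows "\<exists>\<delta> \<beta> \<kappa> n0. \<delta> > 0 \<and> \<beta> > 0 \<and> 0 < \<kappa> \<and> \<kappa> < 1 \<and> (\<forall>n\<ge>n0. \<forall>A\<subseteq>(grid n :: (int ^ 'd::finite) set).
    (1 - \<delta>) * real (n ^ CARD('d)) \<le> real (card A) \<longrightarrow>
    real (card {c \<in> near_colorings k h r (\<beta> * real (n ^ CARD('d))) A. \<not> card (c ` A) \<le> k * h - 1})
      \<le> real (k * h - 1) ^ card A * \<kappa> ^ (n ^ CARD('d)))"
proof -
  define q where "q = k * h - 1"
  have "2 * 2 \<le> k * h" using k h by (intro mult_le_mono)
  then have q: "q \<ge> 3" and r4: "r \<ge> 4" using r by (simp_all add: q_def)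
  obtain c1 :: real and n1 where c1: "c1 > 0" and thr: "\<forall>n\<ge>n1. \<forall>y\<in>(grid n :: (int ^ 'd) set).
    \<exists>(T :: (int ^ 'd) set) X. finite T \<and> real (card T) \<ge> c1 * real (n ^ CARD('d)) \<and>
      solution_star k h n y T X"
    using disjoint_solutions_through_point[OF h, of k, where 'd = 'd] by (elim exE conjE)
  define \<rho> where "\<rho> = 1 - 1 / real q ^ q"
  have "real q ^ q > 1" using q by (intro one_less_power) auto
  then have \<rho>: "0 < \<rho>" "\<rho> < 1" using q by (simp_all add: \<rho>_def)
  \<comment> \<open>The saving is \<open>\<rho> powr (c1 / 2)\<close> = \<kappa>^4 per point. Paying
    b = \<kappa>^(-2) for E leaves \<kappa>^2, and one of the two factors \<kappa>^N absorbs the 2^r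
    palettes.\<close>
  define \<kappa> where "\<kappa> = \<rho> powr (c1 / 8)"
  have \<kappa>: "0 < \<kappa>" "\<kappa> < 1" using \<rho> c1 powr_less_mono'[of \<rho> 0 "c1 / 8"] by (auto simp: \<kappa>_def)
  define b where "b = 1 / \<kappa>\<^sup>2"
  have b: "b > 1" using \<kappa> by (simp add: b_def power_less_one_iff)
  have b\<rho>: "b * \<rho> powr (c1 / 2) = \<kappa> * \<kappa>"
  proof -
    have "\<rho> powr (c1 / 2) = \<kappa> ^ 4" using \<rho> by (simp add: \<kappa>_def powr_power)
    then show ?thesis using \<kappa> by (simp add: b_def power2_eq_square power4_eq_xxxx)
  qed
  obtain \<alpha> where \<alpha>: "\<alpha> > 0" and small: "\<And>(S :: (int ^ 'd) set) M. finite S \<Longrightarrow> real (card S) \<le> M \<Longrightarrow>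
    (\<Sum>E | E \<subseteq> S \<and> real (card E) \<le> \<alpha> * M. real r ^ card E) \<le> b powr M"
    using weighted_count_small_subsets[OF b, of "real r", where 'a = "int ^ 'd"] r4 by auto
  \<comment> \<open>At most c1/4 N petals are lost to points outside A and c1/4 N to outliers, so
    c1/2 N of the c1 N petals remain.\<close>
  define \<beta> where "\<beta> = min \<alpha> (c1 / 4)"
  have \<beta>: "\<beta> > 0" "\<beta> \<le> \<alpha>" "\<beta> \<le> c1 / 4" using \<alpha> c1 by (simp_all add: \<beta>_def)
  obtain m where m: "\<And>j. j \<ge> m \<Longrightarrow> \<kappa> ^ j \<le> 1 / 2 ^ r"
    using power_le_eventually[of \<kappa> "1 / 2 ^ r"] \<kappa> by auto
  have "real (card {c \<in> near_colorings k h r (\<beta> * real (n ^ CARD('d))) A. \<not> card (c ` A) \<le> k * h - 1})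
      \<le> real (k * h - 1) ^ card A * \<kappa> ^ (n ^ CARD('d))"
    if n: "n \<ge> max n1 m" and A: "A \<subseteq> (grid n :: (int ^ 'd) set)"
      and dense: "(1 - c1 / 4) * real (n ^ CARD('d)) \<le> real (card A)" for n A
  proof -
    define N where "N = n ^ CARD('d)"
  let ?M = "{c \<in> near_colorings k h r (\<beta> * real N) A. \<not> card (c ` A) \<le> k * h - 1}"
    have Nm: "N \<ge> m" using n grid_power_ge[of n, where 'd = 'd] by (simp add: N_def)
    have finA: "finite A" using A finite_subset finite_grid by blast
    have cAN: "card A \<le> N"
      using card_mono[OF finite_grid A] by (simp add: N_def card_grid)
    define \<L> where "\<L> = {L. L \<subseteq> {1..r} \<and> card L = q}"
    define \<E> where "\<E> = {E. E \<subseteq> A \<and> real (card E) \<le> \<beta> * real N}"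
    define C where "C = (\<lambda>(L, E). {c \<in> rainbow_free_colorings k h r A. E \<noteq> {} \<and> {x\<in>A. c x \<notin> L} = E})"
    define Q where "Q = real q ^ card A * \<rho> powr (c1 / 2 * real N)"
    have Q0: "Q \<ge> 0" by (simp add: Q_def)
    have fin: "finite \<L>" "finite \<E>" using finA by (simp_all add: \<L>_def \<E>_def)
    have cover: "?M \<subseteq> (\<Union>LE\<in>\<L> \<times> \<E>. C LE)"
    proof
      fix c assume "c \<in> ?M"
      then obtain L where L: "L \<in> \<L>" and c: "c \<in> rainbow_free_colorings k h r A"
        and le: "real (card {x\<in>A. c x \<notin> L}) \<le> \<beta> * real N" and many: "\<not> card (c ` A) \<le> q"
        unfolding near_colorings_def \<L>_def q_def by blast
      have "finite L" using L finite_subset by (auto simp: \<L>_def)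
      then have "\<not> c ` A \<subseteq> L" using many L card_mono[of L "c ` A"] by (auto simp: \<L>_def)
      then have "(L, {x\<in>A. c x \<notin> L}) \<in> \<L> \<times> \<E>" "c \<in> C (L, {x\<in>A. c x \<notin> L})"
        using L c le by (auto simp: \<E>_def C_def)
      then show "c \<in> (\<Union>LE\<in>\<L> \<times> \<E>. C LE)" by blast
    qed
    have CLE: "real (card (C (L, E))) \<le> real r ^ card E * Q" if L: "L \<in> \<L>" and E: "E \<in> \<E>" for L E
    proof (cases "E = {}")
      case True
      then show ?thesis using Q0 by (simp add: C_def)
    next
      case False
      then obtain y where y: "y \<in> E" by blast
      have EA: "E \<subseteq> A" "real (card E) \<le> \<beta> * real N" using E by (simp_all add: \<E>_def)
      have yG: "y \<in> grid n" using y EA A by blast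
      have n1n: "n1 \<le> n" using n by simp
      obtain T :: "(int ^ 'd) set" and X where T: "finite T" "real (card T) \<ge> c1 * real (n ^ CARD('d))"
        and X: "solution_star k h n y T X"
        using thr[THEN spec, THEN mp, OF n1n, THEN bspec, OF yG] by (elim exE conjE)
      have "card (grid n - A) = N - card A"
        using A finA by (simp add: card_Diff_subset N_def card_grid)
      then have "real (card (grid n - A)) = real N - real (card A)" using cAN by (simp add: of_nat_diff)
      moreover have "\<beta> * real N \<le> c1 / 4 * real N" using \<beta>(3) by (intro mult_right_mono) auto
      moreover have "(1 - c1 / 4) * real N = real N - c1 / 4 * real N" by (simp add: algebra_simps)
      ultimately have u: "real (card (grid n - A)) + real (card E) + c1 / 2 * real N \<le> real (card T)"
        using dense T(2) EA(2) unfolding N_def[symmetric] by linarith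
      have "real (card {c \<in> rainbow_free_colorings k h r A. {x\<in>A. c x \<notin> L} = E})
        \<le> real r ^ card E * (real (k * h - 1) ^ card A * (1 - 1 / real (k * h - 1) ^ (k * h - 1)) powr (c1 / 2 * real N))"
        using L by (intro card_colorings_with_outlier_le[OF k h A _ _ EA(1) y T(1) X u]) (auto simp: \<L>_def q_def)
      then show ?thesis using False by (simp add: C_def Q_def \<rho>_def q_def)
    qed
    have finC: "finite (C LE)" for LE
      unfolding C_def using finite_rainbow_free_colorings[OF finA] by (cases LE) simp
    have "card ?M \<le> card (\<Union>LE\<in>\<L> \<times> \<E>. C LE)"
      using cover fin finC by (intro card_mono) auto
    also have "\<dots> \<le> (\<Sum>LE\<in>\<L> \<times> \<E>. card (C LE))" using fin by (intro card_UN_le) auto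
    finally have "real (card ?M) \<le> (\<Sum>LE\<in>\<L> \<times> \<E>. real (card (C LE)))"
      by (simp flip: of_nat_sum)
    also have "\<dots> \<le> (\<Sum>LE\<in>\<L> \<times> \<E>. real r ^ card (snd LE) * Q)"
      using CLE by (intro sum_mono) auto
    also have "\<dots> = (\<Sum>L\<in>\<L>. \<Sum>E\<in>\<E>. real r ^ card E * Q)" by (subst sum.cartesian_product) (simp add: case_prod_unfold)
    also have "\<dots> = real (card \<L>) * ((\<Sum>E\<in>\<E>. real r ^ card E) * Q)" by (simp add: sum_distrib_right)
    also have "\<dots> \<le> 2 ^ r * (b ^ N * Q)"
    proof (intro mult_mono mult_right_mono Q0)
      have "card \<L> \<le> card (Pow {1..r})" by (intro card_mono) (auto simp: \<L>_def)
      then show "real (card \<L>) \<le> 2 ^ r" by (simp add: card_Pow flip: of_nat_power)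
      have "(\<Sum>E\<in>\<E>. real r ^ card E) \<le> (\<Sum>E | E \<subseteq> A \<and> real (card E) \<le> \<alpha> * real N. real r ^ card E)"
      proof (rule sum_mono2)
        have "\<beta> * real N \<le> \<alpha> * real N" using \<beta>(2) by (intro mult_right_mono) auto
        then show "\<E> \<subseteq> {E. E \<subseteq> A \<and> real (card E) \<le> \<alpha> * real N}" by (auto simp: \<E>_def)
      qed (use finA in auto)
      also have "\<dots> \<le> b powr real N" using small[OF finA] cAN by simp
      finally show "(\<Sum>E\<in>\<E>. real r ^ card E) \<le> b ^ N" using b by (simp add: powr_realpow)
    qed (use Q0 b in \<open>auto intro!: mult_nonneg_nonneg sum_nonneg\<close>)
    also have "\<dots> = real q ^ card A * (2 ^ r * (b * \<rho> powr (c1 / 2)) ^ N)"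
    proof -
      have "\<rho> powr (c1 / 2 * real N) = (\<rho> powr (c1 / 2)) ^ N"
        unfolding powr_powr[symmetric] using \<rho> by (intro powr_realpow) simp
      then show ?thesis by (simp add: Q_def power_mult_distrib)
    qed
    also have "\<dots> = real q ^ card A * ((2 ^ r * \<kappa> ^ N) * \<kappa> ^ N)" unfolding b\<rho> by (simp add: power_mult_distrib)
    also have "\<dots> \<le> real q ^ card A * (1 * \<kappa> ^ N)"
    proof (intro mult_left_mono mult_right_mono)
      show "2 ^ r * \<kappa> ^ N \<le> 1" using m[OF Nm] by (simp add: field_simps)
    qed (use \<kappa> in auto)
    finally show ?thesis by (simp add: N_def q_def)
  qed
  then show ?thesis using c1 \<beta>(1) \<kappa>
    by (intro exI[of _ "c1 / 4"] exI[of _ \<beta>] exI[of _ \<kappa>] exI[of _ "max n1 m"]) simp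
qed

lemma multicolored_few:
  assumes k: "k \<ge> 2" and h: "h \<ge> 2" and r: "r \<ge> k * h"
  shows "\<exists>\<delta> \<kappa> n0. \<delta> > 0 \<and> 0 < \<kappa> \<and> \<kappa> < 1 \<and> (\<forall>n\<ge>n0. \<forall>A\<subseteq>(grid n :: (int ^ 'd::finite) set).
    (1 - \<delta>) * real (n ^ CARD('d)) \<le> real (card A) \<longrightarrow>
    real (card {c \<in> rainbow_free_colorings k h r A. \<not> card (c ` A) \<le> k * h - 1})
      \<le> 2 * real (k * h - 1) ^ card A * \<kappa> ^ (n ^ CARD('d)))"
proof -
  obtain \<delta> \<beta> \<kappa>1 n1 where par: "\<delta> > 0" "\<beta> > 0" "0 < \<kappa>1" "\<kappa>1 < 1"
    and near: "\<forall>n\<ge>n1. \<forall>A\<subseteq>(grid n :: (int ^ 'd) set).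
    (1 - \<delta>) * real (n ^ CARD('d)) \<le> real (card A) \<longrightarrow>
    real (card {c \<in> near_colorings k h r (\<beta> * real (n ^ CARD('d))) A. \<not> card (c ` A) \<le> k * h - 1})
      \<le> real (k * h - 1) ^ card A * \<kappa>1 ^ (n ^ CARD('d))"
    using near_multicolored_few[OF k h r, where 'd = 'd] by (elim exE conjE)
  obtain \<kappa>2 n2 where par2: "0 < \<kappa>2" "\<kappa>2 < 1" and far: "\<forall>n\<ge>n2. \<forall>A\<subseteq>(grid n :: (int ^ 'd) set).
    real (card (far_colorings k h r (\<beta> * real (n ^ CARD('d))) A)) \<le> real (k * h - 1) ^ card A * \<kappa>2 ^ (n ^ CARD('d))"
    using far_colorings_few[OF k h r par(2), where 'd = 'd] by (elim exE conjE)
  define \<kappa> where "\<kappa> = max \<kappa>1 \<kappa>2"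
  have "real (card {c \<in> rainbow_free_colorings k h r A. \<not> card (c ` A) \<le> k * h - 1})
      \<le> 2 * real (k * h - 1) ^ card A * \<kappa> ^ (n ^ CARD('d))"
    if n: "n \<ge> max n1 n2" and A: "A \<subseteq> (grid n :: (int ^ 'd) set)"
      and dense: "(1 - \<delta>) * real (n ^ CARD('d)) \<le> real (card A)" for n A
  proof -
    define N where "N = n ^ CARD('d)"
    define t where "t = \<beta> * real (n ^ CARD('d))"
  let ?M = "{c \<in> near_colorings k h r t A. \<not> card (c ` A) \<le> k * h - 1}"
    define Q where "Q = real (k * h - 1) ^ card A"
    have finA: "finite A" using A finite_subset finite_grid by blast
    have fin: "finite (near_colorings k h r t A)" "finite (far_colorings k h r t A)"
      using finite_rainbow_free_colorings[OF finA, of k h r] unfolding rainbow_free_eq_far_near[of k h r A t] by auto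
    have "card {c \<in> rainbow_free_colorings k h r A. \<not> card (c ` A) \<le> k * h - 1}
      \<le> card (far_colorings k h r t A \<union> ?M)"
      using fin by (intro card_mono) (auto simp: rainbow_free_eq_far_near[of k h r A t])
    also have "\<dots> \<le> card (far_colorings k h r t A) + card ?M"
      by (rule card_Un_le)
    finally have "real (card {c \<in> rainbow_free_colorings k h r A. \<not> card (c ` A) \<le> k * h - 1})
      \<le> real (card (far_colorings k h r t A)) + real (card ?M)"
      by (simp flip: of_nat_add)
    also have "\<dots> \<le> Q * \<kappa>2 ^ N + Q * \<kappa>1 ^ N"
      unfolding t_def Q_def N_def using near far n A dense by (intro add_mono) simp_all
    also have "\<dots> \<le> Q * \<kappa> ^ N + Q * \<kappa> ^ N"
      using par par2 by (intro add_mono mult_left_mono power_mono) (auto simp: \<kappa>_def Q_def)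
    finally show ?thesis by (simp add: Q_def N_def mult_ac)
  qed
  then show ?thesis using par par2
    by (intro exI[of _ \<delta>] exI[of _ \<kappa>] exI[of _ "max n1 n2"]) (simp add: \<kappa>_def)
qed

text \<open>Valid for every A, dense or not. The closeness to a palette is measured with the
  \<alpha> that belongs to b, so the near colorings cost only b^N; the far ones are fewer still by
  the template bound.\<close>

lemma rainbow_free_crude_bound:
  fixes b :: real
  assumes k: "k \<ge> 2" and h: "h \<ge> 2" and r: "r \<ge> k * h" and b: "b > 1"
  shows "\<exists>n0. \<forall>n\<ge>n0. \<forall>A\<subseteq>(grid n :: (int ^ 'd::finite) set).
    real (num_rainbow_free k h r A) \<le> (2 ^ r + 1) * (b ^ (n ^ CARD('d)) * real (k * h - 1) ^ card A)"
proof -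
  have "2 * 2 \<le> k * h" using k h by (intro mult_le_mono)
  then have q: "k * h - 1 \<ge> 1" and r4: "r \<ge> 4" using r by simp_all
  obtain \<alpha> where \<alpha>: "\<alpha> > 0" and small: "\<And>(S :: (int ^ 'd) set) M. finite S \<Longrightarrow> real (card S) \<le> M \<Longrightarrow>
    (\<Sum>E | E \<subseteq> S \<and> real (card E) \<le> \<alpha> * M. real r ^ card E) \<le> b powr M"
    using weighted_count_small_subsets[OF b, of "real r", where 'a = "int ^ 'd"] r4 by auto
  obtain \<kappa> n0 where \<kappa>: "0 < \<kappa>" "\<kappa> < 1" and far: "\<forall>n\<ge>n0. \<forall>A\<subseteq>(grid n :: (int ^ 'd) set).
    real (card (far_colorings k h r (\<alpha> * real (n ^ CARD('d))) A)) \<le> real (k * h - 1) ^ card A * \<kappa> ^ (n ^ CARD('d))"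
    using far_colorings_few[OF k h r \<alpha>, where 'd = 'd] by (elim exE conjE)
  have "real (num_rainbow_free k h r A) \<le> (2 ^ r + 1) * (b ^ (n ^ CARD('d)) * real (k * h - 1) ^ card A)"
    if n: "n \<ge> n0" and A: "A \<subseteq> (grid n :: (int ^ 'd) set)" for n A
  proof -
    define N where "N = n ^ CARD('d)"
    define t where "t = \<alpha> * real N"
    define Q where "Q = real (k * h - 1) ^ card A"
    have finA: "finite A" using A finite_subset finite_grid by blast
    have cAN: "real (card A) \<le> real N"
      using card_mono[OF finite_grid A] by (simp add: N_def card_grid flip: of_nat_power)
    have "num_rainbow_free k h r A \<le> card (far_colorings k h r t A) + card (near_colorings k h r t A)"
      unfolding num_rainbow_free_def rainbow_free_eq_far_near[of k h r A t] by (rule card_Un_le)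
    then have "real (num_rainbow_free k h r A) \<le> real (card (far_colorings k h r t A)) + real (card (near_colorings k h r t A))"
      by linarith
    also have "\<dots> \<le> 1 * (b ^ N * Q) + 2 ^ r * (b ^ N * Q)"
    proof (rule add_mono)
      have "real (card (far_colorings k h r t A)) \<le> Q * \<kappa> ^ N" using far n A by (simp add: t_def Q_def N_def)
      also have "\<dots> \<le> Q * b ^ N"
      proof (rule mult_left_mono)
        have "\<kappa> ^ N \<le> 1" "1 \<le> b ^ N" using \<kappa> b by (simp_all add: power_le_one)
        then show "\<kappa> ^ N \<le> b ^ N" by linarith
      qed (simp add: Q_def)
      finally show "real (card (far_colorings k h r t A)) \<le> 1 * (b ^ N * Q)" by (simp add: mult.commute)
      have "(\<Sum>E | E \<subseteq> A \<and> real (card E) \<le> t. real r ^ card E) \<le> b ^ N"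
        using small[OF finA cAN] b by (simp add: t_def powr_realpow)
      then have "2 ^ r * ((\<Sum>E | E \<subseteq> A \<and> real (card E) \<le> t. real r ^ card E) * Q) \<le> 2 ^ r * (b ^ N * Q)"
        by (intro mult_left_mono mult_right_mono) (simp_all add: Q_def)
      then show "real (card (near_colorings k h r t A)) \<le> 2 ^ r * (b ^ N * Q)"
        using card_near_colorings_le[OF finA q, of r t] unfolding Q_def by linarith
    qed
    finally show ?thesis by (simp add: N_def Q_def algebra_simps)
  qed
  then show ?thesis by blast
qed

section \<open>Counting\<close>

lemma few_colors_rainbow_free:
  assumes c: "c \<in> A \<rightarrow>\<^sub>E {1..r}" and few: "card (c ` A) < k * h" and A: "finite A"
  shows "c \<in> rainbow_free_colorings k h r A"
proof -
  have False if x: "B_solution k h A x" "rainbow k h c x" for x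
  proof -
    have "(\<lambda>(l, i). c (x l i)) ` ({1..k} \<times> {1..h}) \<subseteq> c ` A"
      using x(1) by (auto simp: B_solution_def)
    then have "card ({1..k} \<times> {1..h}) \<le> card (c ` A)"
      using x(2) A unfolding rainbow_def by (intro card_inj_on_le) auto
    then show False using few by (simp add: card_cartesian_product)
  qed
  then show ?thesis using c by (auto simp: rainbow_free_colorings_def)
qed

lemma card_few_colors_le:
  assumes A: "finite A" and q: "q \<le> r"
  shows "card {c \<in> A \<rightarrow>\<^sub>E {1..r}. card (c ` A) \<le> q} \<le> (r choose q) * q ^ card A"
proof -
  let ?F = "{c \<in> A \<rightarrow>\<^sub>E {1..r}. card (c ` A) \<le> q}"
  define \<L> where "\<L> = {L. L \<subseteq> {1..r} \<and> card L = q}"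
  have fin: "finite \<L>" by (simp add: \<L>_def)
  have cL: "card \<L> = r choose q" unfolding \<L>_def using n_subsets[of "{1..r}" q] by simp
  have "?F \<subseteq> (\<Union>L\<in>\<L>. A \<rightarrow>\<^sub>E L)"
  proof
    fix c assume "c \<in> ?F"
    then have c: "c \<in> A \<rightarrow>\<^sub>E {1..r}" and le: "card (c ` A) \<le> q" by auto
    have "c ` A \<subseteq> {1..r}" using PiE_mem[OF c] by blast
    then obtain L where L: "c ` A \<subseteq> L" "L \<subseteq> {1..r}" "card L = q"
      using exists_subset_between[of "c ` A" q "{1..r}"] le q by auto
    have "c \<in> A \<rightarrow>\<^sub>E L" using L(1) PiE_arb[OF c] by (intro PiE_I) auto
    then show "c \<in> (\<Union>L\<in>\<L>. A \<rightarrow>\<^sub>E L)" using L by (auto simp: \<L>_def)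
  qed
  moreover have "finite (A \<rightarrow>\<^sub>E L)" if "L \<in> \<L>" for L
    using that A finite_subset by (intro finite_PiE) (auto simp: \<L>_def)
  ultimately have "card ?F \<le> card (\<Union>L\<in>\<L>. A \<rightarrow>\<^sub>E L)"
    using fin by (intro card_mono) auto
  also have "\<dots> \<le> (\<Sum>L\<in>\<L>. card (A \<rightarrow>\<^sub>E L))" using fin by (rule card_UN_le)
  also have "\<dots> = (\<Sum>L\<in>\<L>. q ^ card A)" using A by (intro sum.cong) (auto simp: card_funcsetE \<L>_def)
  finally show ?thesis by (simp add: cL)
qed

text \<open>Colorings onto different q-sets L are distinct, so their counts add up. For one L, a
  union bound over the omitted color gives the subtracted term.\<close>

lemma card_few_colors_ge:
  assumes A: "finite A" and q: "q \<ge> 1"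
  shows "real (r choose q) * (real q ^ card A - real q * (real q - 1) ^ card A)
    \<le> real (card {c \<in> A \<rightarrow>\<^sub>E {1..r}. card (c ` A) \<le> q})"
proof -
  let ?F = "{c \<in> A \<rightarrow>\<^sub>E {1..r}. card (c ` A) \<le> q}"
  define \<L> where "\<L> = {L. L \<subseteq> {1..r} \<and> card L = q}"
  define S where "S L = {c \<in> A \<rightarrow>\<^sub>E L. c ` A = L}" for L :: "nat set"
  have fin: "finite \<L>" by (simp add: \<L>_def)
  have cL: "card \<L> = r choose q" unfolding \<L>_def using n_subsets[of "{1..r}" q] by simp
  have finL: "finite L" if "L \<in> \<L>" for L using that finite_subset by (auto simp: \<L>_def)
  have finS: "finite (S L)" if "L \<in> \<L>" for L
    unfolding S_def by (rule finite_subset[OF _ finite_PiE[OF A, of "\<lambda>_. L"]]) (use finL[OF that] in auto)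
  have SL: "real q ^ card A - real q * (real q - 1) ^ card A \<le> real (card (S L))" if L: "L \<in> \<L>" for L
  proof -
    have "A \<rightarrow>\<^sub>E L \<subseteq> S L \<union> (\<Union>j\<in>L. A \<rightarrow>\<^sub>E (L - {j}))"
    proof
      fix c assume c: "c \<in> A \<rightarrow>\<^sub>E L"
      show "c \<in> S L \<union> (\<Union>j\<in>L. A \<rightarrow>\<^sub>E (L - {j}))"
      proof (cases "c ` A = L")
        case True
        then show ?thesis using c by (simp add: S_def)
      next
        case False
        then obtain j where "j \<in> L" "j \<notin> c ` A" using PiE_mem[OF c] by blast
        moreover have "c \<in> A \<rightarrow>\<^sub>E (L - {j})"
          using PiE_mem[OF c] PiE_arb[OF c] \<open>j \<notin> c ` A\<close> by (intro PiE_I) auto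
        ultimately show ?thesis by blast
      qed
    qed
    then have "card (A \<rightarrow>\<^sub>E L) \<le> card (S L \<union> (\<Union>j\<in>L. A \<rightarrow>\<^sub>E (L - {j})))"
      using finS[OF L] finL[OF L] A by (intro card_mono) (auto intro!: finite_PiE)
    also have "\<dots> \<le> card (S L) + card (\<Union>j\<in>L. A \<rightarrow>\<^sub>E (L - {j}))" by (rule card_Un_le)
    also have "card (\<Union>j\<in>L. A \<rightarrow>\<^sub>E (L - {j})) \<le> (\<Sum>j\<in>L. card (A \<rightarrow>\<^sub>E (L - {j})))"
      using finL[OF L] by (rule card_UN_le)
    also have "\<dots> = (\<Sum>j\<in>L. (q - 1) ^ card A)"
      using A L finL[OF L] by (intro sum.cong) (auto simp: card_funcsetE \<L>_def)
    also have "card (A \<rightarrow>\<^sub>E L) = q ^ card A" using A L by (simp add: card_funcsetE \<L>_def)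
    finally have "q ^ card A \<le> card (S L) + q * (q - 1) ^ card A" using L by (simp add: \<L>_def)
    then have "real (q ^ card A) \<le> real (card (S L) + q * (q - 1) ^ card A)" by (simp only: of_nat_le_iff)
    then show ?thesis using q by (simp add: of_nat_diff)
  qed
  have "real (r choose q) * (real q ^ card A - real q * (real q - 1) ^ card A) =
      (\<Sum>L\<in>\<L>. real q ^ card A - real q * (real q - 1) ^ card A)" by (simp add: cL)
  also have "\<dots> \<le> (\<Sum>L\<in>\<L>. real (card (S L)))" by (rule sum_mono[OF SL])
  also have "\<dots> = real (card (\<Union>L\<in>\<L>. S L))"
    using fin finS by (subst card_UN_disjoint) (auto simp: S_def)
  also have "\<dots> \<le> real (card ?F)"
  proof (intro of_nat_mono card_mono)
    show "finite ?F"
      by (rule finite_subset[OF _ finite_PiE[OF A, of "\<lambda>_. {1..r}"]]) auto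
    show "(\<Union>L\<in>\<L>. S L) \<subseteq> ?F"
    proof
      fix c assume "c \<in> (\<Union>L\<in>\<L>. S L)"
      then obtain L where L: "L \<subseteq> {1..r}" "card L = q" and c: "c \<in> A \<rightarrow>\<^sub>E L" "c ` A = L"
        by (auto simp: \<L>_def S_def)
      have "c \<in> A \<rightarrow>\<^sub>E {1..r}" using PiE_mem[OF c(1)] PiE_arb[OF c(1)] L(1) by (intro PiE_I) blast+
      then show "c \<in> ?F" using c L by simp
    qed
  qed
  finally show ?thesis .
qed

definition palette_asymptotics :: "nat \<Rightarrow> nat \<Rightarrow> nat \<Rightarrow> real \<Rightarrow> (int ^ 'd) set \<Rightarrow> bool" where
  "palette_asymptotics k h r \<epsilon> A \<longleftrightarrow>
    (1 - \<epsilon>) * real (r choose (k * h - 1)) * real (k * h - 1) ^ card A \<le> real (num_rainbow_free k h r A) \<and>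
    real (num_rainbow_free k h r A) \<le> (1 + \<epsilon>) * real (r choose (k * h - 1)) * real (k * h - 1) ^ card A \<and>
    real (card {c \<in> rainbow_free_colorings k h r A. \<not> card (c ` A) \<le> k * h - 1}) \<le> \<epsilon> * real (num_rainbow_free k h r A)"

text \<open>Colorings with fewer than kh colors are automatically rainbow-free, so the count is
  exactly F + M with M the multicolored ones. The density \<delta> precedes \<epsilon>, because the
  bound on M decays at a fixed exponential rate and \<epsilon> only affects how large n must
  be.\<close>

lemma dense_sets_asymptotics:
  assumes k: "k \<ge> 2" and h: "h \<ge> 2" and r: "r \<ge> k * h"
  shows "\<exists>\<delta>>0. \<forall>\<epsilon>::real>0. \<exists>n0. \<forall>n\<ge>n0. \<forall>A\<subseteq>(grid n :: (int ^ 'd::finite) set).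
    (1 - \<delta>) * real (n ^ CARD('d)) \<le> real (card A) \<longrightarrow>
      palette_asymptotics k h r \<epsilon> A"
proof -
  define q where "q = k * h - 1"
  have "2 * 2 \<le> k * h" using k h by (intro mult_le_mono)
  then have q: "q \<ge> 3" "q < k * h" "q \<le> r" "k * h = q + 1" using r by (simp_all add: q_def)
  define R where "R = real (r choose q)"
  have "r choose q > 0" using q by simp
  then have R: "R \<ge> 1" unfolding R_def by linarith
  obtain \<delta>0 \<kappa> n1 where par: "\<delta>0 > 0" "0 < \<kappa>" "\<kappa> < 1" and many: "\<forall>n\<ge>n1. \<forall>A\<subseteq>(grid n :: (int ^ 'd) set).
    (1 - \<delta>0) * real (n ^ CARD('d)) \<le> real (card A) \<longrightarrow>
    real (card {c \<in> rainbow_free_colorings k h r A. \<not> card (c ` A) \<le> k * h - 1})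
      \<le> 2 * real (k * h - 1) ^ card A * \<kappa> ^ (n ^ CARD('d))"
    using multicolored_few[OF k h r, where 'd = 'd] by (elim exE conjE)
  \<comment> \<open>The cap 1/2 forces |A| to be at least N/2, hence to grow, which makes the
    correction \<open>\<theta> ^ card A\<close> in the lower bound negligible.\<close>
  define \<delta> where "\<delta> = min \<delta>0 (1/2)"
  have \<delta>: "\<delta> > 0" "\<delta> \<le> \<delta>0" "\<delta> \<le> 1/2" using par by (simp_all add: \<delta>_def)
  define \<theta> where "\<theta> = (real q - 1) / real q"
  have \<theta>: "0 \<le> \<theta>" "\<theta> < 1" using q by (simp_all add: \<theta>_def)
  show ?thesis
  proof (intro exI[of _ \<delta>] conjI allI impI)
    fix \<epsilon> :: real assume \<epsilon>: "\<epsilon> > 0"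
    \<comment> \<open>The cap 1/2 keeps the total at least Q/2, so that M, which is at most e/2 * Q,
      is a fraction at most \<epsilon> of it even for large \<epsilon>.\<close>
    define e where "e = min \<epsilon> (1/2)"
    have e: "e > 0" "e \<le> \<epsilon>" "e \<le> 1/2" using \<epsilon> by (simp_all add: e_def)
    obtain m1 where m1: "\<And>j. j \<ge> m1 \<Longrightarrow> \<kappa> ^ j \<le> e / 4" using power_le_eventually[of \<kappa> "e / 4"] par e by auto
    obtain m2 where m2: "\<And>j. j \<ge> m2 \<Longrightarrow> \<theta> ^ j \<le> e / real q" using power_le_eventually[of \<theta> "e / real q"] \<theta> e q by auto
    show "\<exists>n0. \<forall>n\<ge>n0. \<forall>A\<subseteq>(grid n :: (int ^ 'd) set). (1 - \<delta>) * real (n ^ CARD('d)) \<le> real (card A) \<longrightarrow>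
      palette_asymptotics k h r \<epsilon> A"
    proof (intro exI[of _ "max n1 (max m1 (2 * m2))"] allI impI)
      fix n and A :: "(int ^ 'd) set"
      assume n: "max n1 (max m1 (2 * m2)) \<le> n" and A: "A \<subseteq> grid n" and dense: "(1 - \<delta>) * real (n ^ CARD('d)) \<le> real (card A)"
      define N where "N = n ^ CARD('d)"
      have nN: "n \<le> N" unfolding N_def by (rule grid_power_ge)
      have finA: "finite A" using A finite_subset finite_grid by blast
      define Q where "Q = real q ^ card A"
  let ?M = "{c \<in> rainbow_free_colorings k h r A. \<not> card (c ` A) \<le> q}"
  let ?F = "{c \<in> A \<rightarrow>\<^sub>E {1..r}. card (c ` A) \<le> q}"
      have Q: "Q > 0" using q by (simp add: Q_def)
      have "1/2 * real N \<le> (1 - \<delta>) * real N" using \<delta> by (intro mult_right_mono) auto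
      then have "1/2 * real N \<le> real (card A)" using dense unfolding N_def by linarith
      moreover have "2 * m2 \<le> N" using n nN by simp
      then have "real (2 * m2) \<le> real N" by (rule of_nat_mono)
      ultimately have Am2: "m2 \<le> card A" by simp
      define M where "M = real (card ?M)"
      define F where "F = real (card ?F)"
      have "(1 - \<delta>0) * real N \<le> (1 - \<delta>) * real N" using \<delta> by (intro mult_right_mono) auto
      then have "(1 - \<delta>0) * real (n ^ CARD('d)) \<le> real (card A)" using dense unfolding N_def by linarith
      then have "M \<le> 2 * Q * \<kappa> ^ N"
        using many n A unfolding M_def Q_def N_def q_def by simp
      also have "\<dots> \<le> 2 * Q * (e / 4)" using Q nN n by (intro mult_left_mono m1) auto
      finally have M: "M \<le> e / 2 * Q" by (simp add: mult.commute)
      have "rainbow_free_colorings k h r A = ?M \<union> ?F"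
        using few_colors_rainbow_free[OF _ _ finA, of _ r k h] q(4)
        by (auto simp: rainbow_free_colorings_def less_Suc_eq_le)
      moreover have "card (?M \<union> ?F)
        = card ?M + card ?F"
      proof (rule card_Un_disjoint)
        show "finite ?F"
          by (rule finite_subset[OF _ finite_PiE[OF finA, of "\<lambda>_. {1..r}"]]) auto
      qed (use finite_rainbow_free_colorings[OF finA] in auto)
      ultimately have g: "real (num_rainbow_free k h r A) = M + F"
        unfolding num_rainbow_free_def M_def F_def by simp
      have "F \<le> real ((r choose q) * q ^ card A)"
        unfolding F_def using card_few_colors_le[OF finA q(3)] by (simp only: of_nat_le_iff)
      then have F1: "F \<le> R * Q" by (simp add: R_def Q_def)
      have F2: "(1 - e) * (R * Q) \<le> F"
      proof -
        have "real q * (real q - 1) ^ card A = real q * (Q * \<theta> ^ card A)"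
          using q by (simp add: Q_def \<theta>_def power_divide)
        also have "\<dots> \<le> real q * (Q * (e / real q))"
          using Q m2[OF Am2] by (intro mult_left_mono) auto
        also have "\<dots> = e * Q" using q by simp
        finally have "(1 - e) * Q \<le> Q - real q * (real q - 1) ^ card A" by (simp add: algebra_simps)
        then have "R * ((1 - e) * Q) \<le> R * (Q - real q * (real q - 1) ^ card A)"
          using R by (intro mult_left_mono) auto
        also have "\<dots> \<le> F" unfolding F_def Q_def R_def using q by (intro card_few_colors_ge[OF finA]) simp
        finally show ?thesis by (simp add: mult_ac)
      qed
      have M0: "M \<ge> 0" by (simp add: M_def)
      have RQ: "Q \<le> R * Q" using R Q by simp
      have low: "(1 - \<epsilon>) * R * Q \<le> M + F"
      proof -
        have "(1 - \<epsilon>) * (R * Q) \<le> (1 - e) * (R * Q)" using e RQ Q by (intro mult_right_mono) auto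
        then show ?thesis using F2 M0 by (simp add: mult.assoc)
      qed
      have up: "M + F \<le> (1 + \<epsilon>) * R * Q"
      proof -
        have "e / 2 * Q \<le> \<epsilon> * (R * Q)" using e \<epsilon> Q RQ by (intro mult_mono) auto
        then show ?thesis using M F1 by (simp add: algebra_simps)
      qed
      have ratio: "M \<le> \<epsilon> * (M + F)"
      proof -
        have "1/2 * (R * Q) \<le> (1 - e) * (R * Q)" using e RQ Q by (intro mult_right_mono) auto
        then have "1/2 * Q \<le> M + F" using F2 M0 RQ by linarith
        then have "\<epsilon> * (1/2 * Q) \<le> \<epsilon> * (M + F)" using \<epsilon> by (intro mult_left_mono) auto
        moreover have "e / 2 * Q \<le> \<epsilon> / 2 * Q" using e Q by (intro mult_right_mono) auto
        ultimately show ?thesis using M by simp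
      qed
      show "palette_asymptotics k h r \<epsilon> A"
        using low up ratio unfolding palette_asymptotics_def g M_def R_def Q_def q_def by blast
    qed
  qed (rule \<delta>(1))
qed

lemma log_density_threshold:
  assumes "\<delta> > 0"
  shows "\<exists>n0. \<forall>n\<ge>n0. (1 - \<delta>) * real (n ^ D) \<le> real n ^ D - real n ^ D / log 2 (real n)"
proof -
  define n0 where "n0 = nat \<lceil>2 powr (1 / \<delta>)\<rceil>"
  have "(1 - \<delta>) * real (n ^ D) \<le> real n ^ D - real n ^ D / log 2 (real n)" if "n \<ge> n0" for n
  proof -
    have p: "2 powr (1 / \<delta>) \<le> real n" using that unfolding n0_def by linarith
    have n: "real n > 0" using p by (smt (verit) powr_gt_zero)
    have "1 / \<delta> \<le> log 2 (real n)" using p n by (simp add: le_log_iff)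
    then have "1 \<le> \<delta> * log 2 (real n)" using assms by (simp add: divide_le_eq mult.commute)
    moreover have "log 2 (real n) > 0" using \<open>1 / \<delta> \<le> log 2 (real n)\<close> assms by (smt (verit) zero_less_divide_1_iff)
    ultimately have "1 / log 2 (real n) \<le> \<delta>" by (simp add: divide_le_eq)
    then have "real n ^ D * (1 / log 2 (real n)) \<le> real n ^ D * \<delta>" by (intro mult_left_mono) auto
    then show ?thesis by (simp add: algebra_simps)
  qed
  then show ?thesis by blast
qed

text \<open>A dense proper subset misses a point and so loses a factor q, at least 3, which beats
  the two error factors: 5/4 divided by 3 is below 3/4. A sparse subset has an exponentially smaller
  palette term, and the crude bound suffices.\<close>

lemma grid_unique_maximizer:
  assumes k: "k \<ge> 2" and h: "h \<ge> 2" and r: "r \<ge> k * h"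
  shows "\<exists>n0. \<forall>n\<ge>n0. \<forall>A. A \<subset> (grid n :: (int ^ 'd::finite) set) \<longrightarrow>
    num_rainbow_free k h r A < num_rainbow_free k h r (grid n :: (int ^ 'd) set)"
proof -
  define q where "q = k * h - 1"
  have "2 * 2 \<le> k * h" using k h by (intro mult_le_mono)
  then have q: "q \<ge> 3" "q \<le> r" using r by (simp_all add: q_def)
  define R where "R = real (r choose q)"
  have "r choose q > 0" using q by simp
  then have R: "R \<ge> 1" unfolding R_def by linarith
  obtain \<delta> where \<delta>: "\<delta> > 0" and asy: "\<forall>\<epsilon>::real>0. \<exists>n0. \<forall>n\<ge>n0. \<forall>A\<subseteq>(grid n :: (int ^ 'd) set).
    (1 - \<delta>) * real (n ^ CARD('d)) \<le> real (card A) \<longrightarrow>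
      palette_asymptotics k h r \<epsilon> A"
    using dense_sets_asymptotics[OF k h r, where 'd = 'd] by (elim exE conjE)
  have quarter: "(0::real) < 1/4" by simp
  obtain n1 where n1: "\<forall>n\<ge>n1. \<forall>A\<subseteq>(grid n :: (int ^ 'd) set).
    (1 - \<delta>) * real (n ^ CARD('d)) \<le> real (card A) \<longrightarrow>
      (1 - 1/4) * R * real q ^ card A \<le> real (num_rainbow_free k h r A) \<and>
      real (num_rainbow_free k h r A) \<le> (1 + 1/4) * R * real q ^ card A"
    using asy[THEN spec, THEN mp, OF quarter] unfolding palette_asymptotics_def R_def q_def by blast
  \<comment> \<open>Since b^2 = q^\<delta>, a sparse A has q^|A| at most q^N / b^(2N). One factor
    b^N cancels the crude bound's loss, the other beats its constant 2^r + 1.\<close>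
  define b where "b = real q powr (\<delta> / 2)"
  have b: "b > 1" unfolding b_def using q \<delta> by (intro gr_one_powr) auto
  obtain n2 where n2: "\<forall>n\<ge>n2. \<forall>A\<subseteq>(grid n :: (int ^ 'd) set).
    real (num_rainbow_free k h r A) \<le> (2 ^ r + 1) * (b ^ (n ^ CARD('d)) * real q ^ card A)"
    using rainbow_free_crude_bound[OF k h r b, where 'd = 'd] unfolding q_def by (elim exE)
  have pos: "(2 ^ r + 1 :: real) > 0" by (simp add: add_pos_pos)
  have "(1::real) / (2 * (2 ^ r + 1)) > 0" using pos by simp
  then obtain m where m: "\<And>j. j \<ge> m \<Longrightarrow> (1 / b) ^ j \<le> 1 / (2 * (2 ^ r + 1))"
    using power_le_eventually[of "1 / b" "1 / (2 * (2 ^ r + 1))"] b by auto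
  have "num_rainbow_free k h r A < num_rainbow_free k h r (grid n :: (int ^ 'd) set)"
    if n: "n \<ge> max n1 (max n2 m)" and A: "A \<subset> (grid n :: (int ^ 'd) set)" for n A
  proof -
    define N where "N = n ^ CARD('d)"
    have nN: "n \<le> N" unfolding N_def by (rule grid_power_ge)
    have cG: "card (grid n :: (int ^ 'd) set) = N" by (simp add: card_grid N_def)
    have cA: "card A < N" using psubset_card_mono[OF finite_grid A] cG by simp
    have "(1 - \<delta>) * real N \<le> real N" using \<delta> by (simp add: algebra_simps)
    then have G: "3/4 * (R * real q ^ N) \<le> real (num_rainbow_free k h r (grid n :: (int ^ 'd) set))"
      using n1[THEN spec, THEN mp, THEN spec, THEN mp, THEN mp, of n "grid n"] n cG
      unfolding N_def by (simp add: mult.assoc)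
    have Q: "real q ^ N > 0" using q by simp
    have RQ: "real q ^ N \<le> R * real q ^ N" using R Q by simp
    show ?thesis
    proof (cases "(1 - \<delta>) * real N \<le> real (card A)")
      case True
      then have "real (num_rainbow_free k h r A) \<le> 5/4 * (R * real q ^ card A)"
        using n1[THEN spec, THEN mp, THEN spec, THEN mp, THEN mp, of n A] n A
        unfolding N_def by (simp add: mult.assoc psubset_imp_subset)
      also have "\<dots> \<le> 5/4 * (R * real q ^ (N - 1))"
        using cA q R by (intro mult_left_mono power_increasing) auto
      also have "\<dots> = 5/4 * (R * real q ^ N) / real q"
        using cA q by (cases N) auto
      also have "\<dots> \<le> 5/4 * (R * real q ^ N) / 3" using q R by (intro divide_left_mono) auto
      also have "\<dots> < 3/4 * (R * real q ^ N)" using RQ Q by simp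
      finally show ?thesis using G by linarith
    next
      case False
      have "real q ^ card A = real q powr real (card A)" using q by (simp add: powr_realpow)
      also have "\<dots> \<le> real q powr ((1 - \<delta>) * real N)" using False q by (intro powr_mono) auto
      also have "\<dots> = real q powr (real N) / (b powr real N) / (b powr real N)"
        unfolding b_def powr_powr powr_diff[symmetric] by (simp add: algebra_simps)
      also have "\<dots> = real q ^ N / b ^ N / b ^ N" using q b by (simp add: powr_realpow)
      finally have "b ^ N * real q ^ card A \<le> b ^ N * (real q ^ N / b ^ N / b ^ N)"
        using b by (intro mult_left_mono) auto
      also have "\<dots> = real q ^ N * (1 / b) ^ N" using b by (simp add: power_divide)
      also have "\<dots> \<le> real q ^ N * (1 / (2 * (2 ^ r + 1)))" using n nN Q by (intro mult_left_mono m) auto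
      finally have "(2 ^ r + 1) * (b ^ N * real q ^ card A) \<le> (2 ^ r + 1) * (real q ^ N * (1 / (2 * (2 ^ r + 1))))"
        using pos by (intro mult_left_mono) auto
      also have "\<dots> = 1/2 * real q ^ N" using pos by (simp add: field_simps)
      also have "\<dots> < 3/4 * (R * real q ^ N)" using RQ Q by linarith
      finally show ?thesis using G n2 n A unfolding N_def by (smt (verit) max.bounded_iff of_nat_less_iff psubset_imp_subset)
    qed
  qed
  then show ?thesis by blast
qed

theorem theorem1p1:
  fixes k h r :: nat
  assumes "k \<ge> 2" and "h \<ge> 2" and "r \<ge> k * h"
  shows
    "(\<forall>\<epsilon>::real>0. \<exists>n0. \<forall>n\<ge>n0. \<forall>A \<subseteq> (grid n :: (int ^ 'd::finite) set).
        real (card A) \<ge> real n ^ CARD('d) - real n ^ CARD('d) / log 2 (real n) \<longrightarrow>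
          (1 - \<epsilon>) * real (r choose (k * h - 1)) * real (k * h - 1) ^ card A \<le> real (num_rainbow_free k h r A) \<and>
          real (num_rainbow_free k h r A) \<le> (1 + \<epsilon>) * real (r choose (k * h - 1)) * real (k * h - 1) ^ card A)
     \<and>
     (\<forall>\<epsilon>::real>0. \<exists>n0. \<forall>n\<ge>n0. \<forall>A \<subseteq> (grid n :: (int ^ 'd) set).
        real (card A) \<ge> real n ^ CARD('d) - real n ^ CARD('d) / log 2 (real n) \<longrightarrow>
          real (card {c \<in> rainbow_free_colorings k h r A. \<not> card (c ` A) \<le> k * h - 1})
            \<le> \<epsilon> * real (num_rainbow_free k h r A))
     \<and>
     (\<exists>n0. \<forall>n\<ge>n0. \<forall>A. A \<subset> (grid n :: (int ^ 'd) set) \<longrightarrow> num_rainbow_free k h r A < num_rainbow_free k h r (grid n :: (int ^ 'd) set))"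
proof -
  obtain \<delta> where \<delta>: "\<delta> > 0" and asy: "\<forall>\<epsilon>::real>0. \<exists>n0. \<forall>n\<ge>n0. \<forall>A\<subseteq>(grid n :: (int ^ 'd) set).
    (1 - \<delta>) * real (n ^ CARD('d)) \<le> real (card A) \<longrightarrow>
      palette_asymptotics k h r \<epsilon> A"
    using dense_sets_asymptotics[OF assms, where 'd = 'd] by (elim exE conjE)
  obtain n1 where n1: "\<forall>n\<ge>n1. (1 - \<delta>) * real (n ^ CARD('d)) \<le> real n ^ CARD('d) - real n ^ CARD('d) / log 2 (real n)"
    using log_density_threshold[OF \<delta>, of "CARD('d)"] by (elim exE)
  have dense: "\<exists>n0. \<forall>n\<ge>n0. \<forall>A\<subseteq>(grid n :: (int ^ 'd) set).
    real (card A) \<ge> real n ^ CARD('d) - real n ^ CARD('d) / log 2 (real n) \<longrightarrow>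
      palette_asymptotics k h r \<epsilon> A"
    if \<epsilon>: "\<epsilon> > 0" for \<epsilon> :: real
  proof -
    obtain n2 where n2: "\<forall>n\<ge>n2. \<forall>A\<subseteq>(grid n :: (int ^ 'd) set).
    (1 - \<delta>) * real (n ^ CARD('d)) \<le> real (card A) \<longrightarrow>
      palette_asymptotics k h r \<epsilon> A"
      using asy \<epsilon> by blast
    show ?thesis
    proof (intro exI[of _ "max n1 n2"] allI impI)
      fix n and A :: "(int ^ 'd) set"
      assume n: "max n1 n2 \<le> n" and A: "A \<subseteq> grid n"
        and "real n ^ CARD('d) - real n ^ CARD('d) / log 2 (real n) \<le> real (card A)"
      moreover have "(1 - \<delta>) * real (n ^ CARD('d)) \<le> real n ^ CARD('d) - real n ^ CARD('d) / log 2 (real n)"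
        using n1 n by simp
      ultimately have d: "(1 - \<delta>) * real (n ^ CARD('d)) \<le> real (card A)" by linarith
      have "n2 \<le> n" using n by simp
      from n2[THEN spec, THEN mp, OF this, THEN spec, THEN mp, OF A, THEN mp, OF d]
      show "palette_asymptotics k h r \<epsilon> A" .
    qed
  qed
  show ?thesis
  proof (intro conjI)
    show "\<forall>\<epsilon>::real>0. \<exists>n0. \<forall>n\<ge>n0. \<forall>A \<subseteq> (grid n :: (int ^ 'd) set).
        real (card A) \<ge> real n ^ CARD('d) - real n ^ CARD('d) / log 2 (real n) \<longrightarrow>
          (1 - \<epsilon>) * real (r choose (k * h - 1)) * real (k * h - 1) ^ card A \<le> real (num_rainbow_free k h r A) \<and>
          real (num_rainbow_free k h r A) \<le> (1 + \<epsilon>) * real (r choose (k * h - 1)) * real (k * h - 1) ^ card A"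
      using dense unfolding palette_asymptotics_def by meson
    show "\<forall>\<epsilon>::real>0. \<exists>n0. \<forall>n\<ge>n0. \<forall>A \<subseteq> (grid n :: (int ^ 'd) set).
        real (card A) \<ge> real n ^ CARD('d) - real n ^ CARD('d) / log 2 (real n) \<longrightarrow>
          real (card {c \<in> rainbow_free_colorings k h r A. \<not> card (c ` A) \<le> k * h - 1})
            \<le> \<epsilon> * real (num_rainbow_free k h r A)"
      using dense unfolding palette_asymptotics_def by meson
    show "\<exists>n0. \<forall>n\<ge>n0. \<forall>A. A \<subset> (grid n :: (int ^ 'd) set) \<longrightarrow> num_rainbow_free k h r A < num_rainbow_free k h r (grid n :: (int ^ 'd) set)"
      by (rule grid_unique_maximizer[OF assms])
  qed
qed

end
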